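(* Let $p\in\mathbb{R}$, $q\ge0$. Assume that $(M,J,g)$ is Kählerian of dimension $2k$ and that $L$ is totally geodesic. Then the almost Hermitian manifold $(T^\perp L,\tilde J,h_{p,q})$ is locally conformal almost Kählerian, i.e. $$d\varphi=\alpha\wedge\varphi,$$ where $\varphi(A,B)=h_{p,q}(A,\tilde JB)$ is its fundamental form and $\alpha$ is the one-form on $T^\perp L$ determined by $$\alpha(X^h)=0,\qquad\alpha_\theta(\xi^v)=-\left(p\,\omega_\theta-\frac{q}{1+\sqrt{1+q\langle\theta,\theta\rangle^\perp}}\right)\langle\xi,\theta\rangle^\perp.$$ In particular, $(T^\perp L,\tilde J,h_{p,q})$ is almost Kählerian (i.e. $d\varphi=0$) if and only if $p=q=0$.
   Context: All objects are smooth. $(M,g)$ is a Riemannian manifold of dimension $2k$ with an almost complex structure $J$ compatible with $g$ (i.e. $g(JU,JV)=g(U,V)$); Kählerian means that in addition $J$ is parallel for the Levi-Civita connection of $g$. $L\subset M$ is a $k$-dimensional totally real submanifold in the sense that for every $x\in L$, $T_xM$ is the orthogonal direct sum of $T_xL$ and $J(T_xL)$ (so $J$ interchanges $T_xL$ and $T_x^\perp L$). $\langle\cdot,\cdot\rangle$ is the metric induced by $g$ on $L$; $\pi:T^\perp L\to L$ is the normal bundle with fibre metric $\langle\cdot,\cdot\rangle^\perp$ induced by $g$, and normal connection $\nabla^\perp$. The connection map $K:T(T^\perp L)\to T^\perp L$ is the unique bundle morphism such that $K:T_\theta(T^\perp_xL)\to T^\perp_xL$ is the canonical isomorphism for $\theta\in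 T_x^\perp L$, and $K(\xi_*X)=\nabla^\perp_X\xi$ for every section $\xi$ of $T^\perp L$ and vector field $X$ on $L$. $X^h$ is the horizontal lift of $X$ ($KX^h=0$, $\pi_*X^h=X$), $\xi^v$ the vertical lift of $\xi$ ($\pi_*\xi^v=0$, $K\xi^v=\xi$), $\Theta$ the vertical vector field with $K(\Theta_\theta)=\theta$, and $J^h_\theta=(J\theta)^h_\theta$. With $\omega_\theta=\frac{1}{1+\langle\theta,\theta\rangle^\perp}$, the $(p,q)$-metric on $T^\perp L$ is $$h_{p,q}(A,B)=\langle\pi_*A,\pi_*B\rangle+\omega_\theta^p\big(\langle KA,KB\rangle^\perp+q\langle KA,\theta\rangle^\perp\langle KB,\theta\rangle^\perp\big),\quad A,B\in T_\theta(T^\perp L).$$ The almost complex structure $\tilde J$ on $T^\perp L$ (compatible with $h_{p,q}$) is given by $$(\tilde J\xi^v)_\theta=\omega_\theta^{p/2}\left((J\xi)^h_\theta+\frac{q}{1+\sqrt{1+q\langle\theta,\theta\rangle^\perp}}\langle\xi,\theta\rangle^\perp J^h_\theta\right),\quad (\tilde JX^h)_\theta=\omega_\theta^{-p/2}\left((JX)^v_\theta-\frac{q\,\langle JX,\theta\rangle^\perp}{1+q\langle\theta,\theta\rangle^\perp+\sqrt{1+q\langle\theta,\theta\rangle^\perp}}\Theta_\theta\right).$$ Conventions: $(\alpha\wedge\varphi)(A,B,C)=\alpha(A)\varphi(B,C)-\alpha(B)\varphi(A,C)+\alpha(C)\varphi(A,B)$, and $d\varphi(A,B,C)=A\varphi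(B,C)-B\varphi(A,C)+C\varphi(A,B)+\varphi([A,C],B)-\varphi([A,B],C)-\varphi([B,C],A)$.
   Formalization: The printed sign of the q-term in α is wrong for q>0, k≥2; the theorem proved has α(ξ^v) = −(pω + q/(1+√(1+q⟨θ,θ⟩)))⟨ξ,θ⟩. The equivalence "dφ=0 iff p=q=0" is stated for k≥2 and L nonempty, since for k=1 every 3-form on T^⊥L vanishes. *)

theory Defs
  imports "HOL-Analysis.Analysis"
begin

section \<open>Smooth functions between Euclidean spaces\<close>

primrec Ck_on :: "nat \<Rightarrow> 'a::euclidean_space set \<Rightarrow> ('a \<Rightarrow> 'b::real_normed_vector) \<Rightarrow> bool" where
  "Ck_on 0 S f \<longleftrightarrow> continuous_on S f"
| "Ck_on (Suc n) S f \<longleftrightarrow> (\<forall>x\<in>S. f differentiable (at x)) \<and>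
     (\<forall>v. Ck_on n S (\<lambda>x. frechet_derivative f (at x) v))"

text \<open>Used for open \<open>S\<close> only.\<close>
definition smooth_on :: "'a::euclidean_space set \<Rightarrow> ('a \<Rightarrow> 'b::real_normed_vector) \<Rightarrow> bool" where
  "smooth_on S f \<longleftrightarrow> (\<forall>n. Ck_on n S f)"


section \<open>Smooth manifolds\<close>

text \<open>
  A chart is a pair of a domain and a coordinate map; the values of the coordinate map outside the
  domain are irrelevant. A manifold is given by an atlas, its underlying set being the union
  of the chart domains. The dimension is that of the Euclidean model space \<open>'e\<close>.
\<close>

type_synonym ('m, 'e) chart = "'m set \<times> ('m \<Rightarrow> 'e)"
type_synonym ('m, 'e) atlas = "('m, 'e) chart set"

definition points :: "('m, 'e) atlas \<Rightarrow> 'm set" where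
  "points \<A> = (\<Union>C\<in>\<A>. fst C)"

definition chart_inv :: "('m, 'e) chart \<Rightarrow> 'e \<Rightarrow> 'm" where
  "chart_inv C = inv_into (fst C) (snd C)"

definition compatible :: "('m, 'e::euclidean_space) chart \<Rightarrow> ('m, 'e) chart \<Rightarrow> bool" where
  "compatible C D \<longleftrightarrow> open (snd C ` (fst C \<inter> fst D)) \<and>
     smooth_on (snd C ` (fst C \<inter> fst D)) (snd D \<circ> chart_inv C)"

definition smooth_atlas :: "('m, 'e::euclidean_space) atlas \<Rightarrow> bool" where
  "smooth_atlas \<A> \<longleftrightarrow> (\<forall>C\<in>\<A>. inj_on (snd C) (fst C)) \<and> (\<forall>C\<in>\<A>. \<forall>D\<in>\<A>. compatible C D)"

definition max_atlas :: "('m, 'e::euclidean_space) atlas \<Rightarrow> ('m, 'e) atlas" where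
  "max_atlas \<A> = {C. fst C \<subseteq> points \<A> \<and> inj_on (snd C) (fst C) \<and>
     (\<forall>D\<in>\<A>. compatible C D \<and> compatible D C)}"

definition mtop :: "('m, 'e::euclidean_space) atlas \<Rightarrow> 'm topology" where
  "mtop \<A> = topology (\<lambda>W. W \<subseteq> points \<A> \<and> (\<forall>C\<in>\<A>. open (snd C ` (W \<inter> fst C))))"

definition smooth_manifold :: "('m, 'e::euclidean_space) atlas \<Rightarrow> bool" where
  "smooth_manifold \<A> \<longleftrightarrow> smooth_atlas \<A> \<and> Hausdorff_space (mtop \<A>) \<and> second_countable (mtop \<A>)"

definition smooth_near :: "('m, 'e::euclidean_space) atlas \<Rightarrow> 'm \<Rightarrow> ('m \<Rightarrow> real) \<Rightarrow> bool" where
  "smooth_near \<A> x f \<longleftrightarrow> (\<exists>C\<in>\<A>. \<exists>S. x \<in> fst C \<and> open S \<and> snd C x \<in> S \<and> S \<subseteq> snd C ` fst C \<and>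
     smooth_on S (f \<circ> chart_inv C))"


section \<open>Tangent vectors and vector fields\<close>

text \<open>
  A tangent vector at \<open>x\<close> is a directional derivative in a chart, regarded as a functional on
  the functions that are smooth near \<open>x\<close>. The value \<open>0\<close> on all other functions makes equality of
  functionals coincide with equality of tangent vectors, and the vector space structure is the
  pointwise one.
\<close>

type_synonym 'm tvec = "('m \<Rightarrow> real) \<Rightarrow> real"

abbreviation (input) vzero :: "'m tvec" where
  "vzero \<equiv> (\<lambda>f. 0)"

definition vadd :: "'m tvec \<Rightarrow> 'm tvec \<Rightarrow> 'm tvec" (infixl "\<boxplus>" 65) where
  "u \<boxplus> v = (\<lambda>f. u f + v f)"

definition vscale :: "real \<Rightarrow> 'm tvec \<Rightarrow> 'm tvec" (infixr "\<bullet>\<^sub>t" 75) where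
  "a \<bullet>\<^sub>t v = (\<lambda>f. a * v f)"

definition chart_vec :: "('m, 'e::euclidean_space) atlas \<Rightarrow> ('m, 'e) chart \<Rightarrow> 'm \<Rightarrow> 'e \<Rightarrow> 'm tvec" where
  "chart_vec \<A> C x w = (\<lambda>f. if smooth_near \<A> x f
     then frechet_derivative (f \<circ> chart_inv C) (at (snd C x)) w else 0)"

definition tangent :: "('m, 'e::euclidean_space) atlas \<Rightarrow> 'm \<Rightarrow> 'm tvec set" where
  "tangent \<A> x = {chart_vec \<A> C x w | C w. C \<in> \<A> \<and> x \<in> fst C}"

definition smooth_field :: "('m, 'e::euclidean_space) atlas \<Rightarrow> 'm set \<Rightarrow> ('m \<Rightarrow> 'm tvec) \<Rightarrow> bool" where
  "smooth_field \<A> W X \<longleftrightarrow> openin (mtop \<A>) W \<and> (\<forall>x\<in>W. X x \<in> tangent \<A> x \<and>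
     (\<forall>f. smooth_near \<A> x f \<longrightarrow> smooth_near \<A> x (\<lambda>y. X y f)))"

definition lie_bracket ::
  "('m, 'e::euclidean_space) atlas \<Rightarrow> ('m \<Rightarrow> 'm tvec) \<Rightarrow> ('m \<Rightarrow> 'm tvec) \<Rightarrow> 'm \<Rightarrow> 'm tvec" where
  "lie_bracket \<A> X Y x = (\<lambda>f. if smooth_near \<A> x f
     then X x (\<lambda>y. Y y f) - Y x (\<lambda>y. X y f) else 0)"

text \<open>\<open>push \<B> F x v\<close> is \<open>F\<^sub>* v\<close> for \<open>v\<close> tangent at \<open>x\<close>, where \<open>\<B>\<close> is the atlas of the target of \<open>F\<close>.\<close>
definition push :: "('n, 'f::euclidean_space) atlas \<Rightarrow> ('m \<Rightarrow> 'n) \<Rightarrow> 'm \<Rightarrow> 'm tvec \<Rightarrow> 'n tvec" where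
  "push \<B> F x v = (\<lambda>f. if smooth_near \<B> (F x) f then v (f \<circ> F) else 0)"


section \<open>Differential forms\<close>

definition one_form :: "('m, 'e::euclidean_space) atlas \<Rightarrow> ('m \<Rightarrow> 'm tvec \<Rightarrow> real) \<Rightarrow> bool" where
  "one_form \<A> \<alpha> \<longleftrightarrow>
     (\<forall>x\<in>points \<A>. \<forall>u\<in>tangent \<A> x. \<forall>v\<in>tangent \<A> x. \<forall>a b.
        \<alpha> x (a \<bullet>\<^sub>t u \<boxplus> b \<bullet>\<^sub>t v) = a * \<alpha> x u + b * \<alpha> x v) \<and>
     (\<forall>W X. smooth_field \<A> W X \<longrightarrow> (\<forall>x\<in>W. smooth_near \<A> x (\<lambda>y. \<alpha> y (X y))))"

definition ext_deriv2 :: "('m, 'e::euclidean_space) atlas \<Rightarrow> ('m \<Rightarrow> 'm tvec \<Rightarrow> 'm tvec \<Rightarrow> real) \<Rightarrow>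
    ('m \<Rightarrow> 'm tvec) \<Rightarrow> ('m \<Rightarrow> 'm tvec) \<Rightarrow> ('m \<Rightarrow> 'm tvec) \<Rightarrow> 'm \<Rightarrow> real" where
  "ext_deriv2 \<A> \<phi> A B C x =
     A x (\<lambda>y. \<phi> y (B y) (C y)) - B x (\<lambda>y. \<phi> y (A y) (C y)) + C x (\<lambda>y. \<phi> y (A y) (B y))
     + \<phi> x (lie_bracket \<A> A C x) (B x) - \<phi> x (lie_bracket \<A> A B x) (C x)
     - \<phi> x (lie_bracket \<A> B C x) (A x)"

definition wedge12 :: "('m \<Rightarrow> 'm tvec \<Rightarrow> real) \<Rightarrow> ('m \<Rightarrow> 'm tvec \<Rightarrow> 'm tvec \<Rightarrow> real) \<Rightarrow>
    'm \<Rightarrow> 'm tvec \<Rightarrow> 'm tvec \<Rightarrow> 'm tvec \<Rightarrow> real" where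
  "wedge12 \<alpha> \<phi> x a b c = \<alpha> x a * \<phi> x b c - \<alpha> x b * \<phi> x a c + \<alpha> x c * \<phi> x a b"

text \<open>
  \<open>d\<phi> = \<psi>\<close>, tested on vector fields defined on arbitrary open sets, in particular on all
  globally defined ones.
\<close>
definition ext_deriv2_eq :: "('m, 'e::euclidean_space) atlas \<Rightarrow> ('m \<Rightarrow> 'm tvec \<Rightarrow> 'm tvec \<Rightarrow> real) \<Rightarrow>
    ('m \<Rightarrow> 'm tvec \<Rightarrow> 'm tvec \<Rightarrow> 'm tvec \<Rightarrow> real) \<Rightarrow> bool" where
  "ext_deriv2_eq \<A> \<phi> \<psi> \<longleftrightarrow>
     (\<forall>W A B C. smooth_field \<A> W A \<and> smooth_field \<A> W B \<and> smooth_field \<A> W C \<longrightarrow>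
        (\<forall>x\<in>W. ext_deriv2 \<A> \<phi> A B C x = \<psi> x (A x) (B x) (C x)))"


section \<open>Riemannian, almost complex and Kaehler structures\<close>

definition riemannian_metric ::
  "('m, 'e::euclidean_space) atlas \<Rightarrow> ('m \<Rightarrow> 'm tvec \<Rightarrow> 'm tvec \<Rightarrow> real) \<Rightarrow> bool" where
  "riemannian_metric \<A> g \<longleftrightarrow>
     (\<forall>x\<in>points \<A>. \<forall>u\<in>tangent \<A> x. \<forall>v\<in>tangent \<A> x.
        g x u v = g x v u \<and> (u \<noteq> vzero \<longrightarrow> g x u u > 0) \<and>
        (\<forall>w\<in>tangent \<A> x. \<forall>a b. g x (a \<bullet>\<^sub>t u \<boxplus> b \<bullet>\<^sub>t v) w = a * g x u w + b * g x v w)) \<and>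
     (\<forall>W X Y. smooth_field \<A> W X \<and> smooth_field \<A> W Y \<longrightarrow>
        (\<forall>x\<in>W. smooth_near \<A> x (\<lambda>y. g y (X y) (Y y))))"

definition almost_complex ::
  "('m, 'e::euclidean_space) atlas \<Rightarrow> ('m \<Rightarrow> 'm tvec \<Rightarrow> 'm tvec) \<Rightarrow> bool" where
  "almost_complex \<A> J \<longleftrightarrow>
     (\<forall>x\<in>points \<A>. \<forall>u\<in>tangent \<A> x. J x u \<in> tangent \<A> x \<and> J x (J x u) = (- 1) \<bullet>\<^sub>t u \<and>
        (\<forall>v\<in>tangent \<A> x. \<forall>a b. J x (a \<bullet>\<^sub>t u \<boxplus> b \<bullet>\<^sub>t v) = a \<bullet>\<^sub>t J x u \<boxplus> b \<bullet>\<^sub>t J x v)) \<and>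
     (\<forall>W X. smooth_field \<A> W X \<longrightarrow> smooth_field \<A> W (\<lambda>x. J x (X x)))"

definition almost_hermitian :: "('m, 'e::euclidean_space) atlas \<Rightarrow>
    ('m \<Rightarrow> 'm tvec \<Rightarrow> 'm tvec \<Rightarrow> real) \<Rightarrow> ('m \<Rightarrow> 'm tvec \<Rightarrow> 'm tvec) \<Rightarrow> bool" where
  "almost_hermitian \<A> g J \<longleftrightarrow> riemannian_metric \<A> g \<and> almost_complex \<A> J \<and>
     (\<forall>x\<in>points \<A>. \<forall>u\<in>tangent \<A> x. \<forall>v\<in>tangent \<A> x. g x (J x u) (J x v) = g x u v)"

text \<open>
  \<open>nab x v Y\<close> is \<open>\<nabla>\<^sub>v Y\<close> for \<open>v\<close> tangent at \<open>x\<close> and a vector field \<open>Y\<close> that is smooth on a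
  neighbourhood of \<open>x\<close>.
\<close>
definition affine_connection ::
  "('m, 'e::euclidean_space) atlas \<Rightarrow> ('m \<Rightarrow> 'm tvec \<Rightarrow> ('m \<Rightarrow> 'm tvec) \<Rightarrow> 'm tvec) \<Rightarrow> bool" where
  "affine_connection \<A> nab \<longleftrightarrow>
     (\<forall>W Y. smooth_field \<A> W Y \<longrightarrow>
        (\<forall>x\<in>W. \<forall>v\<in>tangent \<A> x. nab x v Y \<in> tangent \<A> x \<and>
           (\<forall>w\<in>tangent \<A> x. \<forall>a b.
              nab x (a \<bullet>\<^sub>t v \<boxplus> b \<bullet>\<^sub>t w) Y = a \<bullet>\<^sub>t nab x v Y \<boxplus> b \<bullet>\<^sub>t nab x w Y) \<and>
           (\<forall>Z. smooth_field \<A> W Z \<longrightarrow> nab x v (\<lambda>y. Y y \<boxplus> Z y) = nab x v Y \<boxplus> nab x v Z) \<and>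
           (\<forall>Z. (\<forall>y\<in>W. Z y = Y y) \<longrightarrow> nab x v Z = nab x v Y) \<and>
           (\<forall>f. smooth_near \<A> x f \<longrightarrow>
              nab x v (\<lambda>y. f y \<bullet>\<^sub>t Y y) = v f \<bullet>\<^sub>t Y x \<boxplus> f x \<bullet>\<^sub>t nab x v Y)) \<and>
        (\<forall>X. smooth_field \<A> W X \<longrightarrow> smooth_field \<A> W (\<lambda>x. nab x (X x) Y)))"

definition levi_civita :: "('m, 'e::euclidean_space) atlas \<Rightarrow>
    ('m \<Rightarrow> 'm tvec \<Rightarrow> 'm tvec \<Rightarrow> real) \<Rightarrow> ('m \<Rightarrow> 'm tvec \<Rightarrow> ('m \<Rightarrow> 'm tvec) \<Rightarrow> 'm tvec) \<Rightarrow> bool" where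
  "levi_civita \<A> g nab \<longleftrightarrow> affine_connection \<A> nab \<and>
     (\<forall>W X Y. smooth_field \<A> W X \<and> smooth_field \<A> W Y \<longrightarrow>
        (\<forall>x\<in>W. nab x (X x) Y = nab x (Y x) X \<boxplus> lie_bracket \<A> X Y x)) \<and>
     (\<forall>W Y Z. smooth_field \<A> W Y \<and> smooth_field \<A> W Z \<longrightarrow>
        (\<forall>x\<in>W. \<forall>v\<in>tangent \<A> x.
           v (\<lambda>y. g y (Y y) (Z y)) = g x (nab x v Y) (Z x) + g x (Y x) (nab x v Z)))"

definition kaehler :: "('m, 'e::euclidean_space) atlas \<Rightarrow>
    ('m \<Rightarrow> 'm tvec \<Rightarrow> 'm tvec \<Rightarrow> real) \<Rightarrow> ('m \<Rightarrow> 'm tvec \<Rightarrow> 'm tvec) \<Rightarrow>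
    ('m \<Rightarrow> 'm tvec \<Rightarrow> ('m \<Rightarrow> 'm tvec) \<Rightarrow> 'm tvec) \<Rightarrow> bool" where
  "kaehler \<A> g J nab \<longleftrightarrow> smooth_manifold \<A> \<and> almost_hermitian \<A> g J \<and> levi_civita \<A> g nab \<and>
     (\<forall>W Y. smooth_field \<A> W Y \<longrightarrow>
        (\<forall>x\<in>W. \<forall>v\<in>tangent \<A> x. nab x v (\<lambda>y. J y (Y y)) = J x (nab x v Y)))"


section \<open>Submanifolds\<close>

text \<open>
  A submanifold of a manifold modelled on \<open>'e \<times> 'f\<close> with itself model \<open>'e\<close> is locally given by the
  vanishing of the \<open>'f\<close>-coordinates; it carries the atlas formed by the \<open>'e\<close>-coordinates.
\<close>

definition slice_charts :: "('m, 'e::euclidean_space \<times> 'f::euclidean_space) atlas \<Rightarrow> 'm set \<Rightarrow>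
    ('m, 'e \<times> 'f) chart set" where
  "slice_charts \<A> L = {C \<in> max_atlas \<A>. snd C ` (fst C \<inter> L) = snd C ` fst C \<inter> (UNIV \<times> {0})}"

definition submanifold ::
  "('m, 'e::euclidean_space \<times> 'f::euclidean_space) atlas \<Rightarrow> 'm set \<Rightarrow> bool" where
  "submanifold \<A> L \<longleftrightarrow> (\<forall>x\<in>L. \<exists>C\<in>slice_charts \<A> L. x \<in> fst C)"

definition sub_atlas :: "('m, 'e::euclidean_space \<times> 'f::euclidean_space) atlas \<Rightarrow> 'm set \<Rightarrow>
    ('m, 'e) atlas" where
  "sub_atlas \<A> L = (\<lambda>C. (fst C \<inter> L, fst \<circ> snd C)) ` slice_charts \<A> L"

text \<open>
  \<open>T\<^sub>xL\<close> occurs in two forms: \<open>tangent (sub_atlas \<A> L) x\<close> consists of functionals on functions that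
  are smooth on \<open>L\<close>, whereas \<open>tangent_sub \<A> L x\<close> is its image in \<open>T\<^sub>xM\<close> under the differential
  of the inclusion.
\<close>
definition tangent_sub ::
  "('m, 'e::euclidean_space \<times> 'f::euclidean_space) atlas \<Rightarrow> 'm set \<Rightarrow> 'm \<Rightarrow> 'm tvec set" where
  "tangent_sub \<A> L x = push \<A> (\<lambda>y. y) x ` tangent (sub_atlas \<A> L) x"

definition normal_sub :: "('m, 'e::euclidean_space \<times> 'f::euclidean_space) atlas \<Rightarrow>
    ('m \<Rightarrow> 'm tvec \<Rightarrow> 'm tvec \<Rightarrow> real) \<Rightarrow> 'm set \<Rightarrow> 'm \<Rightarrow> 'm tvec set" where
  "normal_sub \<A> g L x = {\<xi> \<in> tangent \<A> x. \<forall>u\<in>tangent_sub \<A> L x. g x \<xi> u = 0}"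

definition normal_part :: "('m, 'e::euclidean_space \<times> 'f::euclidean_space) atlas \<Rightarrow>
    ('m \<Rightarrow> 'm tvec \<Rightarrow> 'm tvec \<Rightarrow> real) \<Rightarrow> 'm set \<Rightarrow> 'm \<Rightarrow> 'm tvec \<Rightarrow> 'm tvec" where
  "normal_part \<A> g L x w =
     (THE \<xi>. \<xi> \<in> normal_sub \<A> g L x \<and> (\<exists>u\<in>tangent_sub \<A> L x. w = u \<boxplus> \<xi>))"

definition totally_real :: "('m, 'e::euclidean_space \<times> 'f::euclidean_space) atlas \<Rightarrow>
    ('m \<Rightarrow> 'm tvec \<Rightarrow> 'm tvec \<Rightarrow> real) \<Rightarrow> ('m \<Rightarrow> 'm tvec \<Rightarrow> 'm tvec) \<Rightarrow> 'm set \<Rightarrow> bool" where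
  "totally_real \<A> g J L \<longleftrightarrow>
     (\<forall>x\<in>L. (\<forall>u\<in>tangent_sub \<A> L x. \<forall>v\<in>tangent_sub \<A> L x. g x u (J x v) = 0) \<and>
        (\<forall>w\<in>tangent \<A> x. \<exists>u\<in>tangent_sub \<A> L x. \<exists>v\<in>tangent_sub \<A> L x. w = u \<boxplus> J x v))"

text \<open>Vanishing of the second fundamental form \<open>(v, Y) \<mapsto> (\<nabla>\<^sub>v Y)\<^sup>\<bottom>\<close>.\<close>
definition totally_geodesic :: "('m, 'e::euclidean_space \<times> 'f::euclidean_space) atlas \<Rightarrow>
    ('m \<Rightarrow> 'm tvec \<Rightarrow> 'm tvec \<Rightarrow> real) \<Rightarrow>
    ('m \<Rightarrow> 'm tvec \<Rightarrow> ('m \<Rightarrow> 'm tvec) \<Rightarrow> 'm tvec) \<Rightarrow> 'm set \<Rightarrow> bool" where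
  "totally_geodesic \<A> g nab L \<longleftrightarrow>
     (\<forall>W Y. smooth_field \<A> W Y \<and> (\<forall>y\<in>W \<inter> L. Y y \<in> tangent_sub \<A> L y) \<longrightarrow>
        (\<forall>x\<in>W \<inter> L. \<forall>v\<in>tangent_sub \<A> L x. normal_part \<A> g L x (nab x v Y) = vzero))"


section \<open>The normal bundle\<close>

text \<open>
  A local section of the normal bundle is presented by a vector field \<open>\<xi>\<close> of the ambient manifold,
  smooth on an open set \<open>W\<close> and normal along \<open>W \<inter> L\<close>; every smooth section has such a
  presentation near each point of \<open>L\<close>.
\<close>
definition normal_section :: "('m, 'e::euclidean_space \<times> 'f::euclidean_space) atlas \<Rightarrow>
    ('m \<Rightarrow> 'm tvec \<Rightarrow> 'm tvec \<Rightarrow> real) \<Rightarrow> 'm set \<Rightarrow> 'm set \<Rightarrow> ('m \<Rightarrow> 'm tvec) \<Rightarrow> bool" where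
  "normal_section \<A> g L W \<xi> \<longleftrightarrow> smooth_field \<A> W \<xi> \<and> (\<forall>y\<in>W \<inter> L. \<xi> y \<in> normal_sub \<A> g L y)"

text \<open>\<open>\<nabla>\<^sup>\<bottom>\<^sub>v \<xi>\<close> for \<open>v\<close> in \<open>tangent (sub_atlas \<A> L) x\<close>.\<close>
definition normal_connection :: "('m, 'e::euclidean_space \<times> 'f::euclidean_space) atlas \<Rightarrow>
    ('m \<Rightarrow> 'm tvec \<Rightarrow> 'm tvec \<Rightarrow> real) \<Rightarrow> ('m \<Rightarrow> 'm tvec \<Rightarrow> ('m \<Rightarrow> 'm tvec) \<Rightarrow> 'm tvec) \<Rightarrow> 'm set \<Rightarrow>
    'm \<Rightarrow> 'm tvec \<Rightarrow> ('m \<Rightarrow> 'm tvec) \<Rightarrow> 'm tvec" where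
  "normal_connection \<A> g nab L x v \<xi> = normal_part \<A> g L x (nab x (push \<A> (\<lambda>y. y) x v) \<xi>)"

text \<open>A smooth local frame over \<open>W \<inter> L\<close>, as a family of linear isomorphisms from the model space
  of the fibre.\<close>
definition normal_frame :: "('m, 'e::euclidean_space \<times> 'f::euclidean_space) atlas \<Rightarrow>
    ('m \<Rightarrow> 'm tvec \<Rightarrow> 'm tvec \<Rightarrow> real) \<Rightarrow> 'm set \<Rightarrow> 'm set \<Rightarrow> ('f \<Rightarrow> 'm \<Rightarrow> 'm tvec) \<Rightarrow> bool" where
  "normal_frame \<A> g L W F \<longleftrightarrow> (\<forall>a. normal_section \<A> g L W (F a)) \<and>
     (\<forall>y\<in>W \<inter> L. bij_betw (\<lambda>a. F a y) UNIV (normal_sub \<A> g L y) \<and>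
        (\<forall>a b r s. F (r *\<^sub>R a + s *\<^sub>R b) y = r \<bullet>\<^sub>t F a y \<boxplus> s \<bullet>\<^sub>t F b y))"

text \<open>The total space consists of the pairs \<open>(x, \<theta>)\<close> with \<open>x \<in> L\<close> and \<open>\<theta>\<close> normal at \<open>x\<close>. Its charts are
  the bundle charts given by a chart of \<open>L\<close> and a frame.\<close>
definition normal_bundle :: "('m, 'e::euclidean_space \<times> 'f::euclidean_space) atlas \<Rightarrow>
    ('m \<Rightarrow> 'm tvec \<Rightarrow> 'm tvec \<Rightarrow> real) \<Rightarrow> 'm set \<Rightarrow> ('m \<times> 'm tvec, 'e \<times> 'f) atlas" where
  "normal_bundle \<A> g L =
     {({(x, \<theta>). x \<in> fst C \<and> \<theta> \<in> normal_sub \<A> g L x},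
       \<lambda>(x, \<theta>). (snd C x, inv_into UNIV (\<lambda>a. F a x) \<theta>)) | C F W.
      C \<in> sub_atlas \<A> L \<and> fst C \<subseteq> W \<and> normal_frame \<A> g L W F}"

text \<open>The velocity at \<open>t = 0\<close> of \<open>t \<mapsto> \<theta> + t \<eta>\<close>, i.e. the image of \<open>\<eta>\<close> under the canonical
  isomorphism from the fibre to its tangent space at \<open>\<theta>\<close>.\<close>
definition fibre_vec :: "('m \<times> 'm tvec, 'e::euclidean_space) atlas \<Rightarrow> 'm \<times> 'm tvec \<Rightarrow> 'm tvec \<Rightarrow>
    ('m \<times> 'm tvec) tvec" where
  "fibre_vec \<N> z \<eta> = (\<lambda>f. if smooth_near \<N> z f
     then deriv (\<lambda>t. f (fst z, snd z \<boxplus> t \<bullet>\<^sub>t \<eta>)) 0 else 0)"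

definition connection_map :: "('m, 'e::euclidean_space \<times> 'f::euclidean_space) atlas \<Rightarrow>
    ('m \<Rightarrow> 'm tvec \<Rightarrow> 'm tvec \<Rightarrow> real) \<Rightarrow> ('m \<Rightarrow> 'm tvec \<Rightarrow> ('m \<Rightarrow> 'm tvec) \<Rightarrow> 'm tvec) \<Rightarrow> 'm set \<Rightarrow>
    ('m \<times> 'm tvec \<Rightarrow> ('m \<times> 'm tvec) tvec \<Rightarrow> 'm tvec) \<Rightarrow> bool" where
  "connection_map \<A> g nab L K \<longleftrightarrow>
     (let \<N> = normal_bundle \<A> g L in
       (\<forall>z\<in>points \<N>. \<forall>A\<in>tangent \<N> z. K z A \<in> normal_sub \<A> g L (fst z) \<and>
          (\<forall>B\<in>tangent \<N> z. \<forall>a b. K z (a \<bullet>\<^sub>t A \<boxplus> b \<bullet>\<^sub>t B) = a \<bullet>\<^sub>t K z A \<boxplus> b \<bullet>\<^sub>t K z B)) \<and>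
       (\<forall>z\<in>points \<N>. \<forall>\<eta>\<in>normal_sub \<A> g L (fst z). K z (fibre_vec \<N> z \<eta>) = \<eta>) \<and>
       (\<forall>W \<xi>. normal_section \<A> g L W \<xi> \<longrightarrow>
          (\<forall>x\<in>W \<inter> L. \<forall>v\<in>tangent (sub_atlas \<A> L) x.
             K (x, \<xi> x) (push \<N> (\<lambda>y. (y, \<xi> y)) x v) = normal_connection \<A> g nab L x v \<xi>)))"

text \<open>\<open>\<pi>\<^sub>* A\<close> as an element of \<open>tangent_sub \<A> L x\<close>, for \<open>A\<close> tangent to the normal bundle.\<close>
definition proj_push :: "('m, 'e::euclidean_space \<times> 'f::euclidean_space) atlas \<Rightarrow> 'm \<times> 'm tvec \<Rightarrow>
    ('m \<times> 'm tvec) tvec \<Rightarrow> 'm tvec" where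
  "proj_push \<A> z A = push \<A> fst z A"

definition hlift :: "('m, 'e::euclidean_space \<times> 'f::euclidean_space) atlas \<Rightarrow>
    ('m \<Rightarrow> 'm tvec \<Rightarrow> 'm tvec \<Rightarrow> real) \<Rightarrow> 'm set \<Rightarrow>
    ('m \<times> 'm tvec \<Rightarrow> ('m \<times> 'm tvec) tvec \<Rightarrow> 'm tvec) \<Rightarrow>
    'm \<times> 'm tvec \<Rightarrow> 'm tvec \<Rightarrow> ('m \<times> 'm tvec) tvec" where
  "hlift \<A> g L K z X =
     (THE A. A \<in> tangent (normal_bundle \<A> g L) z \<and> K z A = vzero \<and> proj_push \<A> z A = X)"

definition vlift :: "('m, 'e::euclidean_space \<times> 'f::euclidean_space) atlas \<Rightarrow>
    ('m \<Rightarrow> 'm tvec \<Rightarrow> 'm tvec \<Rightarrow> real) \<Rightarrow> 'm set \<Rightarrow>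
    ('m \<times> 'm tvec \<Rightarrow> ('m \<times> 'm tvec) tvec \<Rightarrow> 'm tvec) \<Rightarrow>
    'm \<times> 'm tvec \<Rightarrow> 'm tvec \<Rightarrow> ('m \<times> 'm tvec) tvec" where
  "vlift \<A> g L K z \<xi> =
     (THE A. A \<in> tangent (normal_bundle \<A> g L) z \<and> proj_push \<A> z A = vzero \<and> K z A = \<xi>)"


section \<open>The (p,q)-metric and the almost complex structure\<close>

definition sqnorm :: "('m \<Rightarrow> 'm tvec \<Rightarrow> 'm tvec \<Rightarrow> real) \<Rightarrow> 'm \<times> 'm tvec \<Rightarrow> real" where
  "sqnorm g z = g (fst z) (snd z) (snd z)"

definition omega :: "('m \<Rightarrow> 'm tvec \<Rightarrow> 'm tvec \<Rightarrow> real) \<Rightarrow> 'm \<times> 'm tvec \<Rightarrow> real" where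
  "omega g z = 1 / (1 + sqnorm g z)"

definition pq_metric :: "('m, 'e::euclidean_space \<times> 'f::euclidean_space) atlas \<Rightarrow>
    ('m \<Rightarrow> 'm tvec \<Rightarrow> 'm tvec \<Rightarrow> real) \<Rightarrow>
    ('m \<times> 'm tvec \<Rightarrow> ('m \<times> 'm tvec) tvec \<Rightarrow> 'm tvec) \<Rightarrow> real \<Rightarrow> real \<Rightarrow>
    'm \<times> 'm tvec \<Rightarrow> ('m \<times> 'm tvec) tvec \<Rightarrow> ('m \<times> 'm tvec) tvec \<Rightarrow> real" where
  "pq_metric \<A> g K p q z A B =
     (let x = fst z; \<theta> = snd z in
       g x (proj_push \<A> z A) (proj_push \<A> z B)
       + omega g z powr p * (g x (K z A) (K z B) + q * g x (K z A) \<theta> * g x (K z B) \<theta>))"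

definition Jt_vert :: "('m, 'e::euclidean_space \<times> 'f::euclidean_space) atlas \<Rightarrow>
    ('m \<Rightarrow> 'm tvec \<Rightarrow> 'm tvec \<Rightarrow> real) \<Rightarrow> ('m \<Rightarrow> 'm tvec \<Rightarrow> 'm tvec) \<Rightarrow> 'm set \<Rightarrow>
    ('m \<times> 'm tvec \<Rightarrow> ('m \<times> 'm tvec) tvec \<Rightarrow> 'm tvec) \<Rightarrow> real \<Rightarrow> real \<Rightarrow>
    'm \<times> 'm tvec \<Rightarrow> 'm tvec \<Rightarrow> ('m \<times> 'm tvec) tvec" where
  "Jt_vert \<A> g J L K p q z \<xi> =
     (let x = fst z; \<theta> = snd z in
       (omega g z powr (p / 2)) \<bullet>\<^sub>t
         (hlift \<A> g L K z (J x \<xi>) \<boxplus>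
          (q / (1 + sqrt (1 + q * sqnorm g z)) * g x \<xi> \<theta>) \<bullet>\<^sub>t hlift \<A> g L K z (J x \<theta>)))"

definition Jt_hor :: "('m, 'e::euclidean_space \<times> 'f::euclidean_space) atlas \<Rightarrow>
    ('m \<Rightarrow> 'm tvec \<Rightarrow> 'm tvec \<Rightarrow> real) \<Rightarrow> ('m \<Rightarrow> 'm tvec \<Rightarrow> 'm tvec) \<Rightarrow> 'm set \<Rightarrow>
    ('m \<times> 'm tvec \<Rightarrow> ('m \<times> 'm tvec) tvec \<Rightarrow> 'm tvec) \<Rightarrow> real \<Rightarrow> real \<Rightarrow>
    'm \<times> 'm tvec \<Rightarrow> 'm tvec \<Rightarrow> ('m \<times> 'm tvec) tvec" where
  "Jt_hor \<A> g J L K p q z X =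
     (let x = fst z; \<theta> = snd z in
       (omega g z powr (- p / 2)) \<bullet>\<^sub>t
         (vlift \<A> g L K z (J x X) \<boxplus>
          (- (q * g x (J x X) \<theta> / (1 + q * sqnorm g z + sqrt (1 + q * sqnorm g z)))) \<bullet>\<^sub>t
            vlift \<A> g L K z \<theta>))"

text \<open>The linear map with the prescribed values \<open>Jt_vert\<close> on vertical and \<open>Jt_hor\<close> on horizontal
  lifts, since \<open>A = (KA)\<^sup>v + (\<pi>\<^sub>*A)\<^sup>h\<close>.\<close>
definition Jt :: "('m, 'e::euclidean_space \<times> 'f::euclidean_space) atlas \<Rightarrow>
    ('m \<Rightarrow> 'm tvec \<Rightarrow> 'm tvec \<Rightarrow> real) \<Rightarrow> ('m \<Rightarrow> 'm tvec \<Rightarrow> 'm tvec) \<Rightarrow> 'm set \<Rightarrow>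
    ('m \<times> 'm tvec \<Rightarrow> ('m \<times> 'm tvec) tvec \<Rightarrow> 'm tvec) \<Rightarrow> real \<Rightarrow> real \<Rightarrow>
    'm \<times> 'm tvec \<Rightarrow> ('m \<times> 'm tvec) tvec \<Rightarrow> ('m \<times> 'm tvec) tvec" where
  "Jt \<A> g J L K p q z A =
     Jt_vert \<A> g J L K p q z (K z A) \<boxplus> Jt_hor \<A> g J L K p q z (proj_push \<A> z A)"

definition fundamental_form :: "('m, 'e::euclidean_space \<times> 'f::euclidean_space) atlas \<Rightarrow>
    ('m \<Rightarrow> 'm tvec \<Rightarrow> 'm tvec \<Rightarrow> real) \<Rightarrow> ('m \<Rightarrow> 'm tvec \<Rightarrow> 'm tvec) \<Rightarrow> 'm set \<Rightarrow>
    ('m \<times> 'm tvec \<Rightarrow> ('m \<times> 'm tvec) tvec \<Rightarrow> 'm tvec) \<Rightarrow> real \<Rightarrow> real \<Rightarrow>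
    'm \<times> 'm tvec \<Rightarrow> ('m \<times> 'm tvec) tvec \<Rightarrow> ('m \<times> 'm tvec) tvec \<Rightarrow> real" where
  "fundamental_form \<A> g J L K p q z A B = pq_metric \<A> g K p q z A (Jt \<A> g J L K p q z B)"

text \<open>
  The conditions determining the one-form \<open>\<alpha>\<close>. The sign of the \<open>q\<close>-term is the one forced by
  \<open>d\<phi> = \<alpha> \<and> \<phi>\<close>: for \<open>L = \<real>\<^sup>k\<close> in \<open>\<complex>\<^sup>k\<close>, with \<open>u = J\<theta>\<close>, \<open>\<tau> = \<Sum>\<^sub>i u\<^sub>i du\<^sub>i\<close>, \<open>c = q / (1 + \<surd>(1 + q|\<theta>|\<^sup>2))\<close>, one has
  \<open>\<phi> = \<omega>\<^bsup>p/2\<^esup> (\<Sum>\<^sub>i dx\<^sub>i \<and> du\<^sub>i + c \<Sum>\<^sub>i u\<^sub>i dx\<^sub>i \<and> \<tau>)\<close> and \<open>d\<phi> = - (p \<omega> + c) \<tau> \<and> \<phi>\<close>. The difference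
  \<open>p \<omega> - c\<close>, sometimes found instead, is wrong for \<open>q > 0\<close> and \<open>k \<ge> 2\<close>.
\<close>
definition lee_form :: "('m, 'e::euclidean_space \<times> 'f::euclidean_space) atlas \<Rightarrow>
    ('m \<Rightarrow> 'm tvec \<Rightarrow> 'm tvec \<Rightarrow> real) \<Rightarrow> 'm set \<Rightarrow>
    ('m \<times> 'm tvec \<Rightarrow> ('m \<times> 'm tvec) tvec \<Rightarrow> 'm tvec) \<Rightarrow> real \<Rightarrow> real \<Rightarrow>
    ('m \<times> 'm tvec \<Rightarrow> ('m \<times> 'm tvec) tvec \<Rightarrow> real) \<Rightarrow> bool" where
  "lee_form \<A> g L K p q \<alpha> \<longleftrightarrow> one_form (normal_bundle \<A> g L) \<alpha> \<and>
     (\<forall>z\<in>points (normal_bundle \<A> g L).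
        (\<forall>X\<in>tangent_sub \<A> L (fst z). \<alpha> z (hlift \<A> g L K z X) = 0) \<and>
        (\<forall>\<xi>\<in>normal_sub \<A> g L (fst z). \<alpha> z (vlift \<A> g L K z \<xi>) =
           - (p * omega g z + q / (1 + sqrt (1 + q * sqnorm g z))) * g (fst z) \<xi> (snd z)))"

end

theory Submission
  imports Defs
begin

text \<open>
  Write \<open>\<rho> = |\<theta>|\<^sup>2 / 2\<close> and \<open>\<lambda>(A) = \<langle>J \<pi>\<^sub>* A, \<theta>\<rangle>\<close>. Identifying the normal bundle with \<open>TL\<close> by \<open>J\<close>, metricity and
  torsion-freeness of the connection give \<open>d\<rho>(A) = \<langle>KA, \<theta>\<rangle>\<close> and \<open>d\<lambda>(A, B) = \<langle>KA, J \<pi>\<^sub>* B\<rangle> - \<langle>KB, J \<pi>\<^sub>* A\<rangle>\<close>; this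
  uses that \<open>L\<close> is totally geodesic and \<open>J\<close> is parallel, so that \<open>J\<close> intertwines the connections on
  \<open>TL\<close> and on the normal bundle. Unfolding the definitions of the metric and of the almost complex
  structure yields \<open>\<phi> = \<omega>\<^bsup>p/2\<^esup> (d\<lambda> + c d\<rho> \<and> \<lambda>)\<close> with \<open>c = q / (1 + \<surd>(1 + 2q\<rho>))\<close>. As \<open>\<omega>\<close> and \<open>c\<close> are functions of
  \<open>\<rho>\<close> alone, \<open>d\<phi> = d(ln \<omega>\<^bsup>p/2\<^esup>) \<and> \<phi> - \<omega>\<^bsup>p/2\<^esup> c d\<rho> \<and> d\<lambda> = - (p \<omega> + c) d\<rho> \<and> \<phi>\<close>.
\<close>

section \<open>Calculus of smooth functions\<close>

text \<open>\<open>K\<close> is given only by its axioms, the lifts by \<open>THE\<close>, and the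
  forms are tested on vector fields, so explicit coordinates are needed before anything can be
  computed. They are built from a slice chart of \<open>L\<close> and the frame \<open>JE\<close>,
  the J-image of its coordinate fields. Because \<open>L\<close> is totally geodesic and
  \<open>J\<close> is parallel, the normal connection has in this frame the Christoffel symbols
  \<open>\<Gamma>\<close> of \<open>L\<close> itself, and a vector with components (X, V) at the
  fibre coordinate u is sent by \<open>K\<close> to the coordinate V + \<Gamma>(X, u). All forms
  become expressions in \<open>G\<close> (the metric) and \<open>\<Gamma>\<close>; the geometry then
  enters through the symmetry of \<open>\<Gamma>\<close> and its compatibility with
  \<open>G\<close>. Two obstacles explain the length of the analysis. The atlas of the normal bundle
  admits charts from arbitrary frames, known only through ambient fields, so that a change of frame
  inverts a Gram matrix; hence smooth inversion of linear maps. A bracket of fields is a tangent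
  vector only because second derivatives are symmetric. The forms depend on the squared norm 2
  \<rho> rather than on \<rho>, which accounts for coefficients halved in the code.\<close>

declare Ck_on.simps(2) [simp del]

lemma frechet_derivative_eqI:
  "(f has_derivative f') (at x) \<Longrightarrow> frechet_derivative f (at x) = f'"
  using frechet_derivative_at by metis

abbreviation "\<D> f x \<equiv> frechet_derivative f (at x)"

lemma Ck_on_Suc_has_derivative:
  "Ck_on (Suc n) S f \<Longrightarrow> x \<in> S \<Longrightarrow> (f has_derivative \<D> f x) (at x)"
  by (simp add: Ck_on.simps(2) frechet_derivative_works[symmetric])

lemma Ck_on_Suc_frechet:
  "Ck_on (Suc n) S f \<Longrightarrow> Ck_on n S (\<lambda>x. \<D> f x v)"
  by (simp add: Ck_on.simps(2))

lemma Ck_on_SucD: "Ck_on (Suc n) S f \<Longrightarrow> Ck_on n S f"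
proof (induction n arbitrary: f)
  case 0
  then show ?case
    by (auto simp: Ck_on.simps(2) intro!: continuous_at_imp_continuous_on differentiable_imp_continuous_within)
next
  case (Suc n)
  from Suc.prems have "\<forall>x\<in>S. f differentiable (at x)"
    and "\<And>v. Ck_on (Suc n) S (\<lambda>x. \<D> f x v)"
    by (auto simp only: Ck_on.simps(2)[of "Suc n"])
  with Suc.IH show ?case by (simp only: Ck_on.simps(2)[of n]) blast
qed

lemma Ck_on_cong:
  assumes "open S" "\<And>x. x \<in> S \<Longrightarrow> f x = h x"
  shows "Ck_on n S f \<longleftrightarrow> Ck_on n S h"
  using assms(2)
proof (induction n arbitrary: f h)
  case 0
  then show ?case unfolding Ck_on.simps(1) by (intro continuous_on_cong) auto
next
  case (Suc n)
  have *: "(f has_derivative f') (at x) \<longleftrightarrow> (h has_derivative f') (at x)" if "x \<in> S" for f' x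
    using has_derivative_transform_within_open[OF _ assms(1) that] Suc.prems by metis
  then have "\<forall>x\<in>S. (f differentiable (at x) \<longleftrightarrow> h differentiable (at x))"
    and "\<And>v x. x \<in> S \<Longrightarrow> \<D> f x v = \<D> h x v"
    by (auto simp: differentiable_def frechet_derivative_def)
  then show ?case
    unfolding Ck_on.simps(2)
    using Suc.IH[of "\<lambda>x. \<D> f x v" "\<lambda>x. \<D> h x v" for v]
    by simp
qed

lemma Ck_on_subset: "Ck_on n T f \<Longrightarrow> S \<subseteq> T \<Longrightarrow> Ck_on n S f"
  by (induction n arbitrary: f) (auto simp: Ck_on.simps(2) intro: continuous_on_subset)

text \<open>Replaces the chosen \<open>frechet_derivative\<close> by any derivative with a
  convenient formula; on an open set both agree at every point, which is all that
  \<open>Ck_on\<close> sees.\<close>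

lemma Ck_on_SucI:
  assumes "open S" "\<And>x. x \<in> S \<Longrightarrow> (f has_derivative f' x) (at x)" "\<And>v. Ck_on n S (\<lambda>x. f' x v)"
  shows "Ck_on (Suc n) S f"
proof -
  have "Ck_on n S (\<lambda>x. \<D> f x v)" for v
    using assms(3) frechet_derivative_eqI[OF assms(2)] by (subst Ck_on_cong[OF assms(1)]) auto
  with assms(2) show ?thesis
    by (auto simp: Ck_on.simps(2) differentiable_def)
qed

lemma Ck_on_local:
  assumes "open S" "\<And>x. x \<in> S \<Longrightarrow> \<exists>T. open T \<and> x \<in> T \<and> Ck_on n T f"
  shows "Ck_on n S f"
  using assms(2)
proof (induction n arbitrary: f)
  case 0
  have "isCont f x" if "x \<in> S" for x
  proof -
    from 0 that obtain T where "open T" "x \<in> T" "continuous_on T f" by auto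
    then show ?thesis by (simp add: continuous_on_eq_continuous_at)
  qed
  then show ?case by (simp add: continuous_at_imp_continuous_on)
next
  case (Suc n)
  show ?case unfolding Ck_on.simps(2)
  proof (intro conjI ballI allI)
    fix x assume "x \<in> S"
    with Suc.prems obtain T where "x \<in> T" "Ck_on (Suc n) T f" by blast
    then show "f differentiable (at x)" by (simp add: Ck_on.simps(2))
  next
    fix v
    show "Ck_on n S (\<lambda>x. \<D> f x v)"
    proof (rule Suc.IH)
      fix x assume "x \<in> S"
      with Suc.prems obtain T where "open T" "x \<in> T" "Ck_on (Suc n) T f" by blast
      then show "\<exists>T. open T \<and> x \<in> T \<and> Ck_on n T (\<lambda>x. \<D> f x v)"
        using Ck_on_Suc_frechet by blast
    qed
  qed
qed

lemma Ck_on_const: "open S \<Longrightarrow> Ck_on n S (\<lambda>x. c)"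
proof (induction n arbitrary: c)
  case (Suc n)
  show ?case
    by (rule Ck_on_SucI[where f' = "\<lambda>x v. 0"]) (use Suc in auto)
qed auto

lemma Ck_on_bounded_linear:
  assumes "open S" "bounded_linear f"
  shows "Ck_on n S f"
proof (cases n)
  case 0
  then show ?thesis using assms linear_continuous_on by auto
next
  case (Suc m)
  show ?thesis unfolding Suc
    by (rule Ck_on_SucI[where f' = "\<lambda>x. f"])
      (use assms in \<open>auto intro: Ck_on_const bounded_linear_imp_has_derivative\<close>)
qed

lemma Ck_on_add:
  assumes "open S"
  shows "Ck_on n S f \<Longrightarrow> Ck_on n S h \<Longrightarrow> Ck_on n S (\<lambda>x. f x + h x)"
proof (induction n arbitrary: f h)
  case (Suc n)
  show ?case
    by (rule Ck_on_SucI[OF assms, where f' = "\<lambda>x v. \<D> f x v + \<D> h x v"])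
      (use Suc in \<open>auto intro: has_derivative_add Ck_on_Suc_has_derivative Ck_on_Suc_frechet\<close>)
qed (auto intro: continuous_intros)

lemma Ck_on_sum:
  assumes "open S" "\<And>i. i \<in> I \<Longrightarrow> Ck_on n S (f i)"
  shows "Ck_on n S (\<lambda>x. \<Sum>i\<in>I. f i x)"
  using assms(2)
  by (induction I rule: infinite_finite_induct) (auto intro: Ck_on_const Ck_on_add assms(1))

lemma Ck_on_bounded_linear_comp:
  assumes "open S" "bounded_linear h"
  shows "Ck_on n S f \<Longrightarrow> Ck_on n S (\<lambda>x. h (f x))"
proof (induction n arbitrary: f)
  case (Suc n)
  show ?case
    by (rule Ck_on_SucI[OF assms(1), where f' = "\<lambda>x v. h (\<D> f x v)"])
      (use Suc in \<open>auto intro: bounded_linear.has_derivative[OF assms(2)] Ck_on_Suc_has_derivative Ck_on_Suc_frechet\<close>)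
qed (auto intro: bounded_linear.continuous_on[OF assms(2)])

lemma Ck_on_bounded_bilinear:
  assumes "open S" "bounded_bilinear b"
  shows "Ck_on n S f \<Longrightarrow> Ck_on n S h \<Longrightarrow> Ck_on n S (\<lambda>x. b (f x) (h x))"
proof (induction n arbitrary: f h)
  case (Suc n)
  show ?case
  proof (rule Ck_on_SucI[OF assms(1), where f' = "\<lambda>x v. b (f x) (\<D> h x v)
          + b (\<D> f x v) (h x)"])
    show "((\<lambda>x. b (f x) (h x)) has_derivative (\<lambda>v. b (f x) (\<D> h x v)
          + b (\<D> f x v) (h x))) (at x)" if "x \<in> S" for x
      by (rule bounded_bilinear.FDERIV[OF assms(2)])
        (use Suc.prems that in \<open>auto intro: Ck_on_Suc_has_derivative\<close>)
    show "Ck_on n S (\<lambda>x. b (f x) (\<D> h x v)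
          + b (\<D> f x v) (h x))" for v
      by (rule Ck_on_add[OF assms(1) Suc.IH[OF Ck_on_SucD[OF Suc.prems(1)] Ck_on_Suc_frechet[OF Suc.prems(2)]]
            Suc.IH[OF Ck_on_Suc_frechet[OF Suc.prems(1)] Ck_on_SucD[OF Suc.prems(2)]]])
  qed
qed (auto intro: bounded_bilinear.continuous_on[OF assms(2)])

lemma Ck_on_componentwise:
  fixes f :: "'a::euclidean_space \<Rightarrow> 'b::euclidean_space"
  assumes "open S" "\<And>i. i \<in> Basis \<Longrightarrow> Ck_on n S (\<lambda>x. f x \<bullet> i)"
  shows "Ck_on n S f"
proof -
  have "Ck_on n S (\<lambda>x. \<Sum>i\<in>Basis. (f x \<bullet> i) *\<^sub>R i)"
    by (intro Ck_on_sum Ck_on_bounded_bilinear[OF _ bounded_bilinear_scaleR] Ck_on_const assms)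
  then show ?thesis by (simp add: euclidean_representation)
qed

lemma linear_Basis_sum:
  fixes f :: "'a::euclidean_space \<Rightarrow> 'b::real_vector"
  assumes "linear f"
  shows "f v = (\<Sum>i\<in>Basis. (v \<bullet> i) *\<^sub>R f i)"
proof -
  have "f v = f (\<Sum>i\<in>Basis. (v \<bullet> i) *\<^sub>R i)" by (simp add: euclidean_representation)
  also have "\<dots> = (\<Sum>i\<in>Basis. (v \<bullet> i) *\<^sub>R f i)"
    by (simp add: linear_sum[OF assms] linear_cmul[OF assms])
  finally show ?thesis .
qed

text \<open>Expanding \<open>w x\<close> in the basis leaves finitely many products of regular
  coefficients. This handles a derivative applied to a varying vector, both in the chain rule and
  for vector fields acting on functions.\<close>

lemma Ck_on_linear_apply:
  fixes m :: "'a::euclidean_space \<Rightarrow> 'b::euclidean_space \<Rightarrow> 'c::real_normed_vector"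
  assumes "open S" "\<And>x. x \<in> S \<Longrightarrow> linear (m x)" "\<And>a. a \<in> Basis \<Longrightarrow> Ck_on n S (\<lambda>x. m x a)"
    "Ck_on n S w"
  shows "Ck_on n S (\<lambda>x. m x (w x))"
proof -
  have "Ck_on n S (\<lambda>x. \<Sum>i\<in>Basis. (w x \<bullet> i) *\<^sub>R m x i)"
    by (intro Ck_on_sum Ck_on_bounded_bilinear[OF _ bounded_bilinear_scaleR]
        Ck_on_bounded_bilinear[OF _ bounded_bilinear_inner] Ck_on_const assms)
  then show ?thesis
    by (subst Ck_on_cong[OF assms(1)]) (use linear_Basis_sum[OF assms(2)] in auto)
qed

text \<open>The induction varies \<open>f\<close> and fixes \<open>h\<close>: the chain rule
  produces the lower-order function \<open>\<D> f\<close> along the same \<open>h\<close>, applied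
  to the derivative of \<open>h\<close>.\<close>

lemma Ck_on_compose:
  fixes h :: "'a::euclidean_space \<Rightarrow> 'b::euclidean_space"
  assumes "open S" "open T" "h ` S \<subseteq> T"
  shows "Ck_on n T f \<Longrightarrow> Ck_on n S h \<Longrightarrow> Ck_on n S (\<lambda>x. f (h x))"
proof (induction n arbitrary: f)
  case 0
  then show ?case
    using continuous_on_compose2[OF _ _ assms(3)] by simp
next
  case (Suc n)
  have d: "(f has_derivative \<D> f (h x)) (at (h x))" if "x \<in> S" for x
    using Ck_on_Suc_has_derivative[OF Suc.prems(1)] assms(3) that by auto
  show ?case
  proof (rule Ck_on_SucI[OF assms(1), where f' = "\<lambda>x v. \<D> f (h x) (\<D> h x v)"])
    show "((\<lambda>x. f (h x)) has_derivative (\<lambda>v. \<D> f (h x) (\<D> h x v))) (at x)"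
      if "x \<in> S" for x
      using has_derivative_compose[OF Ck_on_Suc_has_derivative[OF Suc.prems(2) that] d[OF that]] .
    show "Ck_on n S (\<lambda>x. \<D> f (h x) (\<D> h x v))" for v
    proof (rule Ck_on_linear_apply[OF assms(1) _ _ Ck_on_Suc_frechet[OF Suc.prems(2)]])
      show "linear (\<D> f (h x))" if "x \<in> S" for x
        by (rule has_derivative_linear[OF d[OF that]])
      show "Ck_on n S (\<lambda>x. \<D> f (h x) a)" for a
        by (rule Suc.IH[OF Ck_on_Suc_frechet[OF Suc.prems(1)] Ck_on_SucD[OF Suc.prems(2)]])
    qed
  qed
qed

text \<open>The family with a free factor and a free exponent is closed under differentiation, which
  makes the induction go through.\<close>

lemma Ck_on_powr: "Ck_on n {0<..} (\<lambda>x::real. c * x powr a)"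
proof (induction n arbitrary: a c)
  case 0
  show ?case by (auto intro!: continuous_intros)
next
  case (Suc n)
  show ?case
  proof (rule Ck_on_SucI[where f' = "\<lambda>x v. (c * a * v) * x powr (a - 1)"])
    fix x :: real assume "x \<in> {0<..}"
    then have "((\<lambda>x. c * x powr a) has_real_derivative c * (a * x powr (a - 1))) (at x)"
      by (intro DERIV_cmult has_real_derivative_powr) simp
    then show "((\<lambda>x. c * x powr a) has_derivative (\<lambda>v. (c * a * v) * x powr (a - 1))) (at x)"
      by (simp add: has_field_derivative_def mult_ac mult_commute_abs)
  qed (auto intro: Suc)
qed

section \<open>Smooth inversion of linear maps\<close>

text \<open>A product rule for a factor \<open>c\<close> that is merely continuous: since
  \<open>r\<close> vanishes at \<open>x\<close>, the correction
  \<open>r y *\<^sub>R (c y - c x)\<close> is a term of size O(|y - x|) times one tending to 0. It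
  serves to differentiate an inverse whose differentiability is not yet known.\<close>

lemma has_derivative_scaleR_vanishing:
  fixes r :: "'a::real_normed_vector \<Rightarrow> real" and c :: "'a \<Rightarrow> 'b::real_normed_vector"
  assumes r: "(r has_derivative r') (at x)" "r x = 0" and c: "isCont c x"
  shows "((\<lambda>y. r y *\<^sub>R c y) has_derivative (\<lambda>h. r' h *\<^sub>R c x)) (at x)"
proof -
  have bl: "bounded_linear r'" using r(1) by (rule has_derivative_bounded_linear)
  have 1: "((\<lambda>y. r y *\<^sub>R c x) has_derivative (\<lambda>h. r' h *\<^sub>R c x)) (at x)"
    by (rule has_derivative_scaleR_left[OF r(1)])
  have 2: "((\<lambda>y. r y *\<^sub>R (c y - c x)) has_derivative (\<lambda>h. 0)) (at x)"
    unfolding has_derivative_iff_norm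
  proof
    obtain M where M: "M > 0" "\<And>h. norm (r' h) \<le> norm h * M"
      using bounded_linear.pos_bounded[OF bl] by blast
    have lim: "((\<lambda>y. norm (r y - r x - r' (y - x)) / norm (y - x)) \<longlongrightarrow> 0) (at x)"
      using r(1) by (simp add: has_derivative_iff_norm)
    have "((\<lambda>y. (norm (r y - r x - r' (y - x)) / norm (y - x) + M) * norm (c y - c x)) \<longlongrightarrow> (0 + M) * norm (c x - c x)) (at x)"
      by (intro tendsto_intros lim) (use c in \<open>simp add: isCont_def\<close>)
    then have lim0: "((\<lambda>y. (norm (r y - r x - r' (y - x)) / norm (y - x) + M) * norm (c y - c x)) \<longlongrightarrow> 0) (at x)"
      by simp
    show "((\<lambda>y. norm (r y *\<^sub>R (c y - c x) - r x *\<^sub>R (c x - c x) - 0) / norm (y - x)) \<longlongrightarrow> 0) (at x)"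
    proof (rule Lim_null_comparison[OF _ lim0], rule eventually_at_topological[THEN iffD2], rule exI[of _ UNIV], safe)
      fix y assume "y \<noteq> x"
      then have n: "norm (y - x) > 0" by simp
      have "\<bar>r y\<bar> \<le> norm (r y - r x - r' (y - x)) + norm (y - x) * M"
        using M(2)[of "y - x"] r(2) by (simp add: abs_if split: if_splits)
      then have "\<bar>r y\<bar> / norm (y - x) \<le> norm (r y - r x - r' (y - x)) / norm (y - x) + M"
        using n by (simp add: field_simps)
      then have "\<bar>r y\<bar> / norm (y - x) * norm (c y - c x) \<le> (norm (r y - r x - r' (y - x)) / norm (y - x) + M) * norm (c y - c x)"
        by (rule mult_right_mono) simp
      then show "norm (norm (r y *\<^sub>R (c y - c x) - r x *\<^sub>R (c x - c x) - 0) / norm (y - x))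
         \<le> (norm (r y - r x - r' (y - x)) / norm (y - x) + M) * norm (c y - c x)"
        by (simp add: r(2))
    qed auto
  qed simp
  from has_derivative_add[OF 1 2] show ?thesis by (simp add: scaleR_diff_right)
qed

text \<open>The map \<open>m x0\<close> is bounded below by some d > 0, and near \<open>x0\<close>
  the bound d / 2 persists. So the inverses are uniformly bounded by 2 / d there, and
  \<open>n x b - n x0 b\<close> is \<open>n x\<close> applied to the residual
  \<open>b - m x (n x0 b)\<close>, which tends to 0.\<close>

lemma isCont_linear_inverse:
  fixes m n :: "'a::euclidean_space \<Rightarrow> 'b::euclidean_space \<Rightarrow> 'b"
  assumes S: "open S" "x0 \<in> S"
    and lin: "\<And>x. x \<in> S \<Longrightarrow> linear (m x)" "\<And>x. x \<in> S \<Longrightarrow> linear (n x)"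
    and inv: "\<And>x b. x \<in> S \<Longrightarrow> m x (n x b) = b" "\<And>x b. x \<in> S \<Longrightarrow> n x (m x b) = b"
    and cont: "\<And>a. isCont (\<lambda>x. m x a) x0"
  shows "isCont (\<lambda>x. n x b) x0"
proof -
  have "inj (m x0)" using inv(2)[OF S(2)] by (metis injI)
  then obtain d where d: "d > 0" "\<And>a. d * norm a \<le> norm (m x0 a)"
    using linear_inj_bounded_below_pos[OF lin(1)[OF S(2)]] by (auto simp: mult.commute)
  define e where "e x = (\<Sum>i\<in>Basis. norm (m x i - m x0 i))" for x
  have e: "norm (m x a - m x0 a) \<le> norm a * e x" if "x \<in> S" for x a
  proof -
    have "m x a - m x0 a = (\<Sum>i\<in>Basis. (a \<bullet> i) *\<^sub>R (m x i - m x0 i))"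
      using linear_Basis_sum[OF lin(1)[OF that], of a] linear_Basis_sum[OF lin(1)[OF S(2)], of a]
      by (simp add: scaleR_diff_right sum_subtractf)
    also have "norm \<dots> \<le> (\<Sum>i\<in>Basis. norm a * norm (m x i - m x0 i))"
      by (rule order_trans[OF norm_sum], rule sum_mono) (auto intro!: mult_right_mono simp: Basis_le_norm)
    finally show ?thesis by (simp add: e_def sum_distrib_left)
  qed
  have "isCont e x0" unfolding e_def by (intro continuous_intros cont)
  then have "e \<midarrow>x0\<rightarrow> 0" by (simp add: isCont_def e_def)
  then have "\<forall>\<^sub>F x in at x0. e x < d / 2" using d(1) by (intro order_tendstoD) auto
  moreover have "\<forall>\<^sub>F x in at x0. x \<in> S" using S by (rule eventually_at_in_open')
  ultimately have "\<forall>\<^sub>F x in at x0. norm (n x b - n x0 b) \<le> 2 / d * norm (b - m x (n x0 b))"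
  proof eventually_elim
    fix x assume x: "e x < d / 2" "x \<in> S"
    define a where "a = n x b - n x0 b"
    have "norm a * e x \<le> norm a * (d / 2)" using x(1) by (intro mult_left_mono) auto
    with d(2)[of a] e[OF x(2), of a] have "d / 2 * norm a \<le> norm (m x a)"
      using norm_triangle_ineq2[of "m x0 a" "m x0 a - m x a"] by (simp add: norm_minus_commute mult.commute)
    moreover have "m x a = b - m x (n x0 b)"
      by (simp add: a_def linear_diff[OF lin(1)[OF x(2)]] inv x(2))
    ultimately show "norm (n x b - n x0 b) \<le> 2 / d * norm (b - m x (n x0 b))"
      using d(1) unfolding a_def by (simp add: field_simps)
  qed
  moreover have "((\<lambda>x. 2 / d * norm (b - m x (n x0 b))) \<longlongrightarrow> 2 / d * norm (b - m x0 (n x0 b))) (at x0)"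
    by (intro tendsto_intros) (use cont in \<open>simp add: isCont_def\<close>)
  then have "((\<lambda>x. 2 / d * norm (b - m x (n x0 b))) \<longlongrightarrow> 0) (at x0)" by (simp add: inv S(2))
  ultimately have "((\<lambda>x. n x b - n x0 b) \<longlongrightarrow> 0) (at x0)"
    by (rule Lim_null_comparison)
  then show ?thesis by (simp add: isCont_def LIM_zero_iff)
qed

text \<open>Bootstrapping: the derivative of \<open>n\<close> is - n m' n, which again contains
  \<open>n\<close>. Continuity starts the induction, and k-fold differentiability of
  \<open>n\<close> carries over to this expression, which gains one order.\<close>

lemma Ck_on_linear_inverse:
  fixes m n :: "'a::euclidean_space \<Rightarrow> 'b::euclidean_space \<Rightarrow> 'b"
  assumes S: "open S"
    and lin: "\<And>x. x \<in> S \<Longrightarrow> linear (m x)" "\<And>x. x \<in> S \<Longrightarrow> linear (n x)"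
    and inv: "\<And>x b. x \<in> S \<Longrightarrow> m x (n x b) = b" "\<And>x b. x \<in> S \<Longrightarrow> n x (m x b) = b"
    and Ck: "\<And>a. Ck_on k S (\<lambda>x. m x a)"
  shows "Ck_on k S (\<lambda>x. n x b)"
  using Ck
proof (induction k arbitrary: b)
  case 0
  then have "continuous_on S (\<lambda>x. m x a)" for a by simp
  then have m: "isCont (\<lambda>x. m x a) x" if "x \<in> S" for a x
    using that continuous_on_eq_continuous_at[OF S] by blast
  have "isCont (\<lambda>x. n x b) x" if "x \<in> S" for x
    by (rule isCont_linear_inverse[OF S that lin inv m[OF that]])
  then show ?case by (simp add: continuous_at_imp_continuous_on)
next
  case (Suc k)
  let ?D = "\<lambda>x v w. \<Sum>j\<in>Basis. (w \<bullet> j) *\<^sub>R \<D> (\<lambda>x. m x j) x v"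
  have IH: "Ck_on k S (\<lambda>x. n x b)" for b using Suc.IH Ck_on_SucD Suc.prems by blast
  show ?case
  proof (rule Ck_on_SucI[OF S, where f' = "\<lambda>x v. - n x (?D x v (n x b))"])
    fix x assume x: "x \<in> S"
    define w where "w = n x b"
    have der: "((\<lambda>y. m y a) has_derivative (\<lambda>v. ?D x v a)) (at x)" for a
    proof (rule has_derivative_transform_within_open[OF _ S x])
      show "((\<lambda>y. \<Sum>j\<in>Basis. (a \<bullet> j) *\<^sub>R m y j) has_derivative (\<lambda>v. ?D x v a)) (at x)"
        by (intro has_derivative_sum has_derivative_scaleR_right Ck_on_Suc_has_derivative[OF Suc.prems x])
    qed (use linear_Basis_sum[OF lin(1)] in auto)
    have cont: "isCont (\<lambda>x. n x b) x" for b
      by (rule isCont_linear_inverse[where m = m and S = S])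
        (use S x lin inv has_derivative_continuous[OF der] in auto)
    have dr: "((\<lambda>y. (b - m y w) \<bullet> i) has_derivative (\<lambda>v. - (?D x v w) \<bullet> i)) (at x)" for i
      by (rule derivative_eq_intros der refl)+ (simp add: inner_minus_left)
    have sum_eq: "(\<Sum>i\<in>Basis. (- (?D x v w) \<bullet> i) *\<^sub>R n x i) = - n x (?D x v w)" for v
      using linear_Basis_sum[OF lin(2)[OF x], of "- ?D x v w"] linear_neg[OF lin(2)[OF x], of "?D x v w"]
      by (simp only:)
    \<comment> \<open>With w = n x b one has n y b = w + n y (b - m y w), and the residual
      \<open>b - m y w\<close> vanishes at y = x; so continuity of \<open>n\<close> at
      \<open>x\<close> is enough to differentiate.\<close>
    have "((\<lambda>y. w + (\<Sum>i\<in>Basis. ((b - m y w) \<bullet> i) *\<^sub>R n y i)) has_derivative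
        (\<lambda>v. 0 + (\<Sum>i\<in>Basis. (- (?D x v w) \<bullet> i) *\<^sub>R n x i))) (at x)"
      by (intro has_derivative_add has_derivative_const has_derivative_sum
          has_derivative_scaleR_vanishing dr cont) (simp add: w_def inv x)
    then have "((\<lambda>y. w + (\<Sum>i\<in>Basis. ((b - m y w) \<bullet> i) *\<^sub>R n y i)) has_derivative
        (\<lambda>v. - n x (?D x v w))) (at x)"
      by (simp only: sum_eq add_0_left)
    then show "((\<lambda>x. n x b) has_derivative (\<lambda>v. - n x (?D x v (n x b)))) (at x)"
      unfolding w_def[symmetric]
    proof (rule has_derivative_transform_within_open[OF _ S x])
      fix y assume y: "y \<in> S"
      show "w + (\<Sum>i\<in>Basis. ((b - m y w) \<bullet> i) *\<^sub>R n y i) = n y b"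
        by (simp add: linear_Basis_sum[OF lin(2)[OF y], symmetric] linear_diff[OF lin(2)[OF y]] inv y)
    qed
  next
    fix v
    have "Ck_on k S (\<lambda>x. n x (?D x v (n x b)))"
    proof (rule Ck_on_linear_apply[OF S lin(2) IH])
      show "Ck_on k S (\<lambda>x. ?D x v (n x b))"
        by (intro Ck_on_sum S Ck_on_bounded_bilinear[OF _ bounded_bilinear_scaleR] IH Ck_on_const
          Ck_on_bounded_bilinear[OF _ bounded_bilinear_inner] Ck_on_Suc_frechet Suc.prems)
    qed
    then show "Ck_on k S (\<lambda>x. - n x (?D x v (n x b)))"
      by (intro Ck_on_bounded_linear_comp[OF S bounded_linear_minus[OF bounded_linear_ident]])
  qed
qed

section \<open>Rules for smooth functions\<close>

lemma smooth_on_has_derivative: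
  "smooth_on S f \<Longrightarrow> x \<in> S \<Longrightarrow> (f has_derivative \<D> f x) (at x)"
  unfolding smooth_on_def using Ck_on_Suc_has_derivative by blast

lemma smooth_on_frechet: "smooth_on S f \<Longrightarrow> smooth_on S (\<lambda>x. \<D> f x v)"
  unfolding smooth_on_def using Ck_on_Suc_frechet by blast

lemma smooth_on_imp_continuous_on: "smooth_on S f \<Longrightarrow> continuous_on S f"
  unfolding smooth_on_def using Ck_on.simps(1) by blast

lemma smooth_on_cong:
  "open S \<Longrightarrow> (\<And>x. x \<in> S \<Longrightarrow> f x = h x) \<Longrightarrow> smooth_on S f \<longleftrightarrow> smooth_on S h"
  unfolding smooth_on_def using Ck_on_cong by blast

lemma smooth_on_transform:
  "open S \<Longrightarrow> smooth_on S f \<Longrightarrow> (\<And>x. x \<in> S \<Longrightarrow> f x = h x) \<Longrightarrow> smooth_on S h"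
  using smooth_on_cong[of S f h] by simp

lemma smooth_on_subset: "smooth_on T f \<Longrightarrow> S \<subseteq> T \<Longrightarrow> smooth_on S f"
  unfolding smooth_on_def using Ck_on_subset by blast

lemma smooth_on_local:
  "open S \<Longrightarrow> (\<And>x. x \<in> S \<Longrightarrow> \<exists>T. open T \<and> x \<in> T \<and> smooth_on T f) \<Longrightarrow> smooth_on S f"
  unfolding smooth_on_def by (metis Ck_on_local)

lemma smooth_on_const: "open S \<Longrightarrow> smooth_on S (\<lambda>x. c)"
  by (simp add: smooth_on_def Ck_on_const)

lemma smooth_on_bounded_linear: "open S \<Longrightarrow> bounded_linear f \<Longrightarrow> smooth_on S f"
  by (simp add: smooth_on_def Ck_on_bounded_linear)

lemma smooth_on_add: "open S \<Longrightarrow> smooth_on S f \<Longrightarrow> smooth_on S h \<Longrightarrow> smooth_on S (\<lambda>x. f x + h x)"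
  by (simp add: smooth_on_def Ck_on_add)

lemma smooth_on_sum:
  "open S \<Longrightarrow> (\<And>i. i \<in> I \<Longrightarrow> smooth_on S (f i)) \<Longrightarrow> smooth_on S (\<lambda>x. \<Sum>i\<in>I. f i x)"
  by (simp add: smooth_on_def Ck_on_sum)

lemma smooth_on_bounded_linear_comp:
  "open S \<Longrightarrow> bounded_linear h \<Longrightarrow> smooth_on S f \<Longrightarrow> smooth_on S (\<lambda>x. h (f x))"
  by (simp add: smooth_on_def Ck_on_bounded_linear_comp)

lemma smooth_on_bounded_bilinear:
  "open S \<Longrightarrow> bounded_bilinear b \<Longrightarrow> smooth_on S f \<Longrightarrow> smooth_on S h \<Longrightarrow> smooth_on S (\<lambda>x. b (f x) (h x))"
  by (simp add: smooth_on_def Ck_on_bounded_bilinear)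

lemmas smooth_on_mult = smooth_on_bounded_bilinear[OF _ bounded_bilinear_mult]
  and smooth_on_scaleR = smooth_on_bounded_bilinear[OF _ bounded_bilinear_scaleR]
  and smooth_on_inner = smooth_on_bounded_bilinear[OF _ bounded_bilinear_inner]

lemma smooth_on_componentwise:
  fixes f :: "'a::euclidean_space \<Rightarrow> 'b::euclidean_space"
  shows "open S \<Longrightarrow> (\<And>i. i \<in> Basis \<Longrightarrow> smooth_on S (\<lambda>x. f x \<bullet> i)) \<Longrightarrow> smooth_on S f"
  by (simp add: smooth_on_def Ck_on_componentwise)

lemma smooth_on_Pair:
  fixes f :: "'a::euclidean_space \<Rightarrow> 'b::real_normed_vector" and h :: "'a \<Rightarrow> 'c::real_normed_vector"
  assumes "open S" "smooth_on S f" "smooth_on S h"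
  shows "smooth_on S (\<lambda>x. (f x, h x))"
proof -
  have "smooth_on S (\<lambda>x. (f x, 0) + (0, h x))"
    by (intro smooth_on_add assms smooth_on_bounded_linear_comp[where h = "\<lambda>y. (y, 0)"]
        smooth_on_bounded_linear_comp[where h = "\<lambda>y. (0, y)"] bounded_linear_Pair
        bounded_linear_ident bounded_linear_zero)
  then show ?thesis by simp
qed

lemma smooth_on_linear_apply:
  fixes m :: "'a::euclidean_space \<Rightarrow> 'b::euclidean_space \<Rightarrow> 'c::real_normed_vector"
  shows "open S \<Longrightarrow> (\<And>x. x \<in> S \<Longrightarrow> linear (m x)) \<Longrightarrow> (\<And>a. a \<in> Basis \<Longrightarrow> smooth_on S (\<lambda>x. m x a)) \<Longrightarrow>
    smooth_on S w \<Longrightarrow> smooth_on S (\<lambda>x. m x (w x))"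
  by (simp add: smooth_on_def Ck_on_linear_apply)

lemma smooth_on_compose:
  fixes h :: "'a::euclidean_space \<Rightarrow> 'b::euclidean_space"
  shows "open S \<Longrightarrow> open T \<Longrightarrow> h ` S \<subseteq> T \<Longrightarrow> smooth_on T f \<Longrightarrow> smooth_on S h \<Longrightarrow> smooth_on S (\<lambda>x. f (h x))"
  unfolding smooth_on_def using Ck_on_compose by blast

lemma smooth_on_linear_inverse:
  fixes m n :: "'a::euclidean_space \<Rightarrow> 'b::euclidean_space \<Rightarrow> 'b"
  assumes "open S" "\<And>x. x \<in> S \<Longrightarrow> linear (m x)" "\<And>x. x \<in> S \<Longrightarrow> linear (n x)"
    and "\<And>x b. x \<in> S \<Longrightarrow> m x (n x b) = b" "\<And>x b. x \<in> S \<Longrightarrow> n x (m x b) = b"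
    and "\<And>a. smooth_on S (\<lambda>x. m x a)"
  shows "smooth_on S (\<lambda>x. n x b)"
  using Ck_on_linear_inverse[OF assms(1-5)] assms(6) by (simp add: smooth_on_def)

lemma smooth_on_powr: "smooth_on {0<..} (\<lambda>x::real. x powr a)"
  using Ck_on_powr[where c = 1] by (simp add: smooth_on_def)

section \<open>Symmetry of second derivatives\<close>

text \<open>The mean value theorem is applied twice: in direction \<open>v\<close> to the difference
  of \<open>f\<close> over a step along \<open>w\<close>, then in direction \<open>w\<close> to the
  derivative along \<open>v\<close>. The bound on \<open>h\<close> keeps the parallelogram inside
  the ball.\<close>

lemma second_difference_mean_value:
  fixes f :: "'a::euclidean_space \<Rightarrow> real"
  assumes f: "smooth_on (ball x r) f" and h: "h > 0" "h * (norm v + norm w) < r"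
  shows "\<exists>y. dist x y \<le> h * (norm v + norm w) \<and>
    f (x + h *\<^sub>R v + h *\<^sub>R w) - f (x + h *\<^sub>R v) - f (x + h *\<^sub>R w) + f x =
    h\<^sup>2 * \<D> (\<lambda>y. \<D> f y v) y w"
proof -
  let ?D = "\<lambda>y v. \<D> f y v"
  have dist: "dist x (x + s *\<^sub>R v + t *\<^sub>R w) \<le> h * (norm v + norm w)"
    if "0 \<le> s" "s \<le> h" "0 \<le> t" "t \<le> h" for s t
  proof -
    have "norm (s *\<^sub>R v + t *\<^sub>R w) \<le> norm (s *\<^sub>R v) + norm (t *\<^sub>R w)" by (rule norm_triangle_ineq)
    also have "\<dots> \<le> h * norm v + h * norm w"
      using that by (intro add_mono) (auto intro: mult_right_mono)
    finally show ?thesis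
      unfolding dist_norm norm_minus_commute[of x "x + s *\<^sub>R v + t *\<^sub>R w"] by (simp add: algebra_simps)
  qed
  then have mem: "x + s *\<^sub>R v + t *\<^sub>R w \<in> ball x r" if "0 \<le> s" "s \<le> h" "0 \<le> t" "t \<le> h" for s t
    using that h(2) by (meson le_less_trans mem_ball)
  have dv: "((\<lambda>s. k (x + s *\<^sub>R v + t *\<^sub>R w)) has_real_derivative \<D> k (x + s *\<^sub>R v + t *\<^sub>R w) v) (at s)"
    "((\<lambda>t. k (x + s *\<^sub>R v + t *\<^sub>R w)) has_real_derivative \<D> k (x + s *\<^sub>R v + t *\<^sub>R w) w) (at t)"
    if k: "smooth_on (ball x r) k" and st: "0 \<le> s" "s \<le> h" "0 \<le> t" "t \<le> h" for k s t
  proof -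
    let ?K = "\<D> k (x + s *\<^sub>R v + t *\<^sub>R w)"
    have K: "(k has_derivative ?K) (at (x + s *\<^sub>R v + t *\<^sub>R w))"
      using smooth_on_has_derivative[OF k mem[OF st]] .
    have "((\<lambda>s. k (x + s *\<^sub>R v + t *\<^sub>R w)) has_derivative (\<lambda>u. ?K (u *\<^sub>R v))) (at s)"
      by (rule has_derivative_compose[where f = "\<lambda>s. x + s *\<^sub>R v + t *\<^sub>R w" and g = k, OF _ K]) (auto intro!: derivative_eq_intros)
    moreover have "((\<lambda>t. k (x + s *\<^sub>R v + t *\<^sub>R w)) has_derivative (\<lambda>u. ?K (u *\<^sub>R w))) (at t)"
      by (rule has_derivative_compose[where f = "\<lambda>t. x + s *\<^sub>R v + t *\<^sub>R w" and g = k, OF _ K]) (auto intro!: derivative_eq_intros)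
    ultimately show "((\<lambda>s. k (x + s *\<^sub>R v + t *\<^sub>R w)) has_real_derivative ?K v) (at s)"
      "((\<lambda>t. k (x + s *\<^sub>R v + t *\<^sub>R w)) has_real_derivative ?K w) (at t)"
      unfolding has_field_derivative_def
      by (simp_all add: linear_cmul[OF has_derivative_linear[OF K]] mult_commute_abs)
  qed
  have "\<exists>s>0. s < h \<and>
    (f (x + h *\<^sub>R v + h *\<^sub>R w) - f (x + h *\<^sub>R v + 0 *\<^sub>R w)) - (f (x + 0 *\<^sub>R v + h *\<^sub>R w) - f (x + 0 *\<^sub>R v + 0 *\<^sub>R w))
      = (h - 0) * (?D (x + s *\<^sub>R v + h *\<^sub>R w) v - ?D (x + s *\<^sub>R v + 0 *\<^sub>R w) v)"
    by (rule MVT2[OF h(1)]) (use h(1) in \<open>intro DERIV_diff dv(1)[OF f]; simp\<close>)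
  then obtain s where s: "0 < s" "s < h" and 1:
    "f (x + h *\<^sub>R v + h *\<^sub>R w) - f (x + h *\<^sub>R v) - (f (x + h *\<^sub>R w) - f x)
      = h * (?D (x + s *\<^sub>R v + h *\<^sub>R w) v - ?D (x + s *\<^sub>R v + 0 *\<^sub>R w) v)"
    by auto
  have "\<exists>t>0. t < h \<and> ?D (x + s *\<^sub>R v + h *\<^sub>R w) v - ?D (x + s *\<^sub>R v + 0 *\<^sub>R w) v
      = (h - 0) * \<D> (\<lambda>y. ?D y v) (x + s *\<^sub>R v + t *\<^sub>R w) w"
    by (rule MVT2[OF h(1)]) (use s in \<open>intro dv(2)[OF smooth_on_frechet[OF f]]; simp\<close>)
  then obtain t where t: "0 < t" "t < h" and 2:
    "?D (x + s *\<^sub>R v + h *\<^sub>R w) v - ?D (x + s *\<^sub>R v + 0 *\<^sub>R w) v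
      = h * \<D> (\<lambda>y. ?D y v) (x + s *\<^sub>R v + t *\<^sub>R w) w"
    by auto
  have "f (x + h *\<^sub>R v + h *\<^sub>R w) - f (x + h *\<^sub>R v) - f (x + h *\<^sub>R w) + f x =
      h * (h * \<D> (\<lambda>y. ?D y v) (x + s *\<^sub>R v + t *\<^sub>R w) w)"
    unfolding 2[symmetric] 1[symmetric] by simp
  then show ?thesis
    using s t by (intro exI[of _ "x + s *\<^sub>R v + t *\<^sub>R w"] conjI dist) (simp_all add: power2_eq_square)
qed

text \<open>Exchanging \<open>v\<close> and \<open>w\<close> does not change the second difference,
  so the two mixed derivatives take a common value at two points arbitrarily close to
  \<open>x\<close>; continuity transfers this to \<open>x\<close> itself.\<close>

lemma frechet_derivative_symmetric:
  fixes f :: "'a::euclidean_space \<Rightarrow> real"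
  assumes "open S" "x \<in> S" "smooth_on S f"
  shows "\<D> (\<lambda>y. \<D> f y v) x w =
    \<D> (\<lambda>y. \<D> f y w) x v"
proof (rule ccontr)
  let ?A = "\<lambda>v w y. \<D> (\<lambda>y. \<D> f y v) y w"
  assume ne: "?A v w x \<noteq> ?A w v x"
  obtain r where r: "r > 0" "ball x r \<subseteq> S" using assms by (meson openE)
  have f: "smooth_on (ball x r) f" using assms(3) r(2) by (rule smooth_on_subset)
  define e where "e = \<bar>?A v w x - ?A w v x\<bar> / 2"
  have e: "e > 0" using ne by (simp add: e_def)
  have cont: "isCont (?A v w) x" for v w
    using smooth_on_imp_continuous_on[OF smooth_on_frechet[OF smooth_on_frechet[OF assms(3)]]] assms(1,2)
    by (auto simp: continuous_on_eq_continuous_at)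
  obtain d1 where d1: "d1 > 0" "\<And>y. dist y x < d1 \<Longrightarrow> \<bar>?A v w y - ?A v w x\<bar> < e"
    using cont[of v w] e unfolding continuous_at_eps_delta by (auto simp: dist_real_def)
  obtain d2 where d2: "d2 > 0" "\<And>y. dist y x < d2 \<Longrightarrow> \<bar>?A w v y - ?A w v x\<bar> < e"
    using cont[of w v] e unfolding continuous_at_eps_delta by (auto simp: dist_real_def)
  define m where "m = min r (min d1 d2)"
  \<comment> \<open>The summand 1 keeps the denominator positive when \<open>v\<close> and
    \<open>w\<close> vanish; the factor 2 yields the strict bound
    \<open>h * (norm v + norm w) < m\<close>.\<close>
  define h where "h = m / (2 * (norm v + norm w + 1))"
  have m: "m > 0" "m \<le> r" "m \<le> d1" "m \<le> d2" using r d1 d2 by (auto simp: m_def)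
  have h: "h > 0" using m by (simp add: h_def add_nonneg_pos)
  have half: "m / (2 * c) * c = m / 2" if "c > 0" for c using that by simp
  have "h * (norm v + norm w) \<le> h * (norm v + norm w + 1)" using h by simp
  also have "\<dots> = m / 2"
    using half[of "norm v + norm w + 1"] by (simp only: h_def) (simp add: add_nonneg_pos)
  finally have hm: "h * (norm v + norm w) < m" using m by simp
  obtain y1 where y1: "dist x y1 \<le> h * (norm v + norm w)"
    "f (x + h *\<^sub>R v + h *\<^sub>R w) - f (x + h *\<^sub>R v) - f (x + h *\<^sub>R w) + f x = h\<^sup>2 * ?A v w y1"
    using second_difference_mean_value[OF f h, of v w] hm m by force
  obtain y2 where y2: "dist x y2 \<le> h * (norm w + norm v)"
    "f (x + h *\<^sub>R w + h *\<^sub>R v) - f (x + h *\<^sub>R w) - f (x + h *\<^sub>R v) + f x = h\<^sup>2 * ?A w v y2"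
    using second_difference_mean_value[OF f h, of w v] hm m by (force simp: add.commute)
  have "h\<^sup>2 * ?A v w y1 = h\<^sup>2 * ?A w v y2"
    unfolding y1(2)[symmetric] y2(2)[symmetric] by (simp add: algebra_simps)
  then have "?A v w y1 = ?A w v y2" using h by simp
  moreover have "\<bar>?A v w y1 - ?A v w x\<bar> < e" using y1 hm m by (intro d1) (simp add: dist_commute)
  moreover have "\<bar>?A w v y2 - ?A w v x\<bar> < e" using y2 hm m by (intro d2) (simp add: dist_commute add.commute)
  ultimately have "\<bar>?A v w x - ?A w v x\<bar> < 2 * e" by linarith
  then show False by (simp add: e_def)
qed

section \<open>Charts and tangent vectors\<close>

lemma chart_inv_left: "inj_on (snd C) (fst C) \<Longrightarrow> x \<in> fst C \<Longrightarrow> chart_inv C (snd C x) = x"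
  by (simp add: chart_inv_def)

lemma chart_inv_right: "y \<in> snd C ` fst C \<Longrightarrow> snd C (chart_inv C y) = y"
  by (simp add: chart_inv_def f_inv_into_f)

lemma chart_inv_mem: "y \<in> snd C ` fst C \<Longrightarrow> chart_inv C y \<in> fst C"
  by (simp add: chart_inv_def inv_into_into)

text \<open>Components are read off by applying the functional to the coordinate functions. This
  avoids choosing a representation by \<open>chart_vec\<close> and makes sense for every
  functional.\<close>

definition vec_coord :: "('m, 'e::euclidean_space) chart \<Rightarrow> 'm tvec \<Rightarrow> 'e" where
  "vec_coord C v = (\<Sum>i\<in>Basis. v (\<lambda>y. snd C y \<bullet> i) *\<^sub>R i)"

locale atlas =
  fixes \<A> :: "('m, 'e::euclidean_space) atlas"
  assumes atlas: "smooth_atlas \<A>"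
begin

lemma max_atlas_inj: "C \<in> max_atlas \<A> \<Longrightarrow> inj_on (snd C) (fst C)"
  by (simp add: max_atlas_def)

lemma max_atlas_sub: "C \<in> max_atlas \<A> \<Longrightarrow> fst C \<subseteq> points \<A>"
  by (simp add: max_atlas_def)

lemma chart_max_atlas:
  assumes "C \<in> \<A>"
  shows "C \<in> max_atlas \<A>"
proof -
  have "inj_on (snd C) (fst C)" "\<forall>D\<in>\<A>. compatible C D \<and> compatible D C"
    using atlas assms unfolding smooth_atlas_def by blast+
  moreover have "fst C \<subseteq> points \<A>" unfolding points_def using assms by blast
  ultimately show ?thesis by (simp add: max_atlas_def)
qed

lemma points_chart: "x \<in> points \<A> \<Longrightarrow> \<exists>C\<in>\<A>. x \<in> fst C"
  by (auto simp: points_def)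

lemma inv_left: "C \<in> max_atlas \<A> \<Longrightarrow> x \<in> fst C \<Longrightarrow> chart_inv C (snd C x) = x"
  by (rule chart_inv_left[OF max_atlas_inj])

text \<open>Charts of the maximal atlas are by definition compatible only with those of
  \<open>\<A>\<close>. The transition therefore has to factor through a chart \<open>E\<close> of
  \<open>\<A>\<close>, which is possible on a neighbourhood of \<open>x\<close>;
  \<open>max_atlas_compatible\<close> glues these pieces.\<close>

lemma transition_local:
  assumes C: "C \<in> max_atlas \<A>" and D: "D \<in> max_atlas \<A>" and x: "x \<in> fst C" "x \<in> fst D"
  shows "\<exists>T. open T \<and> snd C x \<in> T \<and> T \<subseteq> snd C ` (fst C \<inter> fst D) \<and> smooth_on T (snd D \<circ> chart_inv C)"
proof -
  obtain E where E: "E \<in> \<A>" "x \<in> fst E" using x(1) max_atlas_sub[OF C] points_chart by blast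
  have CE: "compatible C E" and DE: "compatible E D"
    using C D E by (auto simp: max_atlas_def)
  let ?U = "snd C ` (fst C \<inter> fst E)" and ?V = "snd E ` (fst E \<inter> fst D)"
  have op: "open ?U" "open ?V" and sm: "smooth_on ?U (snd E \<circ> chart_inv C)" "smooth_on ?V (snd D \<circ> chart_inv E)"
    using CE DE by (auto simp: compatible_def)
  define T where "T = ?U \<inter> (snd E \<circ> chart_inv C) -` ?V"
  have T: "open T"
    unfolding T_def by (rule continuous_open_preimage[OF smooth_on_imp_continuous_on[OF sm(1)] op])
  have mem: "\<exists>x'\<in>fst C \<inter> fst E \<inter> fst D. y = snd C x'" if "y \<in> T" for y
  proof -
    from that obtain x' where x': "x' \<in> fst C" "x' \<in> fst E" "y = snd C x'" by (auto simp: T_def)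
    with that have "snd E x' \<in> ?V" by (simp add: T_def inv_left[OF C])
    then have "x' \<in> fst D"
      using inj_onD[OF max_atlas_inj[OF chart_max_atlas[OF E(1)]]] x'(2) by blast
    with x' show ?thesis by blast
  qed
  have "smooth_on T (\<lambda>y. (snd D \<circ> chart_inv E) ((snd E \<circ> chart_inv C) y))"
  proof (rule smooth_on_compose[OF T op(2) _ sm(2)])
    show "smooth_on T (snd E \<circ> chart_inv C)" by (rule smooth_on_subset[OF sm(1)]) (simp add: T_def)
  qed (auto simp: T_def)
  moreover have "(snd D \<circ> chart_inv E) ((snd E \<circ> chart_inv C) y) = (snd D \<circ> chart_inv C) y" if "y \<in> T" for y
  proof -
    from mem[OF that] obtain x' where "x' \<in> fst C" "x' \<in> fst E" "y = snd C x'" by blast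
    then show ?thesis by (simp add: inv_left[OF C] inv_left[OF chart_max_atlas[OF E(1)]])
  qed
  ultimately have "smooth_on T (snd D \<circ> chart_inv C)"
    by (rule smooth_on_transform[OF T])
  moreover have "snd C x \<in> T"
    using x E by (auto simp: T_def inv_left[OF C])
  ultimately show ?thesis using T mem by blast
qed

lemma max_atlas_compatible:
  assumes C: "C \<in> max_atlas \<A>" and D: "D \<in> max_atlas \<A>"
  shows "compatible C D"
proof -
  let ?U = "snd C ` (fst C \<inter> fst D)"
  have loc: "\<exists>T. open T \<and> y \<in> T \<and> T \<subseteq> ?U \<and> smooth_on T (snd D \<circ> chart_inv C)" if "y \<in> ?U" for y
    using transition_local[OF C D] that by blast
  then have "open ?U" by (subst open_subopen) blast
  moreover from this have "smooth_on ?U (snd D \<circ> chart_inv C)"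
    by (rule smooth_on_local) (use loc in blast)
  ultimately show ?thesis by (simp add: compatible_def)
qed

lemma open_image_inter:
  "C \<in> max_atlas \<A> \<Longrightarrow> D \<in> max_atlas \<A> \<Longrightarrow> open (snd C ` (fst C \<inter> fst D))"
  using max_atlas_compatible by (simp add: compatible_def)

lemma transition_smooth:
  "C \<in> max_atlas \<A> \<Longrightarrow> D \<in> max_atlas \<A> \<Longrightarrow> smooth_on (snd C ` (fst C \<inter> fst D)) (snd D \<circ> chart_inv C)"
  using max_atlas_compatible by (simp add: compatible_def)

lemma open_chart_image: "C \<in> max_atlas \<A> \<Longrightarrow> open (snd C ` fst C)"
  using open_image_inter[of C C] by simp

lemma open_transition_preimage:
  assumes "C \<in> max_atlas \<A>" "D \<in> max_atlas \<A>" "open S"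
  shows "open (snd C ` {x \<in> fst C \<inter> fst D. snd D x \<in> S})"
proof -
  have "snd C ` {x \<in> fst C \<inter> fst D. snd D x \<in> S} =
      snd C ` (fst C \<inter> fst D) \<inter> (snd D \<circ> chart_inv C) -` S"
    by (auto simp: inv_left[OF assms(1)])
  then show ?thesis
    using continuous_open_preimage[OF smooth_on_imp_continuous_on[OF transition_smooth[OF assms(1,2)]]
        open_image_inter[OF assms(1,2)] assms(3)] by simp
qed

section \<open>Manifold topology and functions smooth near a point\<close>

text \<open>\<open>topology\<close> returns the stated open sets only if they do form a topology;
  for intersections this rests on injectivity of the charts.\<close>

lemma openin_mtop:
  "openin (mtop \<A>) W \<longleftrightarrow> W \<subseteq> points \<A> \<and> (\<forall>C\<in>\<A>. open (snd C ` (W \<inter> fst C)))"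
proof -
  have "istopology (\<lambda>W. W \<subseteq> points \<A> \<and> (\<forall>C\<in>\<A>. open (snd C ` (W \<inter> fst C))))"
    unfolding istopology_def
  proof (intro conjI allI impI ballI)
    fix S T C assume S: "S \<subseteq> points \<A> \<and> (\<forall>C\<in>\<A>. open (snd C ` (S \<inter> fst C)))"
      and T: "T \<subseteq> points \<A> \<and> (\<forall>C\<in>\<A>. open (snd C ` (T \<inter> fst C)))" and C: "C \<in> \<A>"
    have "snd C ` (S \<inter> T \<inter> fst C) = snd C ` (S \<inter> fst C) \<inter> snd C ` (T \<inter> fst C)"
      using inj_onD[OF max_atlas_inj[OF chart_max_atlas[OF C]]] by blast
    then show "open (snd C ` (S \<inter> T \<inter> fst C))" using S T C by auto
  next
    fix K C assume K: "\<forall>S\<in>K. S \<subseteq> points \<A> \<and> (\<forall>C\<in>\<A>. open (snd C ` (S \<inter> fst C)))" and C: "C \<in> \<A>"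
    have "snd C ` (\<Union> K \<inter> fst C) = (\<Union>S\<in>K. snd C ` (S \<inter> fst C))" by blast
    then show "open (snd C ` (\<Union> K \<inter> fst C))" using K C by auto
  qed blast+
  then show ?thesis unfolding mtop_def by (simp add: topology_inverse')
qed

lemma open_image_openin:
  assumes C: "C \<in> max_atlas \<A>" and W: "openin (mtop \<A>) W"
  shows "open (snd C ` (W \<inter> fst C))"
proof (subst open_subopen, intro ballI)
  fix y assume "y \<in> snd C ` (W \<inter> fst C)"
  then obtain x where x: "x \<in> W" "x \<in> fst C" "y = snd C x" by blast
  obtain E where E: "E \<in> \<A>" "x \<in> fst E" using x(2) max_atlas_sub[OF C] points_chart by blast
  let ?T = "snd C ` {x \<in> fst C \<inter> fst E. snd E x \<in> snd E ` (W \<inter> fst E)}"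
  have "open ?T"
    using W E by (intro open_transition_preimage C chart_max_atlas) (auto simp: openin_mtop)
  moreover have "?T \<subseteq> snd C ` (W \<inter> fst C)"
    using inj_onD[OF max_atlas_inj[OF chart_max_atlas[OF E(1)]]] by blast
  ultimately show "\<exists>T. open T \<and> y \<in> T \<and> T \<subseteq> snd C ` (W \<inter> fst C)"
    using x E(2) by blast
qed

lemma openin_chart_preimage:
  assumes C: "C \<in> max_atlas \<A>" and S: "open S"
  shows "openin (mtop \<A>) {x \<in> fst C. snd C x \<in> S}"
  unfolding openin_mtop
proof (intro conjI ballI)
  show "{x \<in> fst C. snd C x \<in> S} \<subseteq> points \<A>" using max_atlas_sub[OF C] by blast
  fix D assume "D \<in> \<A>"
  have "{x \<in> fst C. snd C x \<in> S} \<inter> fst D = {x \<in> fst D \<inter> fst C. snd C x \<in> S}" by blast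
  then show "open (snd D ` ({x \<in> fst C. snd C x \<in> S} \<inter> fst D))"
    using open_transition_preimage[OF chart_max_atlas[OF \<open>D \<in> \<A>\<close>] C S] by simp
qed

lemma openin_chart: "C \<in> max_atlas \<A> \<Longrightarrow> openin (mtop \<A>) (fst C)"
  using openin_chart_preimage[of C UNIV] by simp

text \<open>Independence of the chart: the definition provides some chart of \<open>\<A>\<close>,
  whereas computations need the criterion in a prescribed chart of the maximal atlas.\<close>

lemma smooth_near_iff:
  assumes C: "C \<in> max_atlas \<A>" "x \<in> fst C"
  shows "smooth_near \<A> x f \<longleftrightarrow>
    (\<exists>S. open S \<and> snd C x \<in> S \<and> S \<subseteq> snd C ` fst C \<and> smooth_on S (f \<circ> chart_inv C))"
proof -
  have change: "\<exists>T. open T \<and> snd C x \<in> T \<and> T \<subseteq> snd C ` fst C \<and> smooth_on T (f \<circ> chart_inv C)"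
    if C: "C \<in> max_atlas \<A>" "x \<in> fst C" and D: "D \<in> max_atlas \<A>" "x \<in> fst D"
      and S: "open S" "snd D x \<in> S" "S \<subseteq> snd D ` fst D" "smooth_on S (f \<circ> chart_inv D)" for C D S
  proof -
    define T where "T = snd C ` {x \<in> fst C \<inter> fst D. snd D x \<in> S}"
    have T: "open T" unfolding T_def by (rule open_transition_preimage[OF C(1) D(1) S(1)])
    have "smooth_on T (\<lambda>y. (f \<circ> chart_inv D) ((snd D \<circ> chart_inv C) y))"
    proof (rule smooth_on_compose[OF T S(1) _ S(4)])
      show "smooth_on T (snd D \<circ> chart_inv C)"
        using transition_smooth[OF C(1) D(1)] by (rule smooth_on_subset) (auto simp: T_def)
    qed (auto simp: T_def inv_left[OF C(1)])
    moreover have "(f \<circ> chart_inv D) ((snd D \<circ> chart_inv C) y) = (f \<circ> chart_inv C) y" if "y \<in> T" for y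
    proof -
      from that obtain x' where "x' \<in> fst C" "x' \<in> fst D" "y = snd C x'" by (auto simp: T_def)
      then show ?thesis by (simp add: inv_left[OF C(1)] inv_left[OF D(1)])
    qed
    ultimately have "smooth_on T (f \<circ> chart_inv C)" by (rule smooth_on_transform[OF T])
    then show ?thesis using T C(2) D(2) S(2) by (auto simp: T_def)
  qed
  show ?thesis
  proof
    assume "smooth_near \<A> x f"
    then show "\<exists>S. open S \<and> snd C x \<in> S \<and> S \<subseteq> snd C ` fst C \<and> smooth_on S (f \<circ> chart_inv C)"
      unfolding smooth_near_def using change[OF C] chart_max_atlas by blast
  next
    assume "\<exists>S. open S \<and> snd C x \<in> S \<and> S \<subseteq> snd C ` fst C \<and> smooth_on S (f \<circ> chart_inv C)"
    then obtain S where S: "open S" "snd C x \<in> S" "S \<subseteq> snd C ` fst C" "smooth_on S (f \<circ> chart_inv C)"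
      by blast
    obtain E where E: "E \<in> \<A>" "x \<in> fst E" using C max_atlas_sub points_chart by blast
    with change[OF chart_max_atlas[OF E(1)] E(2) C S] show "smooth_near \<A> x f"
      unfolding smooth_near_def by blast
  qed
qed

lemma smooth_near_points: "smooth_near \<A> x f \<Longrightarrow> x \<in> points \<A>"
  by (auto simp: smooth_near_def points_def)

lemma smooth_near_neighbourhood:
  assumes "smooth_near \<A> x f"
  shows "\<exists>W. openin (mtop \<A>) W \<and> x \<in> W \<and> (\<forall>y\<in>W. smooth_near \<A> y f)"
proof -
  obtain C where C: "C \<in> \<A>" "x \<in> fst C" using smooth_near_points[OF assms] points_chart by blast
  note C' = chart_max_atlas[OF C(1)]
  obtain S where S: "open S" "snd C x \<in> S" "S \<subseteq> snd C ` fst C" "smooth_on S (f \<circ> chart_inv C)"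
    using assms smooth_near_iff[OF C' C(2)] by blast
  have "\<forall>y\<in>{x \<in> fst C. snd C x \<in> S}. smooth_near \<A> y f"
    using S by (auto simp: smooth_near_iff[OF C'])
  then show ?thesis using openin_chart_preimage[OF C' S(1)] C(2) S(2) by blast
qed

lemma smooth_near_imp_smooth_on:
  assumes C: "C \<in> max_atlas \<A>" and W: "openin (mtop \<A>) W"
    and f: "\<And>x. x \<in> W \<inter> fst C \<Longrightarrow> smooth_near \<A> x f"
  shows "smooth_on (snd C ` (W \<inter> fst C)) (f \<circ> chart_inv C)"
proof (rule smooth_on_local[OF open_image_openin[OF C W]])
  fix y assume "y \<in> snd C ` (W \<inter> fst C)"
  then obtain x where "x \<in> W" "x \<in> fst C" "y = snd C x" by blast
  then show "\<exists>T. open T \<and> y \<in> T \<and> smooth_on T (f \<circ> chart_inv C)"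
    using f[of x] smooth_near_iff[OF C] by blast
qed

lemma smooth_nearI:
  assumes C: "C \<in> max_atlas \<A>" "x \<in> fst C" and S: "open S" "snd C x \<in> S" "smooth_on S h"
    and f: "\<And>y. y \<in> fst C \<Longrightarrow> snd C y \<in> S \<Longrightarrow> f y = h (snd C y)"
  shows "smooth_near \<A> x f"
proof -
  have op: "open (S \<inter> snd C ` fst C)" using S(1) open_chart_image[OF C(1)] by blast
  have "smooth_on (S \<inter> snd C ` fst C) (f \<circ> chart_inv C)"
    using smooth_on_subset[OF S(3)] f
    by (subst smooth_on_cong[OF op, where h = h]) (auto simp: inv_left[OF C(1)])
  then show ?thesis using smooth_near_iff[OF C] op S(2) C(2) by blast
qed

lemma smooth_near_cong:
  assumes "openin (mtop \<A>) W" "x \<in> W" "\<And>y. y \<in> W \<Longrightarrow> f y = h y"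
  shows "smooth_near \<A> x f \<longleftrightarrow> smooth_near \<A> x h"
proof -
  have *: "smooth_near \<A> x h" if f: "smooth_near \<A> x f" and eq: "\<And>y. y \<in> W \<Longrightarrow> f y = h y" for f h
  proof -
    obtain C where C: "C \<in> \<A>" "x \<in> fst C" using smooth_near_points[OF f] points_chart by blast
    note C' = chart_max_atlas[OF C(1)]
    obtain S where S: "open S" "snd C x \<in> S" "S \<subseteq> snd C ` fst C" "smooth_on S (f \<circ> chart_inv C)"
      using f smooth_near_iff[OF C' C(2)] by blast
    have op: "open (snd C ` (W \<inter> fst C))" by (rule open_image_openin[OF C' assms(1)])
    show ?thesis
    proof (rule smooth_nearI[OF C' C(2)])
      show "open (S \<inter> snd C ` (W \<inter> fst C))" using S op by blast
      show "snd C x \<in> S \<inter> snd C ` (W \<inter> fst C)" using S(2) C(2) assms(2) by blast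
      show "smooth_on (S \<inter> snd C ` (W \<inter> fst C)) (f \<circ> chart_inv C)" using S(4) by (rule smooth_on_subset) blast
      fix y assume y: "y \<in> fst C" "snd C y \<in> S \<inter> snd C ` (W \<inter> fst C)"
      then have "y \<in> W" using inj_onD[OF max_atlas_inj[OF C']] by blast
      then show "h y = (f \<circ> chart_inv C) (snd C y)" by (simp add: inv_left[OF C' y(1)] eq)
    qed
  qed
  show ?thesis using *[of f h] *[of h f] assms(3) by metis
qed

lemma smooth_near_const:
  assumes "x \<in> points \<A>" shows "smooth_near \<A> x (\<lambda>y. c)"
proof -
  obtain C where C: "C \<in> \<A>" "x \<in> fst C" using points_chart[OF assms] by blast
  show ?thesis
    by (rule smooth_nearI[OF chart_max_atlas[OF C(1)] C(2) open_UNIV UNIV_I smooth_on_const[OF open_UNIV]]) simp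
qed

lemma
  assumes f: "smooth_near \<A> x f" and h: "smooth_near \<A> x h"
  shows smooth_near_add: "smooth_near \<A> x (\<lambda>y. f y + h y)"
    and smooth_near_mult: "smooth_near \<A> x (\<lambda>y. f y * h y)"
proof -
  obtain C where C: "C \<in> \<A>" "x \<in> fst C" using smooth_near_points[OF f] points_chart by blast
  note C' = chart_max_atlas[OF C(1)] C(2)
  obtain S where S: "open S" "snd C x \<in> S" "smooth_on S (f \<circ> chart_inv C)"
    using f smooth_near_iff[OF C'] by blast
  obtain T where T: "open T" "snd C x \<in> T" "smooth_on T (h \<circ> chart_inv C)"
    using h smooth_near_iff[OF C'] by blast
  have op: "open (S \<inter> T)" "snd C x \<in> S \<inter> T" using S T by auto
  have sm: "smooth_on (S \<inter> T) (f \<circ> chart_inv C)" "smooth_on (S \<inter> T) (h \<circ> chart_inv C)"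
    using S(3) T(3) smooth_on_subset by blast+
  show "smooth_near \<A> x (\<lambda>y. f y + h y)"
    by (rule smooth_nearI[OF C' op smooth_on_add[OF op(1) sm]]) (simp add: inv_left[OF C'(1)])
  show "smooth_near \<A> x (\<lambda>y. f y * h y)"
    by (rule smooth_nearI[OF C' op smooth_on_mult[OF op(1) sm]]) (simp add: inv_left[OF C'(1)])
qed

lemma smooth_near_diff:
  assumes "smooth_near \<A> x f" "smooth_near \<A> x h"
  shows "smooth_near \<A> x (\<lambda>y. f y - h y)"
  using smooth_near_add[OF assms(1) smooth_near_mult[OF smooth_near_const[of x "-1"] assms(2)]]
    smooth_near_points[OF assms(1)] by simp

lemma smooth_near_compose:
  fixes h :: "real \<Rightarrow> real"
  assumes f: "smooth_near \<A> x f" and h: "open T" "f x \<in> T" "smooth_on T h"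
  shows "smooth_near \<A> x (\<lambda>y. h (f y))"
proof -
  obtain C where C: "C \<in> \<A>" "x \<in> fst C" using smooth_near_points[OF f] points_chart by blast
  note C' = chart_max_atlas[OF C(1)] C(2)
  obtain S where S: "open S" "snd C x \<in> S" "smooth_on S (f \<circ> chart_inv C)"
    using f smooth_near_iff[OF C'] by blast
  define U where "U = S \<inter> (f \<circ> chart_inv C) -` T"
  have U: "open U" "snd C x \<in> U"
    unfolding U_def using continuous_open_preimage[OF smooth_on_imp_continuous_on[OF S(3)] S(1) h(1)]
    by (auto simp: S(2) inv_left[OF C'] h(2))
  have "smooth_on U (\<lambda>u. h ((f \<circ> chart_inv C) u))"
  proof (rule smooth_on_compose[OF U(1) h(1) _ h(3)])
    show "smooth_on U (f \<circ> chart_inv C)" by (rule smooth_on_subset[OF S(3)]) (simp add: U_def)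
  qed (auto simp: U_def)
  from smooth_nearI[OF C' U this] show ?thesis by (simp add: inv_left[OF C'(1)])
qed

lemma smooth_near_coord:
  assumes "C \<in> max_atlas \<A>" "x \<in> fst C"
  shows "smooth_near \<A> x (\<lambda>y. snd C y \<bullet> i)"
  by (rule smooth_nearI[OF assms, where S = UNIV and h = "\<lambda>u. u \<bullet> i"])
    (auto intro: smooth_on_bounded_linear bounded_linear_inner_left)

lemma smooth_near_has_derivative:
  assumes "C \<in> max_atlas \<A>" "x \<in> fst C" "smooth_near \<A> x f"
  shows "((f \<circ> chart_inv C) has_derivative \<D> (f \<circ> chart_inv C) (snd C x)) (at (snd C x))"
  using assms smooth_near_iff smooth_on_has_derivative by metis

section \<open>Tangent vectors in charts\<close>

lemma chart_vec_apply:
  assumes "C \<in> max_atlas \<A>" "x \<in> fst C" "smooth_near \<A> x f"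
    and "((f \<circ> chart_inv C) has_derivative f') (at (snd C x))"
  shows "chart_vec \<A> C x w f = f' w"
  using assms frechet_derivative_eqI[OF assms(4)] by (simp add: chart_vec_def)

lemma chart_vec_linear:
  assumes "C \<in> max_atlas \<A>" "x \<in> fst C"
  shows "chart_vec \<A> C x (a *\<^sub>R v + b *\<^sub>R w) = a \<bullet>\<^sub>t chart_vec \<A> C x v \<boxplus> b \<bullet>\<^sub>t chart_vec \<A> C x w"
  using has_derivative_linear[OF smooth_near_has_derivative[OF assms]]
  by (auto simp: fun_eq_iff chart_vec_def vadd_def vscale_def linear_add linear_cmul)

lemma chart_vec_coord:
  assumes "C \<in> max_atlas \<A>" "x \<in> fst C"
  shows "chart_vec \<A> C x w (\<lambda>y. snd C y \<bullet> i) = w \<bullet> i"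
proof (rule chart_vec_apply[OF assms smooth_near_coord[OF assms]])
  show "((\<lambda>y. snd C y \<bullet> i) \<circ> chart_inv C has_derivative (\<lambda>w. w \<bullet> i)) (at (snd C x))"
  proof (rule has_derivative_transform_within_open[OF _ open_chart_image[OF assms(1)]])
    show "((\<lambda>w. w \<bullet> i) has_derivative (\<lambda>w. w \<bullet> i)) (at (snd C x))"
      by (auto intro!: derivative_eq_intros)
  qed (use assms(2) in \<open>auto simp: chart_inv_right\<close>)
qed

lemma vec_coord_chart_vec:
  assumes "C \<in> max_atlas \<A>" "x \<in> fst C"
  shows "vec_coord C (chart_vec \<A> C x w) = w"
  by (simp add: vec_coord_def chart_vec_coord[OF assms] euclidean_representation)

lemma chart_vec_inj:
  assumes "C \<in> max_atlas \<A>" "x \<in> fst C" "chart_vec \<A> C x v = chart_vec \<A> C x w"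
  shows "v = w"
  using vec_coord_chart_vec[OF assms(1,2)] assms(3) by metis

lemma chart_vec_change:
  assumes C: "C \<in> max_atlas \<A>" "x \<in> fst C" and D: "D \<in> max_atlas \<A>" "x \<in> fst D"
  shows "chart_vec \<A> D x w = chart_vec \<A> C x (\<D> (snd C \<circ> chart_inv D) (snd D x) w)"
proof
  fix f
  show "chart_vec \<A> D x w f = chart_vec \<A> C x (\<D> (snd C \<circ> chart_inv D) (snd D x) w) f"
  proof (cases "smooth_near \<A> x f")
    case True
    let ?\<tau> = "snd C \<circ> chart_inv D"
    have xD: "snd D x \<in> snd D ` (fst D \<inter> fst C)" using C D by blast
    have "(?\<tau> has_derivative \<D> ?\<tau> (snd D x)) (at (snd D x))"
      by (rule smooth_on_has_derivative[OF transition_smooth[OF D(1) C(1)] xD])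
    moreover have "((f \<circ> chart_inv C) has_derivative \<D> (f \<circ> chart_inv C) (snd C x)) (at (?\<tau> (snd D x)))"
      using smooth_near_has_derivative[OF C True] by (simp add: inv_left[OF D])
    ultimately have "((\<lambda>u. (f \<circ> chart_inv C) (?\<tau> u)) has_derivative
        (\<lambda>w. \<D> (f \<circ> chart_inv C) (snd C x) (\<D> ?\<tau> (snd D x) w))) (at (snd D x))"
      by (rule has_derivative_compose)
    then have "((f \<circ> chart_inv D) has_derivative
        (\<lambda>w. \<D> (f \<circ> chart_inv C) (snd C x) (\<D> ?\<tau> (snd D x) w))) (at (snd D x))"
      by (rule has_derivative_transform_within_open[OF _ open_image_inter[OF D(1) C(1)] xD])
        (auto simp: inv_left[OF D(1)] inv_left[OF C(1)])
    from chart_vec_apply[OF D True this] chart_vec_apply[OF C True smooth_near_has_derivative[OF C True]]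
    show ?thesis by metis
  qed (simp add: chart_vec_def)
qed

lemma tangent_eq:
  assumes "C \<in> max_atlas \<A>" "x \<in> fst C"
  shows "tangent \<A> x = range (chart_vec \<A> C x)"
proof -
  have "x \<in> points \<A>" using assms max_atlas_sub by blast
  then obtain E where E: "E \<in> \<A>" "x \<in> fst E" using points_chart by blast
  have "chart_vec \<A> C x w \<in> tangent \<A> x" for w
    unfolding tangent_def using chart_vec_change[OF chart_max_atlas[OF E(1)] E(2) assms] E by blast
  moreover have "v \<in> range (chart_vec \<A> C x)" if "v \<in> tangent \<A> x" for v
    using that chart_vec_change[OF assms] chart_max_atlas unfolding tangent_def by blast
  ultimately show ?thesis by blast
qed

lemma tangent_chart_vec: "C \<in> max_atlas \<A> \<Longrightarrow> x \<in> fst C \<Longrightarrow> chart_vec \<A> C x w \<in> tangent \<A> x"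
  using tangent_eq by blast

lemma chart_vec_vec_coord:
  assumes "C \<in> max_atlas \<A>" "x \<in> fst C" "v \<in> tangent \<A> x"
  shows "chart_vec \<A> C x (vec_coord C v) = v"
  using assms tangent_eq[OF assms(1,2)] vec_coord_chart_vec[OF assms(1,2)] by auto

lemma tangentE:
  assumes "v \<in> tangent \<A> x"
  obtains C w where "C \<in> max_atlas \<A>" "x \<in> fst C" "v = chart_vec \<A> C x w"
  using assms chart_max_atlas unfolding tangent_def by blast

lemma tangent_points: "v \<in> tangent \<A> x \<Longrightarrow> x \<in> points \<A>"
  unfolding tangent_def points_def by blast

text \<open>Tangent vectors see only germs. This includes functions that are not smooth near
  \<open>x\<close>: smoothness there is itself a property of the germ, and without it both values
  are the default 0.\<close>

lemma tangent_cong: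
  assumes v: "v \<in> tangent \<A> x" and W: "openin (mtop \<A>) W" "x \<in> W" and eq: "\<And>y. y \<in> W \<Longrightarrow> f y = h y"
  shows "v f = v h"
proof -
  obtain C w where C: "C \<in> max_atlas \<A>" "x \<in> fst C" "v = chart_vec \<A> C x w" by (rule tangentE[OF v])
  have sm: "smooth_near \<A> x f \<longleftrightarrow> smooth_near \<A> x h" by (rule smooth_near_cong[OF W eq])
  have "\<D> (f \<circ> chart_inv C) (snd C x) = \<D> (h \<circ> chart_inv C) (snd C x)"
    if "smooth_near \<A> x f"
  proof (rule sym, rule frechet_derivative_eqI, rule has_derivative_transform_within_open[OF smooth_near_has_derivative[OF C(1,2) that]])
    show "open (snd C ` (W \<inter> fst C))" by (rule open_image_openin[OF C(1) W(1)])
    show "snd C x \<in> snd C ` (W \<inter> fst C)" using C(2) W(2) by blast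
  qed (auto simp: inv_left[OF C(1)] eq)
  then show ?thesis unfolding C(3) chart_vec_def using sm by auto
qed

lemma
  assumes v: "v \<in> tangent \<A> x" and f: "smooth_near \<A> x f" and h: "smooth_near \<A> x h"
  shows tangent_add: "v (\<lambda>y. f y + h y) = v f + v h"
    and tangent_mult: "v (\<lambda>y. f y * h y) = f x * v h + v f * h x"
proof -
  obtain C w where C: "C \<in> max_atlas \<A>" "x \<in> fst C" and v: "v = chart_vec \<A> C x w" by (rule tangentE[OF v])
  note df = smooth_near_has_derivative[OF C f] and dh = smooth_near_has_derivative[OF C h]
  have "((\<lambda>y. f y + h y) \<circ> chart_inv C has_derivative (\<lambda>w. \<D> (f \<circ> chart_inv C) (snd C x) w + \<D> (h \<circ> chart_inv C) (snd C x) w)) (at (snd C x))"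
    using has_derivative_add[OF df dh] by (simp add: o_def)
  from chart_vec_apply[OF C smooth_near_add[OF f h] this]
  show "v (\<lambda>y. f y + h y) = v f + v h"
    by (simp add: v chart_vec_apply[OF C f df] chart_vec_apply[OF C h dh])
  have "((\<lambda>y. f y * h y) \<circ> chart_inv C has_derivative (\<lambda>w. f x * \<D> (h \<circ> chart_inv C) (snd C x) w + \<D> (f \<circ> chart_inv C) (snd C x) w * h x)) (at (snd C x))"
    using has_derivative_mult[OF df dh] by (simp add: o_def inv_left[OF C])
  from chart_vec_apply[OF C smooth_near_mult[OF f h] this]
  show "v (\<lambda>y. f y * h y) = f x * v h + v f * h x"
    by (simp add: v chart_vec_apply[OF C f df] chart_vec_apply[OF C h dh])
qed

lemma tangent_const:
  assumes "v \<in> tangent \<A> x" shows "v (\<lambda>y. c) = 0"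
proof -
  obtain C w where C: "C \<in> max_atlas \<A>" "x \<in> fst C" and v: "v = chart_vec \<A> C x w" by (rule tangentE[OF assms])
  show ?thesis unfolding v
    by (rule chart_vec_apply[OF C smooth_near_const[OF tangent_points[OF assms]]]) (simp add: o_def)
qed

lemma tangent_diff:
  assumes v: "v \<in> tangent \<A> x" and f: "smooth_near \<A> x f" and h: "smooth_near \<A> x h"
  shows "v (\<lambda>y. f y - h y) = v f - v h"
proof -
  note c = smooth_near_const[OF tangent_points[OF v], of "-1"]
  show ?thesis
    using tangent_add[OF v f smooth_near_mult[OF c h]] tangent_mult[OF v c h] tangent_const[OF v] by simp
qed

lemma tangent_compose:
  fixes h :: "real \<Rightarrow> real"
  assumes v: "v \<in> tangent \<A> x" and f: "smooth_near \<A> x f"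
    and h: "open T" "f x \<in> T" "smooth_on T h" "(h has_real_derivative d) (at (f x))"
  shows "v (\<lambda>y. h (f y)) = d * v f"
proof -
  obtain C w where C: "C \<in> max_atlas \<A>" "x \<in> fst C" and v: "v = chart_vec \<A> C x w" by (rule tangentE[OF v])
  note df = smooth_near_has_derivative[OF C f]
  have "(h has_derivative (\<lambda>u. d * u)) (at ((f \<circ> chart_inv C) (snd C x)))"
    using h(4) by (simp add: inv_left[OF C] has_field_derivative_def)
  from has_derivative_compose[OF df this]
  have "((\<lambda>y. h (f y)) \<circ> chart_inv C has_derivative (\<lambda>w. d * \<D> (f \<circ> chart_inv C) (snd C x) w)) (at (snd C x))"
    by (simp add: o_def)
  from chart_vec_apply[OF C smooth_near_compose[OF f h(1-3)] this]
  show ?thesis by (simp add: v chart_vec_apply[OF C f df])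
qed

section \<open>Vector fields and the Lie bracket\<close>

lemma smooth_field_openin: "smooth_field \<A> W X \<Longrightarrow> openin (mtop \<A>) W"
  and smooth_field_tangent: "smooth_field \<A> W X \<Longrightarrow> x \<in> W \<Longrightarrow> X x \<in> tangent \<A> x"
  and smooth_field_apply: "smooth_field \<A> W X \<Longrightarrow> x \<in> W \<Longrightarrow> smooth_near \<A> x f \<Longrightarrow> smooth_near \<A> x (\<lambda>y. X y f)"
  by (auto simp: smooth_field_def)

lemma smooth_field_coord:
  assumes X: "smooth_field \<A> W X" and C: "C \<in> max_atlas \<A>"
  shows "smooth_on (snd C ` (W \<inter> fst C)) (\<lambda>u. vec_coord C (X (chart_inv C u)))"
proof (rule smooth_on_componentwise[OF open_image_openin[OF C smooth_field_openin[OF X]]])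
  fix i :: 'e assume "i \<in> Basis"
  have "smooth_on (snd C ` (W \<inter> fst C)) ((\<lambda>x. X x (\<lambda>y. snd C y \<bullet> i)) \<circ> chart_inv C)"
    by (rule smooth_near_imp_smooth_on[OF C smooth_field_openin[OF X]])
      (auto intro: smooth_field_apply[OF X] smooth_near_coord[OF C])
  then show "smooth_on (snd C ` (W \<inter> fst C)) (\<lambda>u. vec_coord C (X (chart_inv C u)) \<bullet> i)"
    using \<open>i \<in> Basis\<close> by (simp add: vec_coord_def inner_sum_left inner_Basis if_distrib sum.delta o_def cong: if_cong)
qed

lemma smooth_fieldI:
  assumes W: "openin (mtop \<A>) W" "W \<subseteq> fst C" and C: "C \<in> max_atlas \<A>"
    and w: "smooth_on (snd C ` W) w" and X: "\<And>x. x \<in> W \<Longrightarrow> X x = chart_vec \<A> C x (w (snd C x))"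
  shows "smooth_field \<A> W X"
  unfolding smooth_field_def
proof (intro conjI ballI allI impI W)
  fix x assume x: "x \<in> W"
  with W(2) have xC: "x \<in> fst C" by blast
  show "X x \<in> tangent \<A> x" unfolding X[OF x] by (rule tangent_chart_vec[OF C xC])
  fix f assume "smooth_near \<A> x f"
  then obtain S where S: "open S" "snd C x \<in> S" "S \<subseteq> snd C ` fst C" "smooth_on S (f \<circ> chart_inv C)"
    using smooth_near_iff[OF C xC] by blast
  let ?T = "S \<inter> snd C ` W"
  have op: "open ?T" using S(1) open_image_openin[OF C W(1)] W(2) by (metis Int_absorb2 open_Int)
  show "smooth_near \<A> x (\<lambda>y. X y f)"
  proof (rule smooth_nearI[OF C xC op])
    show "snd C x \<in> ?T" using S x by blast
    show "smooth_on ?T (\<lambda>u. \<D> (f \<circ> chart_inv C) u (w u))"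
    proof (rule smooth_on_linear_apply[where m = "\<lambda>u. \<D> (f \<circ> chart_inv C) u", OF op])
      show "smooth_on ?T (\<lambda>u. \<D> (f \<circ> chart_inv C) u a)" for a
        by (rule smooth_on_subset[OF smooth_on_frechet[OF S(4)]]) blast
      show "smooth_on ?T w" by (rule smooth_on_subset[OF w]) blast
      show "linear (\<D> (f \<circ> chart_inv C) u)" if "u \<in> ?T" for u
        using smooth_on_has_derivative[OF S(4)] that by (blast intro: has_derivative_linear)
    qed
    fix y assume y: "y \<in> fst C" "snd C y \<in> ?T"
    then have "y \<in> W" using inj_onD[OF max_atlas_inj[OF C]] W(2) by blast
    moreover have "smooth_near \<A> y f" using S y smooth_near_iff[OF C y(1)] by blast
    ultimately show "X y f = \<D> (f \<circ> chart_inv C) (snd C y) (w (snd C y))"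
      by (simp add: X chart_vec_def)
  qed
qed

text \<open>Separates v(Xf) into the term in which the coefficients of \<open>X\<close> are
  differentiated and the term in which they are frozen at \<open>x\<close> while \<open>f\<close> is
  differentiated twice. The latter is the one that cancels in a bracket.\<close>

lemma field_apply_has_derivative:
  assumes X: "smooth_field \<A> W X" and C: "C \<in> max_atlas \<A>" and x: "x \<in> W" "x \<in> fst C"
    and f: "smooth_near \<A> x f" and v: "v = chart_vec \<A> C x \<xi>"
  shows "v (\<lambda>y. X y f) =
    \<D> (f \<circ> chart_inv C) (snd C x)
      (\<D> (\<lambda>u. vec_coord C (X (chart_inv C u))) (snd C x) \<xi>) +
    \<D> (\<lambda>u. \<D> (f \<circ> chart_inv C) u (vec_coord C (X x))) (snd C x) \<xi>"
proof -
  obtain S where S: "open S" "snd C x \<in> S" "S \<subseteq> snd C ` fst C" "smooth_on S (f \<circ> chart_inv C)"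
    using f smooth_near_iff[OF C x(2)] by blast
  define T where "T = S \<inter> snd C ` (W \<inter> fst C)"
  have T: "open T" "snd C x \<in> T"
    using S open_image_openin[OF C smooth_field_openin[OF X]] x by (auto simp: T_def)
  have fT: "smooth_on T (f \<circ> chart_inv C)" by (rule smooth_on_subset[OF S(4)]) (simp add: T_def)
  let ?f = "f \<circ> chart_inv C" and ?X = "\<lambda>u. vec_coord C (X (chart_inv C u))" and ?u = "snd C x"
  let ?D = "\<lambda>u a. \<D> ?f u a"
  have XT: "smooth_on T ?X" by (rule smooth_on_subset[OF smooth_field_coord[OF X C]]) (simp add: T_def)
  have lin: "linear (\<D> ?f u)" if "u \<in> T" for u
    using smooth_on_has_derivative[OF fT that] by (rule has_derivative_linear)
  have dD: "((\<lambda>u. ?D u a) has_derivative \<D> (\<lambda>u. ?D u a) ?u) (at ?u)" for a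
    by (rule smooth_on_has_derivative[OF smooth_on_frechet[OF fT] T(2)])
  have dX: "(?X has_derivative \<D> ?X ?u) (at ?u)"
    by (rule smooth_on_has_derivative[OF XT T(2)])
  have "((\<lambda>u. \<Sum>i\<in>Basis. (?X u \<bullet> i) * ?D u i) has_derivative
      (\<lambda>h. \<Sum>i\<in>Basis. (?X ?u \<bullet> i) * \<D> (\<lambda>u. ?D u i) ?u h + (\<D> ?X ?u h \<bullet> i) * ?D ?u i)) (at ?u)"
    by (intro has_derivative_sum has_derivative_mult dD has_derivative_inner_left dX)
  moreover have "(\<Sum>i\<in>Basis. (?X ?u \<bullet> i) * \<D> (\<lambda>u. ?D u i) ?u h + (\<D> ?X ?u h \<bullet> i) * ?D ?u i)
     = ?D ?u (\<D> ?X ?u h) + \<D> (\<lambda>u. ?D u (vec_coord C (X x))) ?u h" for h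
  proof -
    have dlin: "((\<lambda>u. ?D u a) has_derivative (\<lambda>h. \<Sum>i\<in>Basis. (a \<bullet> i) * \<D> (\<lambda>u. ?D u i) ?u h)) (at ?u)" for a
    proof (rule has_derivative_transform_within_open[OF _ T])
      show "((\<lambda>u. \<Sum>i\<in>Basis. (a \<bullet> i) * ?D u i) has_derivative (\<lambda>h. \<Sum>i\<in>Basis. (a \<bullet> i) * \<D> (\<lambda>u. ?D u i) ?u h)) (at ?u)"
        by (intro has_derivative_sum has_derivative_mult_right dD)
    qed (use linear_Basis_sum[OF lin] in simp)
    have eq: "\<D> (\<lambda>u. ?D u a) ?u h = (\<Sum>i\<in>Basis. (a \<bullet> i) * \<D> (\<lambda>u. ?D u i) ?u h)" for a
      by (rule fun_cong[OF frechet_derivative_eqI[OF dlin]])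
    show ?thesis
      by (subst eq[of "vec_coord C (X x)"], subst linear_Basis_sum[OF lin[OF T(2)], of "\<D> ?X ?u h"])
        (simp add: sum.distrib inv_left[OF C x(2)])
  qed
  ultimately have "((\<lambda>u. \<Sum>i\<in>Basis. (?X u \<bullet> i) * ?D u i) has_derivative
      (\<lambda>h. ?D ?u (\<D> ?X ?u h) + \<D> (\<lambda>u. ?D u (vec_coord C (X x))) ?u h)) (at ?u)"
    by simp
  then have "((\<lambda>y. X y f) \<circ> chart_inv C has_derivative
      (\<lambda>h. ?D ?u (\<D> ?X ?u h) + \<D> (\<lambda>u. ?D u (vec_coord C (X x))) ?u h)) (at ?u)"
  proof (rule has_derivative_transform_within_open[OF _ T])
    fix u assume u: "u \<in> T"
    then obtain y where y: "y \<in> W" "y \<in> fst C" "u = snd C y" by (auto simp: T_def)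
    then have "smooth_near \<A> y f" using S u smooth_near_iff[OF C y(2)] by (auto simp: T_def)
    then have "X y f = ?D u (vec_coord C (X y))"
      using chart_vec_vec_coord[OF C y(2) smooth_field_tangent[OF X y(1)]] y(3)
      by (metis chart_vec_def)
    then show "(\<Sum>i\<in>Basis. (?X u \<bullet> i) * ?D u i) = ((\<lambda>y. X y f) \<circ> chart_inv C) u"
      using linear_Basis_sum[OF lin[OF u], of "vec_coord C (X y)"] y by (simp add: inv_left[OF C])
  qed
  from chart_vec_apply[OF C x(2) smooth_field_apply[OF X x(1) f] this] show ?thesis by (simp add: v)
qed

text \<open>The second-derivative terms of X(Yf) and Y(Xf) coincide by symmetry, and what remains is
  of first order in \<open>f\<close>. In particular the bracket is a tangent vector.\<close>

lemma lie_bracket_coord: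
  assumes X: "smooth_field \<A> W X" and Y: "smooth_field \<A> W Y" and C: "C \<in> max_atlas \<A>" and x: "x \<in> W" "x \<in> fst C"
  shows "lie_bracket \<A> X Y x = chart_vec \<A> C x
    (\<D> (\<lambda>u. vec_coord C (Y (chart_inv C u))) (snd C x) (vec_coord C (X x)) -
     \<D> (\<lambda>u. vec_coord C (X (chart_inv C u))) (snd C x) (vec_coord C (Y x)))"
proof
  fix f
  show "lie_bracket \<A> X Y x f = chart_vec \<A> C x
    (\<D> (\<lambda>u. vec_coord C (Y (chart_inv C u))) (snd C x) (vec_coord C (X x)) -
     \<D> (\<lambda>u. vec_coord C (X (chart_inv C u))) (snd C x) (vec_coord C (Y x))) f"
  proof (cases "smooth_near \<A> x f")
    case True
    then obtain S where S: "open S" "snd C x \<in> S" "smooth_on S (f \<circ> chart_inv C)"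
      using smooth_near_iff[OF C x(2)] by blast
    note eq = chart_vec_vec_coord[OF C x(2) smooth_field_tangent[OF _ x(1)], symmetric]
    show ?thesis
      using linear_diff[OF has_derivative_linear[OF smooth_near_has_derivative[OF C x(2) True]]]
        frechet_derivative_symmetric[OF S]
        field_apply_has_derivative[OF Y C x True eq[OF X]] field_apply_has_derivative[OF X C x True eq[OF Y]]
      by (simp add: lie_bracket_def True chart_vec_def)
  qed (simp add: lie_bracket_def chart_vec_def)
qed

lemma smooth_field_lie_bracket:
  assumes X: "smooth_field \<A> W X" and Y: "smooth_field \<A> W Y"
  shows "smooth_field \<A> W (lie_bracket \<A> X Y)"
  unfolding smooth_field_def
proof (intro conjI ballI allI impI smooth_field_openin[OF X])
  fix x assume x: "x \<in> W"
  then obtain C where C: "C \<in> \<A>" "x \<in> fst C"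
    using smooth_field_openin[OF X] points_chart by (metis openin_mtop subsetD)
  show "lie_bracket \<A> X Y x \<in> tangent \<A> x"
    unfolding lie_bracket_coord[OF X Y chart_max_atlas[OF C(1)] x C(2)]
    by (rule tangent_chart_vec[OF chart_max_atlas[OF C(1)] C(2)])
  fix f assume f: "smooth_near \<A> x f"
  \<comment> \<open>The bracket at \<open>y\<close> takes its default value unless \<open>f\<close>
    is smooth near \<open>y\<close>; a neighbourhood on which this holds allows the definition to be
    unfolded.\<close>
  then obtain V where V: "openin (mtop \<A>) V" "x \<in> V" "\<And>y. y \<in> V \<Longrightarrow> smooth_near \<A> y f"
    using smooth_near_neighbourhood[OF f] by blast
  have "smooth_near \<A> x (\<lambda>y. X y (\<lambda>y. Y y f) - Y y (\<lambda>y. X y f))"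
    by (intro smooth_near_diff smooth_field_apply[OF X x] smooth_field_apply[OF Y x] f)
  then show "smooth_near \<A> x (\<lambda>y. lie_bracket \<A> X Y y f)"
    by (subst smooth_near_cong[OF V(1,2)]) (auto simp: lie_bracket_def V(3))
qed

end

section \<open>Submanifolds and bundle charts\<close>

definition slice_restrict :: "'m set \<Rightarrow> ('m, 'e::euclidean_space \<times> 'f::euclidean_space) chart \<Rightarrow> ('m, 'e) chart" where
  "slice_restrict L C = (fst C \<inter> L, fst \<circ> snd C)"

lemma fst_slice_restrict [simp]: "fst (slice_restrict L C) = fst C \<inter> L"
  and snd_slice_restrict [simp]: "snd (slice_restrict L C) y = fst (snd C y)"
  by (simp_all add: slice_restrict_def)

lemma sub_atlas_eq: "sub_atlas \<A> L = slice_restrict L ` slice_charts \<A> L"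
  by (simp add: sub_atlas_def slice_restrict_def)

lemma bounded_linear_pair_zero: "bounded_linear (\<lambda>a. (a, 0))"
  by (rule bounded_linear_Pair[OF bounded_linear_ident bounded_linear_zero])

locale submanifold_atlas = atlas \<A> for \<A> :: "('m, 'e::euclidean_space \<times> 'f::euclidean_space) atlas" +
  fixes L :: "'m set"
  assumes submanifold: "submanifold \<A> L"
begin

lemma slice_max_atlas: "C \<in> slice_charts \<A> L \<Longrightarrow> C \<in> max_atlas \<A>"
  by (simp add: slice_charts_def)

lemma slice_coord:
  assumes "C \<in> slice_charts \<A> L" "y \<in> fst C" "y \<in> L"
  shows "snd C y = (fst (snd C y), 0)"
proof -
  have "snd C y \<in> snd C ` fst C \<inter> (UNIV \<times> {0})"
    using assms unfolding slice_charts_def by blast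
  then show ?thesis by (metis Int_iff mem_Sigma_iff prod.collapse singletonD)
qed

text \<open>The slice condition equates images, so a point (a, 0) of the chart image comes from some
  point of \<open>L\<close>; injectivity of the chart identifies that point with the given one in
  \<open>S\<close>.\<close>

lemma slice_coord_mem:
  assumes "C \<in> slice_charts \<A> L" "(a, 0) \<in> snd C ` S" "S \<subseteq> fst C"
  shows "chart_inv C (a, 0) \<in> S \<inter> L" "snd C (chart_inv C (a, 0)) = (a, 0)"
proof -
  have "(a, 0) \<in> snd C ` (fst C \<inter> L)"
    using assms unfolding slice_charts_def by blast
  then obtain y where y: "y \<in> fst C" "y \<in> L" "snd C y = (a, 0)" by force
  then have inv: "chart_inv C (a, 0) = y" using inv_left[OF slice_max_atlas[OF assms(1)] y(1)] by simp
  obtain y' where "y' \<in> S" "snd C y' = (a, 0)" using assms(2) by force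
  then have "y = y'"
    using inj_onD[OF max_atlas_inj[OF slice_max_atlas[OF assms(1)]], of y y'] y assms(3) by auto
  then show "chart_inv C (a, 0) \<in> S \<inter> L" using inv y \<open>y' \<in> S\<close> by simp
  show "snd C (chart_inv C (a, 0)) = (a, 0)" using inv y by simp
qed

lemma slice_image_mem:
  assumes "C \<in> slice_charts \<A> L" "y \<in> S" "y \<in> L" "S \<subseteq> fst C"
  shows "(fst (snd C y), 0) \<in> snd C ` S"
  using slice_coord[OF assms(1) _ assms(3)] assms(2,4) by (metis imageI subsetD)

lemma slice_chart_inv:
  assumes "C \<in> slice_charts \<A> L" "y \<in> fst C" "y \<in> L"
  shows "chart_inv C (fst (snd C y), 0) = y"
  using inv_left[OF slice_max_atlas[OF assms(1)] assms(2)] slice_coord[OF assms] by simp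

lemma slice_restrict_inj: "C \<in> slice_charts \<A> L \<Longrightarrow> inj_on (snd (slice_restrict L C)) (fst (slice_restrict L C))"
  by (rule inj_on_inverseI[where g = "\<lambda>a. chart_inv C (a, 0)"]) (simp add: slice_chart_inv)

text \<open>Written as a preimage under a \<mapsto> (a, 0), the coordinate image in \<open>L\<close>
  inherits openness from the ambient one.\<close>

lemma slice_restrict_image:
  assumes "C \<in> slice_charts \<A> L" "S \<subseteq> fst C"
  shows "snd (slice_restrict L C) ` (S \<inter> L) = (\<lambda>a. (a, 0)) -` (snd C ` S)"
proof
  show "snd (slice_restrict L C) ` (S \<inter> L) \<subseteq> (\<lambda>a. (a, 0)) -` (snd C ` S)"
    using slice_image_mem[OF assms(1) _ _ assms(2)] by auto
  show "(\<lambda>a. (a, 0)) -` (snd C ` S) \<subseteq> snd (slice_restrict L C) ` (S \<inter> L)"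
  proof
    fix a assume "a \<in> (\<lambda>a. (a, 0)) -` (snd C ` S)"
    then have "(a, 0) \<in> snd C ` S" by simp
    note slice_coord_mem[OF assms(1) this assms(2)]
    then show "a \<in> snd (slice_restrict L C) ` (S \<inter> L)"
      by (metis fst_conv imageI snd_slice_restrict)
  qed
qed

lemma open_slice_image:
  assumes "C \<in> slice_charts \<A> L" "S \<subseteq> fst C" "open (snd C ` S)"
  shows "open (snd (slice_restrict L C) ` (S \<inter> L))"
  unfolding slice_restrict_image[OF assms(1,2)]
  by (rule open_vimage[OF assms(3)]) (intro linear_continuous_on bounded_linear_pair_zero)

lemma slice_restrict_chart_inv:
  assumes "C \<in> slice_charts \<A> L" "a \<in> snd (slice_restrict L C) ` (fst C \<inter> L)"
  shows "chart_inv (slice_restrict L C) a = chart_inv C (a, 0)"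
proof -
  obtain y where y: "y \<in> fst C" "y \<in> L" "a = fst (snd C y)" using assms(2) by auto
  have "chart_inv (slice_restrict L C) (snd (slice_restrict L C) y) = y"
    by (rule chart_inv_left[OF slice_restrict_inj[OF assms(1)]]) (use y in simp)
  then show ?thesis using slice_chart_inv[OF assms(1) y(1,2)] y(3) by simp
qed

lemma slice_transition_smooth:
  assumes C: "C \<in> slice_charts \<A> L" and D: "D \<in> slice_charts \<A> L"
  shows "smooth_on (snd (slice_restrict L C) ` ((fst C \<inter> fst D) \<inter> L)) (\<lambda>a. fst (snd D (chart_inv C (a, 0))))"
proof -
  note CD = slice_max_atlas[OF C] slice_max_atlas[OF D]
  let ?S = "snd C ` (fst C \<inter> fst D)"
  let ?T = "snd (slice_restrict L C) ` ((fst C \<inter> fst D) \<inter> L)"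
  have op: "open ?T" by (rule open_slice_image[OF C _ open_image_inter[OF CD]]) blast
  have "smooth_on ?T (\<lambda>a. (snd D \<circ> chart_inv C) (a, 0))"
  proof (rule smooth_on_compose[OF op open_image_inter[OF CD] _ transition_smooth[OF CD]])
    show "(\<lambda>a. (a, 0)) ` ?T \<subseteq> ?S" using slice_restrict_image[OF C, of "fst C \<inter> fst D"] by blast
  qed (rule smooth_on_bounded_linear[OF op bounded_linear_pair_zero])
  then show ?thesis
    using smooth_on_bounded_linear_comp[OF op bounded_linear_fst] by (simp add: o_def)
qed

lemma smooth_atlas_sub_atlas: "smooth_atlas (sub_atlas \<A> L)"
  unfolding smooth_atlas_def sub_atlas_eq
proof (intro conjI ballI; (elim imageE)?; simp only:)
  fix C assume "C \<in> slice_charts \<A> L"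
  then show "inj_on (snd (slice_restrict L C)) (fst (slice_restrict L C))" by (rule slice_restrict_inj)
next
  fix C D assume C: "C \<in> slice_charts \<A> L" and D: "D \<in> slice_charts \<A> L"
  let ?T = "snd (slice_restrict L C) ` ((fst C \<inter> fst D) \<inter> L)"
  have eq: "fst (slice_restrict L C) \<inter> fst (slice_restrict L D) = (fst C \<inter> fst D) \<inter> L" by auto
  have op: "open ?T"
    by (rule open_slice_image[OF C _ open_image_inter[OF slice_max_atlas[OF C] slice_max_atlas[OF D]]]) blast
  have "smooth_on ?T (snd (slice_restrict L D) \<circ> chart_inv (slice_restrict L C))"
  proof (rule smooth_on_transform[OF op slice_transition_smooth[OF C D]])
    fix a assume "a \<in> ?T"
    then have "a \<in> snd (slice_restrict L C) ` (fst C \<inter> L)" by blast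
    from slice_restrict_chart_inv[OF C this]
    show "fst (snd D (chart_inv C (a, 0))) = (snd (slice_restrict L D) \<circ> chart_inv (slice_restrict L C)) a" by simp
  qed
  with op show "compatible (slice_restrict L C) (slice_restrict L D)"
    unfolding compatible_def eq by blast
qed

sublocale sub: atlas "sub_atlas \<A> L"
  by unfold_locales (rule smooth_atlas_sub_atlas)

lemma slice_restrict_sub_atlas: "C \<in> slice_charts \<A> L \<Longrightarrow> slice_restrict L C \<in> sub_atlas \<A> L"
  by (simp add: sub_atlas_eq)

lemma slice_chart_exists: "x \<in> L \<Longrightarrow> \<exists>C\<in>slice_charts \<A> L. x \<in> fst C"
  using submanifold by (simp add: submanifold_def)

lemma smooth_near_sub:
  assumes f: "smooth_near \<A> x f" and x: "x \<in> L"
  shows "smooth_near (sub_atlas \<A> L) x f"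
proof -
  obtain C where C: "C \<in> slice_charts \<A> L" "x \<in> fst C" using slice_chart_exists[OF x] by blast
  obtain S where S: "open S" "snd C x \<in> S" "S \<subseteq> snd C ` fst C" "smooth_on S (f \<circ> chart_inv C)"
    using f smooth_near_iff[OF slice_max_atlas[OF C(1)] C(2)] by blast
  have op: "open ((\<lambda>a. (a, 0)) -` S)"
    by (rule open_vimage[OF S(1)]) (intro linear_continuous_on bounded_linear_pair_zero)
  show ?thesis
  proof (rule sub.smooth_nearI[OF sub.chart_max_atlas[OF slice_restrict_sub_atlas[OF C(1)]] _ op])
    show "x \<in> fst (slice_restrict L C)" using C x by simp
    show "snd (slice_restrict L C) x \<in> (\<lambda>a. (a, 0)) -` S"
      using slice_coord[OF C x] S(2) by simp
    show "smooth_on ((\<lambda>a. (a, 0)) -` S) (\<lambda>a. (f \<circ> chart_inv C) (a, 0))"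
      by (rule smooth_on_compose[OF op S(1) _ S(4)]) (auto intro: smooth_on_bounded_linear[OF op bounded_linear_pair_zero])
    fix y assume "y \<in> fst (slice_restrict L C)"
    then show "f y = (f \<circ> chart_inv C) (snd (slice_restrict L C) y, 0)"
      using slice_chart_inv[OF C(1), of y] by simp
  qed
qed

text \<open>In slice coordinates the inclusion is the linear map a \<mapsto> (a, 0), which is its
  own derivative.\<close>

lemma push_inclusion:
  assumes C: "C \<in> slice_charts \<A> L" and x: "x \<in> fst C" "x \<in> L"
  shows "push \<A> (\<lambda>y. y) x (chart_vec (sub_atlas \<A> L) (slice_restrict L C) x a) = chart_vec \<A> C x (a, 0)"
proof
  fix f
  show "push \<A> (\<lambda>y. y) x (chart_vec (sub_atlas \<A> L) (slice_restrict L C) x a) f = chart_vec \<A> C x (a, 0) f"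
  proof (cases "smooth_near \<A> x f")
    case True
    note C' = slice_max_atlas[OF C]
    have xs: "x \<in> fst (slice_restrict L C)" using x by simp
    note df = smooth_near_has_derivative[OF C' x(1) True]
    have "((f \<circ> chart_inv C) has_derivative \<D> (f \<circ> chart_inv C) (snd C x))
        (at (snd (slice_restrict L C) x, 0))"
      using df slice_coord[OF C x] by (metis snd_slice_restrict)
    from has_derivative_compose[OF bounded_linear_imp_has_derivative[OF bounded_linear_pair_zero] this]
    have "((f \<circ> chart_inv (slice_restrict L C)) has_derivative
        (\<lambda>a. \<D> (f \<circ> chart_inv C) (snd C x) (a, 0))) (at (snd (slice_restrict L C) x))"
    proof (rule has_derivative_transform_within_open)
      show "open (snd (slice_restrict L C) ` (fst C \<inter> L))"
        by (rule open_slice_image[OF C _ open_chart_image[OF C']]) simp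
      show "snd (slice_restrict L C) x \<in> snd (slice_restrict L C) ` (fst C \<inter> L)" using x by blast
    qed (simp add: slice_restrict_chart_inv[OF C])
    from sub.chart_vec_apply[OF sub.chart_max_atlas[OF slice_restrict_sub_atlas[OF C]] xs smooth_near_sub[OF True x(2)] this]
    show ?thesis
      by (simp add: push_def True o_def chart_vec_apply[OF C' x(1) True df])
  qed (simp add: push_def chart_vec_def)
qed

lemma tangent_sub_eq:
  assumes C: "C \<in> slice_charts \<A> L" and x: "x \<in> fst C" "x \<in> L"
  shows "tangent_sub \<A> L x = range (\<lambda>a. chart_vec \<A> C x (a, 0))"
proof -
  have "tangent (sub_atlas \<A> L) x = range (chart_vec (sub_atlas \<A> L) (slice_restrict L C) x)"
    by (rule sub.tangent_eq[OF sub.chart_max_atlas[OF slice_restrict_sub_atlas[OF C]]]) (use x in simp)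
  then show ?thesis by (simp add: tangent_sub_def image_image push_inclusion[OF C x])
qed

end

section \<open>Bundle charts of the normal bundle\<close>

lemma vec_coord_linear: "vec_coord C (a \<bullet>\<^sub>t u \<boxplus> b \<bullet>\<^sub>t v) = a *\<^sub>R vec_coord C u + b *\<^sub>R vec_coord C v"
  by (simp add: vec_coord_def vadd_def vscale_def scaleR_add_left sum.distrib scaleR_sum_right)

definition bundle_chart :: "('m, 'e::euclidean_space \<times> 'f::euclidean_space) atlas \<Rightarrow>
    ('m \<Rightarrow> 'm tvec \<Rightarrow> 'm tvec \<Rightarrow> real) \<Rightarrow> 'm set \<Rightarrow> ('m, 'e) chart \<Rightarrow> ('f \<Rightarrow> 'm \<Rightarrow> 'm tvec) \<Rightarrow>
    ('m \<times> 'm tvec, 'e \<times> 'f) chart" where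
  "bundle_chart \<A> g L C F = ({(x, \<theta>). x \<in> fst C \<and> \<theta> \<in> normal_sub \<A> g L x},
     \<lambda>(x, \<theta>). (snd C x, inv_into UNIV (\<lambda>a. F a x) \<theta>))"

locale normal_bundle_atlas = submanifold_atlas \<A> L
  for \<A> :: "('m, 'e::euclidean_space \<times> 'f::euclidean_space) atlas" and L :: "'m set" +
  fixes g :: "'m \<Rightarrow> 'm tvec \<Rightarrow> 'm tvec \<Rightarrow> real"
begin

abbreviation "\<N> \<equiv> normal_bundle \<A> g L"
abbreviation "nsub \<equiv> normal_sub \<A> g L"
abbreviation "bchart C F \<equiv> bundle_chart \<A> g L (slice_restrict L C) F"

lemma normal_bundle_eq:
  "\<N> = {bchart C F | C F W.
     C \<in> slice_charts \<A> L \<and> fst C \<inter> L \<subseteq> W \<and> normal_frame \<A> g L W F}"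
proof (intro set_eqI iffI)
  fix N assume "N \<in> \<N>"
  then obtain C F W where N: "N = bundle_chart \<A> g L C F" "C \<in> sub_atlas \<A> L" "fst C \<subseteq> W" "normal_frame \<A> g L W F"
    unfolding normal_bundle_def bundle_chart_def by blast
  obtain C' where "C' \<in> slice_charts \<A> L" "C = slice_restrict L C'"
    using N(2) unfolding sub_atlas_eq by blast
  with N fst_slice_restrict[of L C'] show "N \<in> {bchart C F | C F W.
     C \<in> slice_charts \<A> L \<and> fst C \<inter> L \<subseteq> W \<and> normal_frame \<A> g L W F}" by blast
next
  fix N assume "N \<in> {bchart C F | C F W.
     C \<in> slice_charts \<A> L \<and> fst C \<inter> L \<subseteq> W \<and> normal_frame \<A> g L W F}"
  then obtain C F W where N: "N = bchart C F" "C \<in> slice_charts \<A> L" "fst C \<inter> L \<subseteq> W" "normal_frame \<A> g L W F"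
    by blast
  then have "slice_restrict L C \<in> sub_atlas \<A> L" "fst (slice_restrict L C) \<subseteq> W"
    by (simp_all add: sub_atlas_eq)
  with N show "N \<in> \<N>"
    unfolding normal_bundle_def bundle_chart_def by blast
qed

lemma fst_bchart: "fst (bchart C F) = {(x, \<theta>). x \<in> fst C \<inter> L \<and> \<theta> \<in> nsub x}"
  by (simp add: bundle_chart_def)

lemma snd_bchart: "snd (bchart C F) (x, \<theta>) = (fst (snd C x), inv_into UNIV (\<lambda>a. F a x) \<theta>)"
  by (simp add: bundle_chart_def)

context
  fixes F W assumes F: "normal_frame \<A> g L W F"
begin

lemma frame_bij: "y \<in> W \<Longrightarrow> y \<in> L \<Longrightarrow> bij_betw (\<lambda>a. F a y) UNIV (nsub y)"
  using F by (simp add: normal_frame_def)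

lemma frame_normal: "y \<in> W \<Longrightarrow> y \<in> L \<Longrightarrow> F a y \<in> nsub y"
  using frame_bij bij_betwE by blast

lemma frame_inv: "y \<in> W \<Longrightarrow> y \<in> L \<Longrightarrow> inv_into UNIV (\<lambda>a. F a y) (F a y) = a"
  using frame_bij bij_betw_inv_into_left by fastforce

lemma frame_inv_right: "y \<in> W \<Longrightarrow> y \<in> L \<Longrightarrow> \<theta> \<in> nsub y \<Longrightarrow> F (inv_into UNIV (\<lambda>a. F a y) \<theta>) y = \<theta>"
  using frame_bij[of y] bij_betw_inv_into_right[of "\<lambda>a. F a y" UNIV "nsub y" \<theta>] by simp

lemma frame_linear: "y \<in> W \<Longrightarrow> y \<in> L \<Longrightarrow> F (r *\<^sub>R a + s *\<^sub>R b) y = r \<bullet>\<^sub>t F a y \<boxplus> s \<bullet>\<^sub>t F b y"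
  using F by (simp add: normal_frame_def)

lemma frame_field: "smooth_field \<A> W (F a)"
  using F by (simp add: normal_frame_def normal_section_def)

lemma frame_coord_linear: "y \<in> W \<Longrightarrow> y \<in> L \<Longrightarrow> linear (\<lambda>a. vec_coord C (F a y))"
proof (rule linearI)
  assume y: "y \<in> W" "y \<in> L"
  show "vec_coord C (F (a + b) y) = vec_coord C (F a y) + vec_coord C (F b y)" for a b
    using frame_linear[OF y, of 1 a 1 b] by (simp add: vec_coord_linear)
  show "vec_coord C (F (r *\<^sub>R a) y) = r *\<^sub>R vec_coord C (F a y)" for r a
    using frame_linear[OF y, of r a 0 0] by (simp add: vec_coord_linear)
qed

lemma frame_coord_inj:
  assumes C: "C \<in> max_atlas \<A>" "y \<in> fst C" and y: "y \<in> W" "y \<in> L" and eq: "vec_coord C (F a y) = vec_coord C (F b y)"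
  shows "a = b"
proof -
  have "F a y = F b y"
    using chart_vec_vec_coord[OF C smooth_field_tangent[OF frame_field y(1)]] eq by metis
  then show ?thesis using frame_inv[OF y] by metis
qed

lemma frame_coord_smooth:
  assumes C: "C \<in> slice_charts \<A> L" and S: "S \<subseteq> fst C" "S \<inter> L \<subseteq> W" "open (snd C ` S)"
  shows "smooth_on ((snd (slice_restrict L C) ` (S \<inter> L)) \<times> UNIV)
    (\<lambda>z. vec_coord C (F a (chart_inv C (fst z, 0))))"
proof -
  let ?T = "(snd (slice_restrict L C) ` (S \<inter> L)) \<times> UNIV"
  have op: "open ?T" using open_slice_image[OF C S(1,3)] by (simp add: open_Times)
  show ?thesis
  proof (rule smooth_on_compose[OF op _ _ smooth_field_coord[OF frame_field slice_max_atlas[OF C]]])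
    show "open (snd C ` (W \<inter> fst C))"
      by (rule open_image_openin[OF slice_max_atlas[OF C] smooth_field_openin[OF frame_field]])
    show "(\<lambda>z. (fst z, 0)) ` ?T \<subseteq> snd C ` (W \<inter> fst C)"
    proof safe
      fix y assume y: "y \<in> S" "y \<in> L"
      with S have "y \<in> W \<inter> fst C" by blast
      moreover have "snd C y = (snd (slice_restrict L C) y, 0)" using slice_coord[OF C _ y(2)] y(1) S(1) by auto
      ultimately show "(fst (snd (slice_restrict L C) y, b), 0) \<in> snd C ` (W \<inter> fst C)" for b
        by (metis fst_conv imageI)
    qed
    show "smooth_on ?T (\<lambda>z. (fst z, 0))"
      by (rule smooth_on_bounded_linear[OF op bounded_linear_Pair[OF bounded_linear_fst bounded_linear_zero]])
  qed
qed

end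

lemma bchart_inj:
  assumes F: "normal_frame \<A> g L W F" and C: "C \<in> slice_charts \<A> L" "fst C \<inter> L \<subseteq> W"
  shows "inj_on (snd (bchart C F)) (fst (bchart C F))"
proof (rule inj_on_inverseI)
  fix z assume "z \<in> fst (bchart C F)"
  then obtain x \<theta> where z: "z = (x, \<theta>)" "x \<in> fst C" "x \<in> L" "\<theta> \<in> nsub x" by (auto simp: fst_bchart)
  with C(2) have "F (inv_into UNIV (\<lambda>a. F a x) \<theta>) x = \<theta>" by (intro frame_inv_right[OF F]) auto
  then show "(\<lambda>w. (chart_inv C (fst w, 0), F (snd w) (chart_inv C (fst w, 0)))) (snd (bchart C F) z) = z"
    using slice_chart_inv[OF C(1) z(2,3)] z by (simp add: snd_bchart)
qed

lemma bchart_chart_inv: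
  assumes F: "normal_frame \<A> g L W F" and C: "C \<in> slice_charts \<A> L" "fst C \<inter> L \<subseteq> W"
    and y: "y \<in> fst C" "y \<in> L"
  shows "chart_inv (bchart C F) (fst (snd C y), u) = (y, F u y)"
    and "(y, F u y) \<in> fst (bchart C F)" "snd (bchart C F) (y, F u y) = (fst (snd C y), u)"
proof -
  have yW: "y \<in> W" using C y by blast
  show mem: "(y, F u y) \<in> fst (bchart C F)" using frame_normal[OF F yW y(2)] y by (simp add: fst_bchart)
  show eq: "snd (bchart C F) (y, F u y) = (fst (snd C y), u)" by (simp add: snd_bchart frame_inv[OF F yW y(2)])
  from chart_inv_left[OF bchart_inj[OF F C] mem] eq show "chart_inv (bchart C F) (fst (snd C y), u) = (y, F u y)" by simp
qed

text \<open>The fibre coordinates of \<open>F u\<close> in the frame \<open>G\<close> solve a linear system with the Gram matrix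
  of \<open>G\<close> (in an ambient chart), so that they depend smoothly on the base point.\<close>
lemma frame_transition_smooth:
  assumes F: "normal_frame \<A> g L W F" and G: "normal_frame \<A> g L V G"
    and C: "C \<in> slice_charts \<A> L" and S: "S \<subseteq> fst C" "S \<inter> L \<subseteq> W" "S \<inter> L \<subseteq> V" "open (snd C ` S)"
  shows "smooth_on ((snd (slice_restrict L C) ` (S \<inter> L)) \<times> UNIV)
    (\<lambda>z. inv_into UNIV (\<lambda>a. G a (chart_inv C (fst z, 0))) (F (snd z) (chart_inv C (fst z, 0))))"
proof -
  let ?T = "(snd (slice_restrict L C) ` (S \<inter> L)) \<times> (UNIV :: 'f set)"
  define pt where "pt z = chart_inv C (fst z, 0 :: 'f)" for z :: "'e \<times> 'f"
  define f where "f z u = vec_coord C (F u (pt z))" for z u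
  define h where "h z u = vec_coord C (G u (pt z))" for z u
  define m where "m z a = (\<Sum>j\<in>Basis. (h z a \<bullet> h z j) *\<^sub>R j)" for z a
  define r where "r z u = (\<Sum>j\<in>Basis. (f z u \<bullet> h z j) *\<^sub>R j)" for z u
  have op: "open ?T" using open_slice_image[OF C S(1,4)] by (simp add: open_Times)
  have pt: "pt z \<in> fst C" "pt z \<in> L" "pt z \<in> W" "pt z \<in> V" if z: "z \<in> ?T" for z
  proof -
    obtain y where y: "y \<in> S" "y \<in> L" "fst z = fst (snd C y)" using z by (auto simp: mem_Times_iff)
    then have "pt z = y" using slice_chart_inv[OF C, of y] S(1) by (auto simp: pt_def)
    then show "pt z \<in> fst C" "pt z \<in> L" "pt z \<in> W" "pt z \<in> V" using y S by auto
  qed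
  have linf: "linear (f z)" if "z \<in> ?T" for z
    unfolding f_def using pt[OF that] by (intro frame_coord_linear[OF F])
  have linh: "linear (h z)" if "z \<in> ?T" for z
    unfolding h_def using pt[OF that] by (intro frame_coord_linear[OF G])
  have linm: "linear (m z)" if "z \<in> ?T" for z
    by (rule linearI) (simp_all add: m_def linear_add[OF linh[OF that]] linear_cmul[OF linh[OF that]]
        inner_add_left scaleR_add_left sum.distrib scaleR_sum_right)
  have linr: "linear (r z)" if "z \<in> ?T" for z
    by (rule linearI) (simp_all add: r_def linear_add[OF linf[OF that]] linear_cmul[OF linf[OF that]]
        inner_add_left scaleR_add_left sum.distrib scaleR_sum_right)
  have injm: "inj (m z)" if z: "z \<in> ?T" for z
  proof (rule linear_injective_0[THEN iffD2, OF linm[OF z], rule_format])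
    fix a assume "m z a = 0"
    \<comment> \<open>The quadratic form of the Gram matrix at \<open>a\<close> is the squared
      length of \<open>h z a\<close>; this gives injectivity, and bijectivity as the dimensions
      agree.\<close>
    then have "0 = m z a \<bullet> a" by simp
    also have "\<dots> = (\<Sum>j\<in>Basis. (h z a \<bullet> h z j) * (a \<bullet> j))"
      unfolding m_def inner_sum_left by (simp add: inner_commute)
    also have "\<dots> = h z a \<bullet> (\<Sum>j\<in>Basis. (a \<bullet> j) *\<^sub>R h z j)" by (simp add: inner_sum_right mult.commute)
    also have "\<dots> = h z a \<bullet> h z a" using linear_Basis_sum[OF linh[OF z], of a] by simp
    finally have "h z a = h z 0" using linear_0[OF linh[OF z]] by simp
    then show "a = 0"
      unfolding h_def using pt[OF z] frame_coord_inj[OF G slice_max_atlas[OF C]] by blast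
  qed
  have surjm: "surj (m z)" if "z \<in> ?T" for z
    using linear_injective_imp_surjective[OF linm[OF that] injm[OF that]] by simp
  have mn: "m z (inv (m z) b) = b" "inv (m z) (m z b) = b" if "z \<in> ?T" for z b
    using injm[OF that] surjm[OF that] by (simp_all add: surj_f_inv_f)
  have linn: "linear (inv (m z))" if "z \<in> ?T" for z
  proof (rule linearI)
    show "inv (m z) (x + y) = inv (m z) x + inv (m z) y" for x y
      using mn(2)[OF that, of "inv (m z) x + inv (m z) y"] by (simp add: linear_add[OF linm[OF that]] mn(1)[OF that])
    show "inv (m z) (c *\<^sub>R x) = c *\<^sub>R inv (m z) x" for c x
      using mn(2)[OF that, of "c *\<^sub>R inv (m z) x"] by (simp add: linear_cmul[OF linm[OF that]] mn(1)[OF that])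
  qed
  have smf: "smooth_on ?T (\<lambda>z. f z a)" for a
    unfolding f_def pt_def by (rule frame_coord_smooth[OF F C S(1,2,4)])
  have smh: "smooth_on ?T (\<lambda>z. h z a)" for a
    unfolding h_def pt_def by (rule frame_coord_smooth[OF G C S(1,3,4)])
  have smm: "smooth_on ?T (\<lambda>z. m z a)" for a
    unfolding m_def by (intro smooth_on_sum smooth_on_scaleR smooth_on_inner smh smooth_on_const op)
  have smn: "smooth_on ?T (\<lambda>z. inv (m z) b)" for b
    by (rule smooth_on_linear_inverse[OF op linm linn mn smm])
  have smr: "smooth_on ?T (\<lambda>z. r z a)" for a
    unfolding r_def by (intro smooth_on_sum smooth_on_scaleR smooth_on_inner smh smf smooth_on_const op)
  have rs: "smooth_on ?T (\<lambda>z. r z (snd z))"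
    by (rule smooth_on_linear_apply[where m = r, OF op linr smr smooth_on_bounded_linear[OF op bounded_linear_snd]])
  have "smooth_on ?T (\<lambda>z. inv (m z) (r z (snd z)))"
    by (rule smooth_on_linear_apply[where m = "\<lambda>z. inv (m z)", OF op linn smn rs])
  then show ?thesis
  proof (rule smooth_on_transform[OF op])
    fix z assume z: "z \<in> ?T"
    define c where "c = inv_into UNIV (\<lambda>a. G a (pt z)) (F (snd z) (pt z))"
    have "G c (pt z) = F (snd z) (pt z)"
      unfolding c_def using pt[OF z] by (intro frame_inv_right[OF G] frame_normal[OF F])
    then have "m z c = r z (snd z)" by (simp add: m_def r_def f_def h_def)
    then show "inv (m z) (r z (snd z)) = inv_into UNIV (\<lambda>a. G a (chart_inv C (fst z, 0))) (F (snd z) (chart_inv C (fst z, 0)))"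
      using mn(2)[OF z, of c] by (simp add: c_def pt_def)
  qed
qed

text \<open>A transition of bundle charts splits into the transition of the slice charts on the base
  and a change of frame in the fibres; the latter is the difficult half and is settled by
  \<open>frame_transition_smooth\<close>.\<close>

lemma smooth_atlas_normal_bundle: "smooth_atlas \<N>"
  unfolding smooth_atlas_def normal_bundle_eq
proof (intro conjI ballI; (elim CollectE exE conjE)?; simp only:)
  fix C F W assume "C \<in> slice_charts \<A> L" "fst C \<inter> L \<subseteq> W" "normal_frame \<A> g L W F"
  then show "inj_on (snd (bchart C F)) (fst (bchart C F))" using bchart_inj by blast
next
  fix C F W D G V
  assume C: "C \<in> slice_charts \<A> L" "fst C \<inter> L \<subseteq> W" and F: "normal_frame \<A> g L W F"
    and D: "D \<in> slice_charts \<A> L" "fst D \<inter> L \<subseteq> V" and G: "normal_frame \<A> g L V G"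
  let ?S = "fst C \<inter> fst D"
  let ?T = "(snd (slice_restrict L C) ` (?S \<inter> L)) \<times> (UNIV :: 'f set)"
  have opS: "open (snd C ` ?S)" by (rule open_image_inter[OF slice_max_atlas[OF C(1)] slice_max_atlas[OF D(1)]])
  have op: "open ?T" using open_slice_image[OF C(1) _ opS] by (simp add: open_Times)
  have "snd (bchart C F) ` (fst (bchart C F) \<inter> fst (bchart D G)) = ?T"
  proof
    show "snd (bchart C F) ` (fst (bchart C F) \<inter> fst (bchart D G)) \<subseteq> ?T"
      by (auto simp: fst_bchart snd_bchart)
    show "?T \<subseteq> snd (bchart C F) ` (fst (bchart C F) \<inter> fst (bchart D G))"
    proof safe
      fix y u assume y: "y \<in> fst C" "y \<in> fst D" "y \<in> L"
      have "(y, F u y) \<in> fst (bchart C F) \<inter> fst (bchart D G)"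
        using bchart_chart_inv(2)[OF F C y(1,3), of u] y by (simp add: fst_bchart)
      then show "(snd (slice_restrict L C) y, u) \<in> snd (bchart C F) ` (fst (bchart C F) \<inter> fst (bchart D G))"
        using bchart_chart_inv(3)[OF F C y(1,3), of u] by (metis imageI snd_slice_restrict)
    qed
  qed
  moreover have "smooth_on ?T (snd (bchart D G) \<circ> chart_inv (bchart C F))"
  proof (rule smooth_on_transform[OF op])
    show "smooth_on ?T (\<lambda>z. (fst (snd D (chart_inv C (fst z, 0))),
       inv_into UNIV (\<lambda>a. G a (chart_inv C (fst z, 0))) (F (snd z) (chart_inv C (fst z, 0)))))"
    proof (rule smooth_on_Pair[OF op])
      show "smooth_on ?T (\<lambda>z. fst (snd D (chart_inv C (fst z, 0))))"
        by (rule smooth_on_compose[OF op open_slice_image[OF C(1) _ opS] _ slice_transition_smooth[OF C(1) D(1)]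
              smooth_on_bounded_linear[OF op bounded_linear_fst]]) auto
      show "smooth_on ?T (\<lambda>z. inv_into UNIV (\<lambda>a. G a (chart_inv C (fst z, 0))) (F (snd z) (chart_inv C (fst z, 0))))"
        by (rule frame_transition_smooth[OF F G C(1) _ _ _ opS]) (use C D in auto)
    qed
    fix z assume "z \<in> ?T"
    then obtain y u where y: "y \<in> fst C" "y \<in> fst D" "y \<in> L" and z: "z = (fst (snd C y), u)" by auto
    show "(fst (snd D (chart_inv C (fst z, 0))),
       inv_into UNIV (\<lambda>a. G a (chart_inv C (fst z, 0))) (F (snd z) (chart_inv C (fst z, 0)))) =
       (snd (bchart D G) \<circ> chart_inv (bchart C F)) z"
      unfolding z using bchart_chart_inv(1)[OF F C y(1,3), of u] slice_chart_inv[OF C(1) y(1,3)]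
      by (simp add: snd_bchart)
  qed
  ultimately show "compatible (bchart C F) (bchart D G)" using op by (simp add: compatible_def)
qed

sublocale nb: atlas "\<N>"
  by unfold_locales (rule smooth_atlas_normal_bundle)

end

section \<open>Totally real, totally geodesic submanifolds of a Kaehler manifold\<close>

text \<open>Both factors of the model are \<open>'e\<close> because \<open>J\<close> carries the
  tangent spaces of \<open>L\<close> onto the normal spaces. The J-image of a coordinate frame of
  \<open>L\<close> can then serve as a normal frame with fibre model \<open>'e\<close>.\<close>

locale totally_real_geodesic = normal_bundle_atlas \<A> L g
  for \<A> :: "('m, 'e::euclidean_space \<times> 'e) atlas" and L :: "'m set"
    and g :: "'m \<Rightarrow> 'm tvec \<Rightarrow> 'm tvec \<Rightarrow> real" +
  fixes J :: "'m \<Rightarrow> 'm tvec \<Rightarrow> 'm tvec"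
    and nab :: "'m \<Rightarrow> 'm tvec \<Rightarrow> ('m \<Rightarrow> 'm tvec) \<Rightarrow> 'm tvec"
    and K :: "'m \<times> 'm tvec \<Rightarrow> ('m \<times> 'm tvec) tvec \<Rightarrow> 'm tvec"
  assumes kaehler: "kaehler \<A> g J nab"
    and totally_real: "totally_real \<A> g J L"
    and totally_geodesic: "totally_geodesic \<A> g nab L"
    and connection_map: "connection_map \<A> g nab L K"
begin

lemma riemannian: "riemannian_metric \<A> g"
  and almost_complex: "almost_complex \<A> J"
  and levi_civita: "levi_civita \<A> g nab"
  and affine_connection: "affine_connection \<A> nab"
  using kaehler by (simp_all add: kaehler_def almost_hermitian_def levi_civita_def)

lemma g_sym: "u \<in> tangent \<A> x \<Longrightarrow> v \<in> tangent \<A> x \<Longrightarrow> g x u v = g x v u"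
  and g_pos: "u \<in> tangent \<A> x \<Longrightarrow> u \<noteq> vzero \<Longrightarrow> g x u u > 0"
  and g_lin: "u \<in> tangent \<A> x \<Longrightarrow> v \<in> tangent \<A> x \<Longrightarrow> w \<in> tangent \<A> x \<Longrightarrow>
    g x (a \<bullet>\<^sub>t u \<boxplus> b \<bullet>\<^sub>t v) w = a * g x u w + b * g x v w"
  using riemannian tangent_points unfolding riemannian_metric_def by blast+

lemma g_smooth: "smooth_field \<A> W X \<Longrightarrow> smooth_field \<A> W Y \<Longrightarrow> x \<in> W \<Longrightarrow> smooth_near \<A> x (\<lambda>y. g y (X y) (Y y))"
  using riemannian unfolding riemannian_metric_def by blast

lemma J_tangent: "u \<in> tangent \<A> x \<Longrightarrow> J x u \<in> tangent \<A> x"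
  and J_J: "u \<in> tangent \<A> x \<Longrightarrow> J x (J x u) = (- 1) \<bullet>\<^sub>t u"
  and J_lin: "u \<in> tangent \<A> x \<Longrightarrow> v \<in> tangent \<A> x \<Longrightarrow>
    J x (a \<bullet>\<^sub>t u \<boxplus> b \<bullet>\<^sub>t v) = a \<bullet>\<^sub>t J x u \<boxplus> b \<bullet>\<^sub>t J x v"
  using almost_complex tangent_points unfolding almost_complex_def by blast+

lemma J_field: "smooth_field \<A> W X \<Longrightarrow> smooth_field \<A> W (\<lambda>x. J x (X x))"
  using almost_complex unfolding almost_complex_def by blast

lemma g_J: "u \<in> tangent \<A> x \<Longrightarrow> v \<in> tangent \<A> x \<Longrightarrow> g x (J x u) (J x v) = g x u v"
  using kaehler tangent_points unfolding kaehler_def almost_hermitian_def by blast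

section \<open>Adapted frames along L\<close>

text \<open>A coordinate field in the directions of \<open>L\<close>. It lives on the whole domain
  of the ambient chart, because \<open>nab\<close> differentiates ambient fields; tangency to
  \<open>L\<close> is meaningful only along \<open>L\<close>.\<close>

definition E :: "('m, 'e \<times> 'e) chart \<Rightarrow> 'm \<Rightarrow> 'e \<Rightarrow> 'm tvec" where
  "E C y a = chart_vec \<A> C y (a, 0)"

text \<open>Along \<open>L\<close> this is the induced metric in slice coordinates.\<close>

definition G :: "('m, 'e \<times> 'e) chart \<Rightarrow> 'm \<Rightarrow> 'e \<Rightarrow> 'e \<Rightarrow> real" where
  "G C y a b = g y (E C y a) (E C y b)"

text \<open>A normal frame along \<open>L\<close>, by total reality. It is chosen because
  \<open>J\<close> is parallel: in this frame the normal connection has the Christoffel symbols of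
  \<open>L\<close>.\<close>

definition JE :: "('m, 'e \<times> 'e) chart \<Rightarrow> 'e \<Rightarrow> 'm \<Rightarrow> 'm tvec" where
  "JE C a y = J y (E C y a)"

lemma vadd_zero: "vzero \<boxplus> v = v" "v \<boxplus> vzero = v"
  by (simp_all add: vadd_def)

lemma lincomb_simps:
  "1 \<bullet>\<^sub>t v = v" "0 \<bullet>\<^sub>t v = vzero" "a \<bullet>\<^sub>t vzero = vzero"
  by (simp_all add: vscale_def)

context
  fixes C assumes C: "C \<in> slice_charts \<A> L"
begin

lemma E_tangent: "y \<in> fst C \<Longrightarrow> E C y a \<in> tangent \<A> y"
  unfolding E_def by (rule tangent_chart_vec[OF slice_max_atlas[OF C]])

lemma JE_tangent: "y \<in> fst C \<Longrightarrow> JE C a y \<in> tangent \<A> y"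
  unfolding JE_def by (intro J_tangent E_tangent)

lemma E_lin: "y \<in> fst C \<Longrightarrow> E C y (r *\<^sub>R a + s *\<^sub>R b) = r \<bullet>\<^sub>t E C y a \<boxplus> s \<bullet>\<^sub>t E C y b"
  using chart_vec_linear[OF slice_max_atlas[OF C], of y r "(a, 0)" s "(b, 0)"] by (simp add: E_def)

lemma JE_lin: "y \<in> fst C \<Longrightarrow> JE C (r *\<^sub>R a + s *\<^sub>R b) y = r \<bullet>\<^sub>t JE C a y \<boxplus> s \<bullet>\<^sub>t JE C b y"
  by (simp add: JE_def E_lin J_lin E_tangent)

lemma E_add: "y \<in> fst C \<Longrightarrow> E C y a \<boxplus> E C y b = E C y (a + b)"
  and E_scale: "y \<in> fst C \<Longrightarrow> r \<bullet>\<^sub>t E C y a = E C y (r *\<^sub>R a)"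
  using E_lin[of y 1 a 1 b] E_lin[of y r a 0 0] by (simp_all add: lincomb_simps vadd_zero)

lemma JE_add: "y \<in> fst C \<Longrightarrow> JE C a y \<boxplus> JE C b y = JE C (a + b) y"
  and JE_scale: "y \<in> fst C \<Longrightarrow> r \<bullet>\<^sub>t JE C a y = JE C (r *\<^sub>R a) y"
  using JE_lin[of y 1 a 1 b] JE_lin[of y r a 0 0] by (simp_all add: lincomb_simps vadd_zero)

lemma E_zero: "y \<in> fst C \<Longrightarrow> E C y 0 = vzero"
  and JE_zero: "y \<in> fst C \<Longrightarrow> JE C 0 y = vzero"
  using E_scale[of y 0 0] JE_scale[of y 0 0] by (simp_all add: lincomb_simps)

lemma E_inj: "y \<in> fst C \<Longrightarrow> E C y a = E C y b \<Longrightarrow> a = b"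
  unfolding E_def using chart_vec_inj[OF slice_max_atlas[OF C]] by blast

lemma J_JE: "y \<in> fst C \<Longrightarrow> J y (JE C a y) = E C y (- a)"
  using E_scale[of y "- 1" a] by (simp add: JE_def J_J E_tangent)

lemma JE_inj: "y \<in> fst C \<Longrightarrow> JE C a y = JE C b y \<Longrightarrow> a = b"
  using J_JE[of y a] J_JE[of y b] E_inj[of y "- a" "- b"] by simp

lemma E_field: "smooth_field \<A> (fst C) (\<lambda>y. E C y a)"
proof (rule smooth_fieldI[OF openin_chart[OF slice_max_atlas[OF C]] _ slice_max_atlas[OF C]])
  show "smooth_on (snd C ` fst C) (\<lambda>u. (a, 0))"
    by (rule smooth_on_const[OF open_chart_image[OF slice_max_atlas[OF C]]])
qed (simp_all add: E_def)

lemma JE_field: "smooth_field \<A> (fst C) (JE C a)"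
  using J_field[OF E_field] by (simp add: JE_def[abs_def])

lemma G_sym: "y \<in> fst C \<Longrightarrow> G C y a b = G C y b a"
  unfolding G_def by (intro g_sym E_tangent)

lemma linear_G_left: "y \<in> fst C \<Longrightarrow> linear (\<lambda>a. G C y a b)"
proof (rule linearI)
  assume y: "y \<in> fst C"
  show "G C y (a + a') b = G C y a b + G C y a' b" for a a'
    using g_lin[OF E_tangent[OF y] E_tangent[OF y] E_tangent[OF y], of 1 a 1 a' b]
    by (simp add: G_def lincomb_simps E_add[OF y])
  show "G C y (r *\<^sub>R a) b = r *\<^sub>R G C y a b" for r a
    using g_lin[OF E_tangent[OF y] E_tangent[OF y] E_tangent[OF y], of r a 0 0 b]
    by (simp add: G_def lincomb_simps E_scale[OF y] E_zero[OF y] vadd_zero)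
qed

lemma linear_G_right: "y \<in> fst C \<Longrightarrow> linear (\<lambda>b. G C y a b)"
  using linear_G_left[of y a] G_sym[of y] by simp

lemma G_simps:
  assumes "y \<in> fst C"
  shows "G C y (a + b) c = G C y a c + G C y b c" "G C y (a - b) c = G C y a c - G C y b c"
    "G C y (- a) c = - G C y a c" "G C y (r *\<^sub>R a) c = r * G C y a c" "G C y 0 c = 0"
    "G C y c (a + b) = G C y c a + G C y c b" "G C y c (a - b) = G C y c a - G C y c b"
    "G C y c (- a) = - G C y c a" "G C y c (r *\<^sub>R a) = r * G C y c a" "G C y c 0 = 0"
  using linear_add[OF linear_G_left[OF assms]] linear_diff[OF linear_G_left[OF assms]]
    linear_neg[OF linear_G_left[OF assms]] linear_cmul[OF linear_G_left[OF assms]] linear_0[OF linear_G_left[OF assms]]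
    linear_add[OF linear_G_right[OF assms]] linear_diff[OF linear_G_right[OF assms]]
    linear_neg[OF linear_G_right[OF assms]] linear_cmul[OF linear_G_right[OF assms]] linear_0[OF linear_G_right[OF assms]]
  by simp_all

lemma G_pos: "y \<in> fst C \<Longrightarrow> a \<noteq> 0 \<Longrightarrow> G C y a a > 0"
  unfolding G_def using E_inj[of y a 0] E_zero by (intro g_pos E_tangent) auto

lemma G_nonneg: "y \<in> fst C \<Longrightarrow> G C y a a \<ge> 0"
  using G_pos[of y a] G_simps(5)[of y a] by (cases "a = 0") auto

lemma G_smooth_near: "y \<in> fst C \<Longrightarrow> smooth_near \<A> y (\<lambda>y. G C y a b)"
  unfolding G_def by (intro g_smooth[OF E_field E_field])

lemma G_JE: "y \<in> fst C \<Longrightarrow> g y (JE C a y) (JE C b y) = G C y a b"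
  unfolding JE_def G_def by (intro g_J E_tangent)

end

context
  fixes C y assumes C: "C \<in> slice_charts \<A> L" and y: "y \<in> fst C" "y \<in> L"
begin

lemma tangent_sub_E: "tangent_sub \<A> L y = range (E C y)"
  unfolding tangent_sub_eq[OF C y] E_def[abs_def] ..

lemma g_E_JE: "g y (E C y a) (JE C b y) = 0" "g y (JE C b y) (E C y a) = 0"
proof -
  show *: "g y (E C y a) (JE C b y) = 0"
    using totally_real y(2) tangent_sub_E unfolding totally_real_def JE_def by blast
  show "g y (JE C b y) (E C y a) = 0"
    using * g_sym[OF E_tangent[OF C y(1)] JE_tangent[OF C y(1)]] by simp
qed

lemma tangent_decomp:
  assumes "w \<in> tangent \<A> y"
  obtains a b where "w = E C y a \<boxplus> JE C b y"
proof -
  obtain u v where "u \<in> tangent_sub \<A> L y" "v \<in> tangent_sub \<A> L y" "w = u \<boxplus> J y v"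
    using totally_real y(2) assms unfolding totally_real_def by blast
  then show ?thesis using that unfolding tangent_sub_E JE_def by blast
qed

text \<open>Pairing a normal vector \<open>E C y a \<boxplus> JE C b y\<close> with
  \<open>E C y a\<close> leaves \<open>G C y a a\<close>, which must therefore vanish, so that a =
  0.\<close>

lemma normal_sub_JE: "nsub y = range (\<lambda>a. JE C a y)"
proof
  show "range (\<lambda>a. JE C a y) \<subseteq> nsub y"
    using g_E_JE(2) JE_tangent[OF C y(1)] by (auto simp: normal_sub_def tangent_sub_E)
  show "nsub y \<subseteq> range (\<lambda>a. JE C a y)"
  proof
    fix \<xi> assume \<xi>: "\<xi> \<in> nsub y"
    then have "\<xi> \<in> tangent \<A> y" by (simp add: normal_sub_def)
    then obtain a b where ab: "\<xi> = E C y a \<boxplus> JE C b y" by (rule tangent_decomp)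
    have "0 = g y \<xi> (E C y a)" using \<xi> by (simp add: normal_sub_def tangent_sub_E)
    also have "\<dots> = g y (E C y a) (E C y a) + g y (JE C b y) (E C y a)"
      using g_lin[OF E_tangent[OF C y(1)] JE_tangent[OF C y(1)] E_tangent[OF C y(1)], of 1 a 1 b a]
      by (simp add: ab lincomb_simps)
    also have "\<dots> = G C y a a" by (simp add: g_E_JE G_def)
    finally have "a = 0" using G_pos[OF C y(1), of a] by force
    then show "\<xi> \<in> range (\<lambda>a. JE C a y)" using ab by (simp add: E_zero[OF C y(1)] vadd_zero)
  qed
qed

lemma normal_part_JE: "normal_part \<A> g L y (E C y a \<boxplus> JE C b y) = JE C b y"
  unfolding normal_part_def
proof (rule the_equality)
  show "JE C b y \<in> nsub y \<and> (\<exists>u\<in>tangent_sub \<A> L y. E C y a \<boxplus> JE C b y = u \<boxplus> JE C b y)"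
    unfolding normal_sub_JE tangent_sub_E by blast
  fix \<xi> assume "\<xi> \<in> nsub y \<and> (\<exists>u\<in>tangent_sub \<A> L y. E C y a \<boxplus> JE C b y = u \<boxplus> \<xi>)"
  then obtain a' b' where \<xi>: "\<xi> = JE C b' y" and eq: "E C y a \<boxplus> JE C b y = E C y a' \<boxplus> JE C b' y"
    unfolding normal_sub_JE tangent_sub_E by blast
  \<comment> \<open>Two decompositions differ by a vector that is both tangent and normal, hence
    orthogonal to itself.\<close>
  have "E C y (a - a') = JE C (b' - b) y"
  proof
    fix f
    show "E C y (a - a') f = JE C (b' - b) y f"
      using fun_cong[OF eq, of f] fun_cong[OF E_lin[OF C y(1), of 1 a "-1" a'], of f]
        fun_cong[OF JE_lin[OF C y(1), of 1 b' "-1" b], of f]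
      by (simp add: vadd_def vscale_def)
  qed
  then have "g y (JE C (b' - b) y) (JE C (b' - b) y) = 0"
    using g_E_JE(1)[of "a - a'" "b' - b"] by simp
  then have "b' = b" using G_pos[OF C y(1), of "b' - b"] by (force simp: G_JE[OF C y(1)])
  then show "\<xi> = JE C b y" using \<xi> by simp
qed

lemma normal_frame_bij: "bij_betw (\<lambda>a. JE C a y) UNIV (nsub y)"
  unfolding normal_sub_JE bij_betw_def using JE_inj[OF C y(1)] by (auto intro: injI)

lemma nab_E_tangent_sub: "nab y (E C y a) (\<lambda>y. E C y b) \<in> range (E C y)"
proof -
  have "\<forall>x\<in>fst C \<inter> L. E C x b \<in> tangent_sub \<A> L x"
    using tangent_sub_eq[OF C] by (auto simp: E_def)
  then have "normal_part \<A> g L y (nab y (E C y a) (\<lambda>y. E C y b)) = vzero"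
    using totally_geodesic E_field[OF C] y tangent_sub_E unfolding totally_geodesic_def by blast
  moreover have "nab y (E C y a) (\<lambda>y. E C y b) \<in> tangent \<A> y"
    using affine_connection E_field[OF C] y(1) E_tangent[OF C y(1)] unfolding affine_connection_def by blast
  then obtain c d where cd: "nab y (E C y a) (\<lambda>y. E C y b) = E C y c \<boxplus> JE C d y"
    by (rule tangent_decomp)
  ultimately have "JE C d y = vzero" using normal_part_JE by simp
  then show ?thesis using cd by (simp add: vadd_zero)
qed

end

text \<open>The Christoffel symbols of \<open>L\<close>. On \<open>L\<close> the choice exists (and is unique) because \<open>L\<close> is totally
  geodesic.\<close>
definition \<Gamma> :: "('m, 'e \<times> 'e) chart \<Rightarrow> 'm \<Rightarrow> 'e \<Rightarrow> 'e \<Rightarrow> 'e" where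
  "\<Gamma> C y a b = (SOME c. nab y (E C y a) (\<lambda>y. E C y b) = E C y c)"

lemma normal_frame_JE:
  assumes C: "C \<in> slice_charts \<A> L"
  shows "normal_frame \<A> g L (fst C) (JE C)"
  unfolding normal_frame_def normal_section_def
proof (intro conjI allI ballI)
  show "smooth_field \<A> (fst C) (JE C a)" for a by (rule JE_field[OF C])
  fix y assume "y \<in> fst C \<inter> L"
  then have y: "y \<in> fst C" "y \<in> L" by auto
  show "JE C a y \<in> nsub y" for a unfolding normal_sub_JE[OF C y] by blast
  show "bij_betw (\<lambda>a. JE C a y) UNIV (nsub y)" by (rule normal_frame_bij[OF C y])
  show "JE C (r *\<^sub>R a + s *\<^sub>R b) y = r \<bullet>\<^sub>t JE C a y \<boxplus> s \<bullet>\<^sub>t JE C b y" for a b r s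
    by (rule JE_lin[OF C y(1)])
qed

context
  fixes C y assumes C: "C \<in> slice_charts \<A> L" and y: "y \<in> fst C" "y \<in> L"
begin

lemma nab_E: "nab y (E C y a) (\<lambda>y. E C y b) = E C y (\<Gamma> C y a b)"
proof -
  obtain c where "nab y (E C y a) (\<lambda>y. E C y b) = E C y c" using nab_E_tangent_sub[OF C y] by blast
  then show ?thesis unfolding \<Gamma>_def by (rule someI)
qed

lemma \<Gamma>_lin: "\<Gamma> C y (r *\<^sub>R a + s *\<^sub>R b) c = r *\<^sub>R \<Gamma> C y a c + s *\<^sub>R \<Gamma> C y b c"
proof (rule E_inj[OF C y(1)])
  have "nab y (r \<bullet>\<^sub>t E C y a \<boxplus> s \<bullet>\<^sub>t E C y b) (\<lambda>y. E C y c) =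
      r \<bullet>\<^sub>t nab y (E C y a) (\<lambda>y. E C y c) \<boxplus> s \<bullet>\<^sub>t nab y (E C y b) (\<lambda>y. E C y c)"
    using affine_connection E_field[OF C] y(1) E_tangent[OF C y(1)] unfolding affine_connection_def by blast
  then show "E C y (\<Gamma> C y (r *\<^sub>R a + s *\<^sub>R b) c) = E C y (r *\<^sub>R \<Gamma> C y a c + s *\<^sub>R \<Gamma> C y b c)"
    by (simp add: nab_E[symmetric] E_lin[OF C y(1)])
qed

lemma linear_\<Gamma>: "linear (\<lambda>a. \<Gamma> C y a c)"
  using \<Gamma>_lin[of 1 _ 1 _ c] \<Gamma>_lin[of _ _ 0 0 c] by (intro linearI) simp_all

text \<open>Slice coordinate fields have constant components, so their bracket vanishes, and
  torsion-freeness exchanges the two arguments.\<close>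

lemma \<Gamma>_sym: "\<Gamma> C y a b = \<Gamma> C y b a"
proof (rule E_inj[OF C y(1)])
  note C' = slice_max_atlas[OF C]
  have const: "\<D> (\<lambda>u. vec_coord C (E C (chart_inv C u) c)) (snd C y) = (\<lambda>v. 0)" for c
  proof (rule frechet_derivative_eqI, rule has_derivative_transform_within_open[OF has_derivative_const open_chart_image[OF C']])
    show "snd C y \<in> snd C ` fst C" using y(1) by blast
    fix u assume "u \<in> snd C ` fst C"
    from vec_coord_chart_vec[OF C' chart_inv_mem[OF this]]
    show "(c, 0) = vec_coord C (E C (chart_inv C u) c)" by (simp add: E_def)
  qed
  have "lie_bracket \<A> (\<lambda>y. E C y a) (\<lambda>y. E C y b) y = chart_vec \<A> C y 0"
    using lie_bracket_coord[OF E_field[OF C] E_field[OF C] C' y(1,1)] by (simp add: const)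
  also have "\<dots> = vzero" using E_zero[OF C y(1)] by (simp add: E_def zero_prod_def)
  finally have bracket: "lie_bracket \<A> (\<lambda>y. E C y a) (\<lambda>y. E C y b) y = vzero" .
  have "nab x (X x) Y = nab x (Y x) X \<boxplus> lie_bracket \<A> X Y x"
    if "smooth_field \<A> W X" "smooth_field \<A> W Y" "x \<in> W" for W X Y x
    using levi_civita that unfolding levi_civita_def by blast
  from this[OF E_field[OF C] E_field[OF C] y(1), of a b]
  have "nab y (E C y a) (\<lambda>y. E C y b) = nab y (E C y b) (\<lambda>y. E C y a) \<boxplus> vzero"
    by (simp add: bracket)
  then show "E C y (\<Gamma> C y a b) = E C y (\<Gamma> C y b a)" by (simp add: nab_E vadd_zero)
qed

text \<open>Metric compatibility in \<open>M\<close> descends to \<open>L\<close> because the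
  covariant derivatives of these fields along \<open>L\<close> have no normal part.\<close>

lemma E_G: "E C y c (\<lambda>y. G C y a b) = G C y (\<Gamma> C y c a) b + G C y a (\<Gamma> C y c b)"
proof -
  have "E C y c (\<lambda>y. g y (E C y a) (E C y b)) =
      g y (nab y (E C y c) (\<lambda>y. E C y a)) (E C y b) + g y (E C y a) (nab y (E C y c) (\<lambda>y. E C y b))"
    using levi_civita E_field[OF C] E_tangent[OF C y(1)] y(1) unfolding levi_civita_def by blast
  then show ?thesis by (simp add: nab_E G_def)
qed

end

section \<open>The bundle chart of the frame JE\<close>

abbreviation "NC C \<equiv> bchart C (JE C)"

lemma NC_normal_bundle: "C \<in> slice_charts \<A> L \<Longrightarrow> NC C \<in> \<N>"
  unfolding normal_bundle_eq using normal_frame_JE[of C] by blast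

lemma NC_max: "C \<in> slice_charts \<A> L \<Longrightarrow> NC C \<in> max_atlas \<N>"
  by (rule nb.chart_max_atlas[OF NC_normal_bundle])

text \<open>The atlas has charts for arbitrary frames, but those with frame \<open>JE\<close>
  already cover the total space. Pointwise identities may thus be verified at points
  \<open>(y, JE C u y)\<close>.\<close>

lemma points_normal_bundle:
  assumes "z \<in> points \<N>"
  obtains C y u where "C \<in> slice_charts \<A> L" "y \<in> fst C" "y \<in> L" "z = (y, JE C u y)"
proof -
  obtain D :: "('m, 'e \<times> 'e) chart" and F where "z \<in> fst (bchart D F)"
    using assms unfolding points_def normal_bundle_eq by blast
  then obtain y \<theta> where z: "z = (y, \<theta>)" "y \<in> L" "\<theta> \<in> nsub y" by (auto simp: fst_bchart)
  obtain C where C: "C \<in> slice_charts \<A> L" "y \<in> fst C" using slice_chart_exists[OF z(2)] by blast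
  with z that[OF C z(2)] normal_sub_JE[OF C z(2)] show ?thesis by blast
qed

lemma K_lin: "z \<in> points \<N> \<Longrightarrow> A \<in> tangent \<N> z \<Longrightarrow>
    B \<in> tangent \<N> z \<Longrightarrow> K z (a \<bullet>\<^sub>t A \<boxplus> b \<bullet>\<^sub>t B) = a \<bullet>\<^sub>t K z A \<boxplus> b \<bullet>\<^sub>t K z B"
  using connection_map[unfolded connection_map_def Let_def, THEN conjunct1] by blast

context
  fixes C assumes C: "C \<in> slice_charts \<A> L"
begin

lemma NC_facts:
  assumes y: "y \<in> fst C" "y \<in> L"
  shows "(y, JE C u y) \<in> fst (NC C)" "snd (NC C) (y, JE C u y) = (fst (snd C y), u)"
    and "chart_inv (NC C) (fst (snd C y), u) = (y, JE C u y)"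
  using bchart_chart_inv[OF normal_frame_JE[OF C] C _ y] by auto

definition "U = snd (slice_restrict L C) ` (fst C \<inter> L)"

lemma open_U: "open U"
  unfolding U_def using open_slice_image[OF C _ open_chart_image[OF slice_max_atlas[OF C]]] by simp

lemma U_mem: "y \<in> fst C \<Longrightarrow> y \<in> L \<Longrightarrow> fst (snd C y) \<in> U"
  by (force simp: U_def)

lemma U_E:
  assumes "a \<in> U"
  obtains y where "y \<in> fst C" "y \<in> L" "a = fst (snd C y)" "chart_inv C (a, 0) = y" "snd C y = (a, 0)"
proof -
  obtain y where y: "y \<in> fst C" "y \<in> L" "a = fst (snd C y)" using assms by (auto simp: U_def)
  show ?thesis
  proof (rule that[OF y])
    show "chart_inv C (a, 0) = y" unfolding y(3) by (rule slice_chart_inv[OF C y(1,2)])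
    show "snd C y = (a, 0)" unfolding y(3) by (rule slice_coord[OF C y(1,2)])
  qed
qed

lemma NC_image: "snd (NC C) ` fst (NC C) = U \<times> UNIV"
proof
  show "snd (NC C) ` fst (NC C) \<subseteq> U \<times> UNIV"
    using U_mem by (auto simp: fst_bchart snd_bchart)
  show "U \<times> UNIV \<subseteq> snd (NC C) ` fst (NC C)"
  proof safe
    fix a u assume "a \<in> U"
    then obtain y where "y \<in> fst C" "y \<in> L" "a = fst (snd C y)" by (rule U_E)
    then show "(a, u) \<in> snd (NC C) ` fst (NC C)" using NC_facts(1,2)[of y u] by (metis imageI)
  qed
qed

definition Gh :: "'e \<Rightarrow> 'e \<Rightarrow> 'e \<Rightarrow> real" where "Gh a b c = G C (chart_inv C (a, 0)) b c"

lemma Gh_eq: "y \<in> fst C \<Longrightarrow> y \<in> L \<Longrightarrow> Gh (fst (snd C y)) b c = G C y b c"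
  by (simp add: Gh_def slice_chart_inv[OF C])

lemma Gh_smooth: "smooth_on U (\<lambda>a. Gh a b c)"
  unfolding Gh_def
proof (rule smooth_on_compose[OF open_U open_chart_image[OF slice_max_atlas[OF C]]])
  show "(\<lambda>a. (a, 0)) ` U \<subseteq> snd C ` fst C"
  proof safe
    fix a assume "a \<in> U"
    then show "(a, 0) \<in> snd C ` fst C" by (rule U_E) (metis imageI)
  qed
  show "smooth_on U (\<lambda>a. (a, 0))" by (rule smooth_on_bounded_linear[OF open_U bounded_linear_pair_zero])
  show "smooth_on (snd C ` fst C) (\<lambda>x. G C (chart_inv C x) b c)"
    using smooth_near_imp_smooth_on[OF slice_max_atlas[OF C] openin_chart[OF slice_max_atlas[OF C]], of "\<lambda>y. G C y b c"]
      G_smooth_near[OF C] by (simp add: o_def)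
qed

text \<open>Differentiating along the slice in direction \<open>h\<close> is the action of the
  tangent vector \<open>E C y h\<close> on \<open>G\<close>, which \<open>E_G\<close>
  evaluates.\<close>

lemma Gh_has_derivative:
  assumes y: "y \<in> fst C" "y \<in> L"
  shows "((\<lambda>a. Gh a b c) has_derivative (\<lambda>h. G C y (\<Gamma> C y h b) c + G C y b (\<Gamma> C y h c))) (at (fst (snd C y)))"
proof -
  note C' = slice_max_atlas[OF C]
  let ?f = "(\<lambda>y. G C y b c) \<circ> chart_inv C"
  note df = smooth_near_has_derivative[OF C' y(1) G_smooth_near[OF C y(1), of b c]]
  then have "(?f has_derivative \<D> ?f (snd C y)) (at (fst (snd C y), 0))"
    using slice_coord[OF C y] by metis
  from has_derivative_compose[OF bounded_linear_imp_has_derivative[OF bounded_linear_pair_zero] this]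
  have "((\<lambda>a. Gh a b c) has_derivative (\<lambda>h. \<D> ?f (snd C y) (h, 0))) (at (fst (snd C y)))"
    by (simp add: Gh_def)
  moreover have "\<D> ?f (snd C y) (h, 0) = G C y (\<Gamma> C y h b) c + G C y b (\<Gamma> C y h c)" for h
    using chart_vec_apply[OF C' y(1) G_smooth_near[OF C y(1), of b c] df, of "(h, 0)"] E_G[OF C y, of h b c]
    by (simp add: E_def)
  ultimately show ?thesis by simp
qed

lemma linear_Gh: "a \<in> U \<Longrightarrow> linear (\<lambda>b. Gh a b c)" "a \<in> U \<Longrightarrow> linear (\<lambda>c. Gh a b c)"
  using linear_G_left[OF C] linear_G_right[OF C] by (auto elim!: U_E simp: Gh_def)

lemma Gh_smooth_compose:
  fixes \<alpha> \<beta> \<gamma> :: "'x::euclidean_space \<Rightarrow> 'e"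
  assumes S: "open S" "\<alpha> ` S \<subseteq> U" and sm: "smooth_on S \<alpha>" "smooth_on S \<beta>" "smooth_on S \<gamma>"
  shows "smooth_on S (\<lambda>w. Gh (\<alpha> w) (\<beta> w) (\<gamma> w))"
proof (rule smooth_on_linear_apply[where m = "\<lambda>w c. Gh (\<alpha> w) (\<beta> w) c", OF S(1) _ _ sm(3)])
  show "linear (Gh (\<alpha> w) (\<beta> w))" if "w \<in> S" for w using linear_Gh(2)[of "\<alpha> w"] S(2) that by blast
  show "smooth_on S (\<lambda>w. Gh (\<alpha> w) (\<beta> w) c)" for c
  proof (rule smooth_on_linear_apply[where m = "\<lambda>w b. Gh (\<alpha> w) b c", OF S(1) _ _ sm(2)])
    show "linear (\<lambda>b. Gh (\<alpha> w) b c)" if "w \<in> S" for w using linear_Gh(1)[of "\<alpha> w"] S(2) that by blast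
    show "smooth_on S (\<lambda>w. Gh (\<alpha> w) b c)" for b
      by (rule smooth_on_compose[OF S(1) open_U S(2) Gh_smooth sm(1)])
  qed
qed

text \<open>\<open>Gh\<close> is bilinear in its last two arguments, so a basis expansion reduces
  the claim to the product rule and to \<open>Gh_has_derivative\<close> for constant
  vectors.\<close>

lemma Gh_compose_has_derivative:
  fixes \<alpha> \<beta> \<gamma> :: "'x::euclidean_space \<Rightarrow> 'e"
  assumes S: "open S" "\<alpha> ` S \<subseteq> U" "w \<in> S"
    and y: "y \<in> fst C" "y \<in> L" "\<alpha> w = fst (snd C y)"
    and d: "(\<alpha> has_derivative \<alpha>') (at w)" "(\<beta> has_derivative \<beta>') (at w)" "(\<gamma> has_derivative \<gamma>') (at w)"
  shows "((\<lambda>w. Gh (\<alpha> w) (\<beta> w) (\<gamma> w)) has_derivative (\<lambda>h.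
    G C y (\<Gamma> C y (\<alpha>' h) (\<beta> w)) (\<gamma> w) + G C y (\<beta> w) (\<Gamma> C y (\<alpha>' h) (\<gamma> w)) +
    G C y (\<beta>' h) (\<gamma> w) + G C y (\<beta> w) (\<gamma>' h))) (at w)"
proof -
  let ?D = "\<lambda>b c k. G C y (\<Gamma> C y k b) c + G C y b (\<Gamma> C y k c)"
  let ?a = "\<alpha> w"
  have aU: "?a \<in> U" using S by blast
  have expand: "Gh a b c = (\<Sum>i\<in>Basis. \<Sum>j\<in>Basis. (b \<bullet> i) * (c \<bullet> j) * Gh a i j)" if "a \<in> U" for a b c
  proof -
    have 1: "Gh a b c = (\<Sum>i\<in>Basis. (b \<bullet> i) *\<^sub>R Gh a i c)"
      by (rule linear_Basis_sum[OF linear_Gh(1)[OF that]])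
    have 2: "Gh a i c = (\<Sum>j\<in>Basis. (c \<bullet> j) *\<^sub>R Gh a i j)" for i
      by (rule linear_Basis_sum[OF linear_Gh(2)[OF that]])
    show ?thesis by (subst 1, subst 2) (simp add: sum_distrib_left mult.assoc)
  qed
  have dG: "((\<lambda>a. Gh a b c) has_derivative ?D b c) (at ?a)" for b c
    using Gh_has_derivative[OF y(1,2), of b c] y(3) by simp
  \<comment> \<open>Bilinearity of the derivative in (b, c) is obtained by differentiating the
    expansion of \<open>Gh\<close> and comparing, derivatives being unique.\<close>
  have D: "?D b c k = (\<Sum>i\<in>Basis. \<Sum>j\<in>Basis. (b \<bullet> i) * (c \<bullet> j) * ?D i j k)" for b c k
  proof -
    have "((\<lambda>a. \<Sum>i\<in>Basis. \<Sum>j\<in>Basis. (b \<bullet> i) * (c \<bullet> j) * Gh a i j) has_derivative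
        (\<lambda>k. \<Sum>i\<in>Basis. \<Sum>j\<in>Basis. (b \<bullet> i) * (c \<bullet> j) * ?D i j k)) (at ?a)"
      by (intro has_derivative_sum has_derivative_mult_right dG)
    then have "((\<lambda>a. Gh a b c) has_derivative
        (\<lambda>k. \<Sum>i\<in>Basis. \<Sum>j\<in>Basis. (b \<bullet> i) * (c \<bullet> j) * ?D i j k)) (at ?a)"
      by (rule has_derivative_transform_within_open[OF _ open_U aU]) (simp add: expand)
    from has_derivative_unique[OF dG this] show ?thesis by meson
  qed
  have D': "?D (\<beta> w) (\<gamma> w) k = (\<Sum>i\<in>Basis. \<Sum>j\<in>Basis. (\<beta> w \<bullet> i) * (\<gamma> w \<bullet> j) * ?D i j k)" for k
    by (rule D)
  have "((\<lambda>w. \<Sum>i\<in>Basis. \<Sum>j\<in>Basis. (\<beta> w \<bullet> i) * (\<gamma> w \<bullet> j) * Gh (\<alpha> w) i j) has_derivative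
     (\<lambda>h. \<Sum>i\<in>Basis. \<Sum>j\<in>Basis. (\<beta> w \<bullet> i) * (\<gamma> w \<bullet> j) * ?D i j (\<alpha>' h)
        + ((\<beta> w \<bullet> i) * (\<gamma>' h \<bullet> j) + (\<beta>' h \<bullet> i) * (\<gamma> w \<bullet> j)) * Gh (\<alpha> w) i j)) (at w)"
    by (intro has_derivative_sum has_derivative_mult has_derivative_inner_left d has_derivative_compose[OF d(1) dG])
  moreover have "(\<Sum>i\<in>Basis. \<Sum>j\<in>Basis. (\<beta> w \<bullet> i) * (\<gamma> w \<bullet> j) * ?D i j (\<alpha>' h)
        + ((\<beta> w \<bullet> i) * (\<gamma>' h \<bullet> j) + (\<beta>' h \<bullet> i) * (\<gamma> w \<bullet> j)) * Gh (\<alpha> w) i j)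
     = ?D (\<beta> w) (\<gamma> w) (\<alpha>' h) + (Gh (\<alpha> w) (\<beta> w) (\<gamma>' h) + Gh (\<alpha> w) (\<beta>' h) (\<gamma> w))" for h
    unfolding D' expand[OF aU, of "\<beta> w" "\<gamma>' h"] expand[OF aU, of "\<beta>' h" "\<gamma> w"]
    by (simp only: sum.distrib distrib_right mult.assoc)
  ultimately have "((\<lambda>w. \<Sum>i\<in>Basis. \<Sum>j\<in>Basis. (\<beta> w \<bullet> i) * (\<gamma> w \<bullet> j) * Gh (\<alpha> w) i j) has_derivative
     (\<lambda>h. ?D (\<beta> w) (\<gamma> w) (\<alpha>' h) + G C y (\<beta>' h) (\<gamma> w) + G C y (\<beta> w) (\<gamma>' h))) (at w)"
    by (simp add: y(3) Gh_eq[OF y(1,2)] add_ac)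
  then show ?thesis
    by (rule has_derivative_transform_within_open[OF _ S(1,3)]) (use S(2) in \<open>simp add: expand image_subset_iff\<close>)
qed

end

section \<open>The connection map and the lifts in bundle coordinates\<close>

text \<open>A coordinate vector at the point \<open>JE C u y\<close>. Its argument is split as (X,
  V), where V is the raw fibre coordinate and differs from the vertical component by a Christoffel
  term.\<close>

definition T :: "('m, 'e \<times> 'e) chart \<Rightarrow> 'm \<Rightarrow> 'e \<Rightarrow> 'e \<times> 'e \<Rightarrow> ('m \<times> 'm tvec) tvec" where
  "T C y u w = chart_vec \<N> (NC C) (y, JE C u y) w"

context
  fixes C y and u :: 'e assumes C: "C \<in> slice_charts \<A> L" and y: "y \<in> fst C" "y \<in> L"
begin

lemma T_tangent: "T C y u w \<in> tangent \<N> (y, JE C u y)"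
  unfolding T_def by (rule nb.tangent_chart_vec[OF NC_max[OF C] NC_facts(1)[OF C y]])

lemma tangent_T:
  assumes "A \<in> tangent \<N> (y, JE C u y)"
  obtains X V where "A = T C y u (X, V)"
  using assms that nb.tangent_eq[OF NC_max[OF C] NC_facts(1)[OF C y]] unfolding T_def by force

lemma T_lin: "T C y u (a *\<^sub>R v + b *\<^sub>R w) = a \<bullet>\<^sub>t T C y u v \<boxplus> b \<bullet>\<^sub>t T C y u w"
  unfolding T_def by (rule nb.chart_vec_linear[OF NC_max[OF C] NC_facts(1)[OF C y]])

lemma T_scale: "a \<bullet>\<^sub>t T C y u w = T C y u (a *\<^sub>R w)"
  and T_add: "T C y u v \<boxplus> T C y u w = T C y u (v + w)"
  using T_lin[of a w 0 0] T_lin[of 1 v 1 w] by (simp_all add: lincomb_simps vadd_zero)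

lemma proj_T: "proj_push \<A> (y, JE C u y) (T C y u (X, V)) = E C y X"
proof
  fix f
  show "proj_push \<A> (y, JE C u y) (T C y u (X, V)) f = E C y X f"
  proof (cases "smooth_near \<A> y f")
    case True
    note C' = slice_max_atlas[OF C] and zN = NC_facts(1)[OF C y, of u]
    let ?k = "\<lambda>w::'e \<times> 'e. (fst w, 0 :: 'e)"
    have bl: "bounded_linear ?k" by (rule bounded_linear_Pair[OF bounded_linear_fst bounded_linear_zero])
    obtain S where S: "open S" "snd C y \<in> S" "S \<subseteq> snd C ` fst C" "smooth_on S (f \<circ> chart_inv C)"
      using True smooth_near_iff[OF C' y(1)] by blast
    have op: "open (?k -` S)" by (rule open_vimage[OF S(1)]) (intro linear_continuous_on bl)
    have sm: "smooth_near \<N> (y, JE C u y) (f \<circ> fst)"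
    proof (rule nb.smooth_nearI[OF NC_max[OF C] zN op])
      show "snd (NC C) (y, JE C u y) \<in> ?k -` S" using slice_coord[OF C y] S(2) by (simp add: NC_facts(2)[OF C y])
      show "smooth_on (?k -` S) (\<lambda>w. (f \<circ> chart_inv C) (?k w))"
        by (rule smooth_on_compose[OF op S(1) _ S(4) smooth_on_bounded_linear[OF op bl]]) auto
      fix z' assume "z' \<in> fst (NC C)"
      then show "(f \<circ> fst) z' = (f \<circ> chart_inv C) (?k (snd (NC C) z'))"
        by (auto simp: fst_bchart snd_bchart slice_chart_inv[OF C])
    qed
    note df = smooth_near_has_derivative[OF C' y(1) True]
    let ?f = "f \<circ> chart_inv C"
    have "(?f has_derivative \<D> ?f (snd C y)) (at (?k (snd (NC C) (y, JE C u y))))"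
      using df slice_coord[OF C y] by (metis NC_facts(2)[OF C y] fst_conv)
    from has_derivative_compose[OF bounded_linear_imp_has_derivative[OF bl] this]
    have "((f \<circ> fst) \<circ> chart_inv (NC C) has_derivative (\<lambda>w. \<D> ?f (snd C y) (?k w))) (at (snd (NC C) (y, JE C u y)))"
    proof (rule has_derivative_transform_within_open[OF _ nb.open_chart_image[OF NC_max[OF C]]])
      show "snd (NC C) (y, JE C u y) \<in> snd (NC C) ` fst (NC C)" using zN by blast
      fix w assume "w \<in> snd (NC C) ` fst (NC C)"
      then have "w \<in> U C \<times> UNIV" by (simp add: NC_image[OF C])
      then obtain y' where y': "y' \<in> fst C" "y' \<in> L" "fst w = fst (snd C y')" by (auto elim!: U_E[OF C])
      then show "?f (?k w) = ((f \<circ> fst) \<circ> chart_inv (NC C)) w"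
        using NC_facts(3)[OF C y'(1,2), of "snd w"] slice_chart_inv[OF C y'(1,2)]
        by (metis comp_apply fst_conv prod.collapse)
    qed
    from nb.chart_vec_apply[OF NC_max[OF C] zN sm this, of "(X, V)"]
    show ?thesis using True chart_vec_apply[OF C' y(1) True df, of "(X, 0)"]
      by (simp add: proj_push_def push_def T_def E_def)
  qed (simp add: proj_push_def push_def E_def chart_vec_def)
qed

text \<open>A section with constant coordinates in the frame has no fibre velocity. Its push-forward
  is thus the complement of the fibre directions on which the second axiom for \<open>K\<close> can
  be evaluated.\<close>

lemma push_section:
  "push \<N> (\<lambda>y. (y, JE C u y)) y (chart_vec (sub_atlas \<A> L) (slice_restrict L C) y X) = T C y u (X, 0)"
proof
  fix f
  show "push \<N> (\<lambda>y. (y, JE C u y)) y (chart_vec (sub_atlas \<A> L) (slice_restrict L C) y X) f = T C y u (X, 0) f"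
  proof (cases "smooth_near \<N> (y, JE C u y) f")
    case True
    note N = NC_max[OF C] NC_facts(1)[OF C y, of u]
    let ?k = "\<lambda>a::'e. (a, u)" and ?f = "f \<circ> chart_inv (NC C)" and ?s = "f \<circ> (\<lambda>y. (y, JE C u y))"
    note R = sub.chart_max_atlas[OF slice_restrict_sub_atlas[OF C]]
    have yR: "y \<in> fst (slice_restrict L C)" using y by simp
    have smk: "smooth_on V ?k" if "open V" for V
      by (intro smooth_on_Pair smooth_on_bounded_linear bounded_linear_ident smooth_on_const that)
    have kd: "(?k has_derivative (\<lambda>a. (a, 0))) (at a)" for a
      by (auto intro!: derivative_eq_intros)
    have eq: "?s y' = ?f (?k (snd (slice_restrict L C) y'))" if "y' \<in> fst (slice_restrict L C)" for y'
      using that NC_facts(3)[OF C, of y' u] by simp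
    obtain S where S: "open S" "snd (NC C) (y, JE C u y) \<in> S" "smooth_on S ?f"
      using True nb.smooth_near_iff[OF N] by blast
    have op: "open (?k -` S)" by (rule open_vimage[OF S(1)]) (intro continuous_intros)
    have sm: "smooth_near (sub_atlas \<A> L) y ?s"
    proof (rule sub.smooth_nearI[where S = "?k -` S" and h = "\<lambda>a. ?f (?k a)", OF R yR op _ _ eq])
      show "snd (slice_restrict L C) y \<in> ?k -` S" using S(2) by (simp add: NC_facts(2)[OF C y])
      show "smooth_on (?k -` S) (\<lambda>a. ?f (?k a))"
        by (rule smooth_on_compose[OF op S(1) _ S(3) smk[OF op]]) auto
    qed
    note df = nb.smooth_near_has_derivative[OF N True]
    have "(?f has_derivative \<D> ?f (snd (NC C) (y, JE C u y))) (at (?k (snd (slice_restrict L C) y)))"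
      using df by (metis NC_facts(2)[OF C y] snd_slice_restrict)
    from has_derivative_compose[OF kd this]
    have "(?s \<circ> chart_inv (slice_restrict L C) has_derivative
        (\<lambda>a. \<D> ?f (snd (NC C) (y, JE C u y)) (a, 0))) (at (snd (slice_restrict L C) y))"
    proof (rule has_derivative_transform_within_open[OF _ sub.open_chart_image[OF R]])
      show "snd (slice_restrict L C) y \<in> snd (slice_restrict L C) ` fst (slice_restrict L C)" using yR by blast
      fix a assume a: "a \<in> snd (slice_restrict L C) ` fst (slice_restrict L C)"
      show "?f (?k a) = (?s \<circ> chart_inv (slice_restrict L C)) a"
        using eq[OF chart_inv_mem[OF a]] chart_inv_right[OF a] by (simp del: snd_slice_restrict fst_slice_restrict)
    qed
    from sub.chart_vec_apply[OF R yR sm this, of X] show ?thesis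
      using True nb.chart_vec_apply[OF N True df, of "(X, 0)"] by (simp add: push_def T_def)
  qed (simp add: push_def T_def chart_vec_def)
qed

lemma fibre_vec_T: "fibre_vec \<N> (y, JE C u y) (JE C V y) = T C y u (0, V)"
proof
  fix f
  show "fibre_vec \<N> (y, JE C u y) (JE C V y) f = T C y u (0, V) f"
  proof (cases "smooth_near \<N> (y, JE C u y) f")
    case True
    note N = NC_max[OF C] NC_facts(1)[OF C y, of u]
    let ?k = "\<lambda>t::real. (fst (snd C y), u + t *\<^sub>R V)" and ?f = "f \<circ> chart_inv (NC C)"
    let ?D = "\<D> ?f (snd (NC C) (y, JE C u y))"
    have kd: "(?k has_derivative (\<lambda>t. (0, t *\<^sub>R V))) (at 0)" by (auto intro!: derivative_eq_intros)
    note df = nb.smooth_near_has_derivative[OF N True]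
    then have "(?f has_derivative ?D) (at (?k 0))" by (simp add: NC_facts(2)[OF C y])
    from has_derivative_compose[OF kd this]
    have "((\<lambda>t. ?f (?k t)) has_derivative (\<lambda>t. ?D (t *\<^sub>R (0, V)))) (at 0)" by simp
    then have "((\<lambda>t. ?f (?k t)) has_real_derivative ?D (0, V)) (at 0)"
      unfolding has_field_derivative_def linear_cmul[OF has_derivative_linear[OF df]]
      by (simp add: mult_commute_abs)
    moreover have "?f (?k t) = f (y, JE C u y \<boxplus> t \<bullet>\<^sub>t JE C V y)" for t
      using JE_lin[OF C y(1), of 1 u t V] by (simp add: NC_facts(3)[OF C y] lincomb_simps)
    ultimately have "((\<lambda>t. f (y, JE C u y \<boxplus> t \<bullet>\<^sub>t JE C V y)) has_real_derivative ?D (0, V)) (at 0)" by simp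
    then show ?thesis
      using True nb.chart_vec_apply[OF N True df, of "(0, V)"]
      by (simp add: fibre_vec_def T_def DERIV_imp_deriv)
  qed (simp add: fibre_vec_def T_def chart_vec_def)
qed

lemma z_points: "(y, JE C u y) \<in> points \<N>"
  using NC_facts(1)[OF C y] NC_normal_bundle[OF C] unfolding points_def by blast

text \<open>The axioms determine \<open>K\<close>. On (0, V) it is the canonical isomorphism; on (X,
  0), the velocity of the section \<open>JE C u\<close>, it is the normal connection. As
  \<open>J\<close> is parallel, the ambient derivative of that section is \<open>J\<close> of
  \<open>E C y (\<Gamma> C y X u)\<close>, which is already normal.\<close>

lemma K_T: "K (y, JE C u y) (T C y u (X, V)) = JE C (V + \<Gamma> C y X u) y"
proof -
  note cm = connection_map[unfolded connection_map_def Let_def]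
  have fib: "K (y, JE C u y) (T C y u (0, V)) = JE C V y"
  proof -
    have "JE C V y \<in> nsub (fst (y, JE C u y))" by (simp add: normal_sub_JE[OF C y])
    with cm z_points have "K (y, JE C u y) (fibre_vec \<N> (y, JE C u y) (JE C V y)) = JE C V y" by blast
    then show ?thesis by (simp add: fibre_vec_T)
  qed
  have sec: "normal_section \<A> g L (fst C) (JE C u)"
    using normal_frame_JE[OF C] by (simp add: normal_frame_def)
  define v where "v = chart_vec (sub_atlas \<A> L) (slice_restrict L C) y X"
  have v: "v \<in> tangent (sub_atlas \<A> L) y"
    unfolding v_def by (rule sub.tangent_chart_vec[OF sub.chart_max_atlas[OF slice_restrict_sub_atlas[OF C]]]) (use y in simp)
  have "K (y, JE C u y) (push \<N> (\<lambda>y. (y, JE C u y)) y v) = normal_connection \<A> g nab L y v (JE C u)"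
    using cm sec v y by blast
  moreover have "push \<A> (\<lambda>y. y) y v = E C y X"
    unfolding v_def E_def by (rule push_inclusion[OF C y])
  moreover have "nab y (E C y X) (\<lambda>y. J y (E C y u)) = J y (nab y (E C y X) (\<lambda>y. E C y u))"
    using kaehler E_field[OF C] y(1) E_tangent[OF C y(1)] unfolding kaehler_def by blast
  then have "nab y (E C y X) (JE C u) = JE C (\<Gamma> C y X u) y"
    by (simp add: JE_def[abs_def] nab_E[OF C y])
  ultimately have "K (y, JE C u y) (T C y u (X, 0)) = normal_part \<A> g L y (JE C (\<Gamma> C y X u) y)"
    by (simp add: v_def push_section normal_connection_def)
  also have "\<dots> = JE C (\<Gamma> C y X u) y"
    using normal_part_JE[OF C y, of 0 "\<Gamma> C y X u"] by (simp add: E_zero[OF C y(1)] vadd_zero)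
  finally have hor: "K (y, JE C u y) (T C y u (X, 0)) = JE C (\<Gamma> C y X u) y" .
  have "K (y, JE C u y) (1 \<bullet>\<^sub>t T C y u (X, 0) \<boxplus> 1 \<bullet>\<^sub>t T C y u (0, V)) =
      1 \<bullet>\<^sub>t K (y, JE C u y) (T C y u (X, 0)) \<boxplus> 1 \<bullet>\<^sub>t K (y, JE C u y) (T C y u (0, V))"
    by (rule K_lin[OF z_points T_tangent T_tangent])
  then show ?thesis
    by (simp add: lincomb_simps T_add fib hor JE_add[OF C y(1)] add.commute)
qed

text \<open>By \<open>proj_T\<close> and \<open>K_T\<close> the defining conditions fix the base
  part and then the fibre part, which gives both existence and uniqueness for
  \<open>THE\<close>.\<close>

lemma hlift_T: "hlift \<A> g L K (y, JE C u y) (E C y X) = T C y u (X, - \<Gamma> C y X u)"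
  unfolding hlift_def
proof (rule the_equality)
  show "T C y u (X, - \<Gamma> C y X u) \<in> tangent \<N> (y, JE C u y) \<and>
    K (y, JE C u y) (T C y u (X, - \<Gamma> C y X u)) = vzero \<and>
    proj_push \<A> (y, JE C u y) (T C y u (X, - \<Gamma> C y X u)) = E C y X"
    by (simp add: T_tangent K_T proj_T JE_zero[OF C y(1)])
  fix A assume A: "A \<in> tangent \<N> (y, JE C u y) \<and> K (y, JE C u y) A = vzero \<and> proj_push \<A> (y, JE C u y) A = E C y X"
  then obtain X' V' where X': "A = T C y u (X', V')" using tangent_T by blast
  with A have "E C y X' = E C y X" "JE C (V' + \<Gamma> C y X' u) y = JE C 0 y"
    by (simp_all add: K_T proj_T JE_zero[OF C y(1)])
  then have "X' = X" "V' + \<Gamma> C y X' u = 0" using E_inj[OF C y(1)] JE_inj[OF C y(1)] by blast+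
  then have "X' = X" "V' = - \<Gamma> C y X u" by (auto simp: eq_neg_iff_add_eq_0)
  then show "A = T C y u (X, - \<Gamma> C y X u)" using X' by simp
qed

lemma vlift_T: "vlift \<A> g L K (y, JE C u y) (JE C V y) = T C y u (0, V)"
  unfolding vlift_def
proof (rule the_equality)
  have z: "\<Gamma> C y 0 u = 0" using linear_0[OF linear_\<Gamma>[OF C y]] .
  show "T C y u (0, V) \<in> tangent \<N> (y, JE C u y) \<and>
    proj_push \<A> (y, JE C u y) (T C y u (0, V)) = vzero \<and>
    K (y, JE C u y) (T C y u (0, V)) = JE C V y"
    by (simp add: T_tangent K_T proj_T E_zero[OF C y(1)] z)
  fix A assume A: "A \<in> tangent \<N> (y, JE C u y) \<and> proj_push \<A> (y, JE C u y) A = vzero \<and> K (y, JE C u y) A = JE C V y"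
  then obtain X' V' where X': "A = T C y u (X', V')" using tangent_T by blast
  with A have "E C y X' = E C y 0" "JE C (V' + \<Gamma> C y X' u) y = JE C V y"
    by (simp_all add: K_T proj_T E_zero[OF C y(1)])
  then have "X' = 0" "V' + \<Gamma> C y X' u = V" using E_inj[OF C y(1)] JE_inj[OF C y(1)] by blast+
  then show "A = T C y u (0, V)" using X' z by simp
qed

end

end

section \<open>Exterior derivative of a form built from a function and a one-form\<close>

context atlas
begin

lemma lie_bracket_apply: "smooth_near \<A> x f \<Longrightarrow> lie_bracket \<A> X Y x f = X x (\<lambda>y. Y y f) - Y x (\<lambda>y. X y f)"
  by (simp add: lie_bracket_def)

lemma tangent_lie_bracket_apply:
  assumes v: "v \<in> tangent \<A> x" and X: "smooth_field \<A> W X" and Y: "smooth_field \<A> W Y" and x: "x \<in> W"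
    and f: "smooth_near \<A> x f"
  shows "v (\<lambda>y. lie_bracket \<A> X Y y f) = v (\<lambda>y. X y (\<lambda>y. Y y f)) - v (\<lambda>y. Y y (\<lambda>y. X y f))"
proof -
  obtain V where V: "openin (mtop \<A>) V" "x \<in> V" "\<And>y. y \<in> V \<Longrightarrow> smooth_near \<A> y f"
    using smooth_near_neighbourhood[OF f] by blast
  have "v (\<lambda>y. lie_bracket \<A> X Y y f) = v (\<lambda>y. X y (\<lambda>y. Y y f) - Y y (\<lambda>y. X y f))"
    by (rule tangent_cong[OF v V(1,2)]) (rule lie_bracket_apply[OF V(3)])
  also have "\<dots> = v (\<lambda>y. X y (\<lambda>y. Y y f)) - v (\<lambda>y. Y y (\<lambda>y. X y f))"
    by (rule tangent_diff[OF v smooth_field_apply[OF X x smooth_field_apply[OF Y x f]]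
          smooth_field_apply[OF Y x smooth_field_apply[OF X x f]]])
  finally show ?thesis .
qed

text \<open>Isolating the bracket with (A, C) matches the signs with which the double brackets occur
  in \<open>ext_deriv2\<close>.\<close>

lemma jacobi:
  assumes A: "smooth_field \<A> W A" and B: "smooth_field \<A> W B" and C: "smooth_field \<A> W C" and x: "x \<in> W"
  shows "lie_bracket \<A> (lie_bracket \<A> A C) B x =
    lie_bracket \<A> (lie_bracket \<A> A B) C x \<boxplus> lie_bracket \<A> (lie_bracket \<A> B C) A x"
proof
  fix f
  note t = smooth_field_tangent[OF A x] smooth_field_tangent[OF B x] smooth_field_tangent[OF C x]
  show "lie_bracket \<A> (lie_bracket \<A> A C) B x f =
    (lie_bracket \<A> (lie_bracket \<A> A B) C x \<boxplus> lie_bracket \<A> (lie_bracket \<A> B C) A x) f"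
  proof (cases "smooth_near \<A> x f")
    case True
    note s = smooth_field_apply[OF A x True] smooth_field_apply[OF B x True] smooth_field_apply[OF C x True]
    show ?thesis
      by (simp add: vadd_def lie_bracket_apply True s tangent_lie_bracket_apply[OF t(2) A C x True]
          tangent_lie_bracket_apply[OF t(3) A B x True] tangent_lie_bracket_apply[OF t(1) B C x True])
  qed (simp add: lie_bracket_def vadd_def)
qed

lemma one_form_linear:
  assumes "one_form \<A> \<alpha>" "u \<in> tangent \<A> x" "v \<in> tangent \<A> x"
  shows "\<alpha> x (a \<bullet>\<^sub>t u \<boxplus> b \<bullet>\<^sub>t v) = a * \<alpha> x u + b * \<alpha> x v"
  using assms tangent_points unfolding one_form_def by blast

lemma one_form_smooth:
  assumes "one_form \<A> \<alpha>" "smooth_field \<A> W X" "x \<in> W"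
  shows "smooth_near \<A> x (\<lambda>y. \<alpha> y (X y))"
  using assms unfolding one_form_def by blast

text \<open>For \<open>\<phi> = F(r) (d\<lambda> + c(r) dr \<and> \<lambda>)\<close> one has \<open>d\<phi> = (F'(r) / F(r) - c(r)) dr \<and> \<phi>\<close>; the second-order
  terms cancel by the Jacobi identity.\<close>
lemma ext_deriv2_conformal:
  fixes F c :: "real \<Rightarrow> real"
  assumes l: "one_form \<A> l" and r: "\<And>x. x \<in> points \<A> \<Longrightarrow> smooth_near \<A> x r"
    and T: "open T" "\<And>x. x \<in> points \<A> \<Longrightarrow> r x \<in> T"
    and sm: "smooth_on T F" "smooth_on T c"
    and \<phi>: "\<And>W X Y x. smooth_field \<A> W X \<Longrightarrow> smooth_field \<A> W Y \<Longrightarrow> x \<in> W \<Longrightarrow>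
      \<phi> x (X x) (Y x) = F (r x) * (X x (\<lambda>y. l y (Y y)) - Y x (\<lambda>y. l y (X y)) - l x (lie_bracket \<A> X Y x)
        + c (r x) * (X x r * l x (Y x) - Y x r * l x (X x)))"
    and fields: "smooth_field \<A> W A" "smooth_field \<A> W B" "smooth_field \<A> W C" and x: "x \<in> W"
    and F': "(F has_real_derivative F (r x) * k) (at (r x))"
  shows "ext_deriv2 \<A> \<phi> A B C x = wedge12 (\<lambda>x v. (k - c (r x)) * v r) \<phi> x (A x) (B x) (C x)"
proof -
  have W: "W \<subseteq> points \<A>" and Wo: "openin (mtop \<A>) W"
    using smooth_field_openin[OF fields(1)] by (simp_all add: openin_mtop)
  have xp: "x \<in> points \<A>" using W x by blast
  note rx = r[OF xp]
  obtain c' where c': "(c has_real_derivative c') (at (r x))"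
    using smooth_on_has_derivative[OF sm(2) T(2)[OF xp]] has_derivative_imp_has_field_derivative
      linear_cmul[OF has_derivative_linear]
    by (metis frechet_derivative_works differentiable_def real_differentiable_def)
  \<comment> \<open>\<open>e\<close> is the exterior derivative of \<open>l\<close> and
    \<open>h\<close> the wedge product of dr with \<open>l\<close>, both evaluated on
    fields.\<close>
  define e where "e X Y y = X y (\<lambda>y. l y (Y y)) - Y y (\<lambda>y. l y (X y)) - l y (lie_bracket \<A> X Y y)" for X Y y
  define h where "h X Y y = X y r * l y (Y y) - Y y r * l y (X y)" for X Y y
  have \<phi>': "\<phi> y (X y) (Y y) = F (r y) * (e X Y y + c (r y) * h X Y y)"
    if "smooth_field \<A> W X" "smooth_field \<A> W Y" "y \<in> W" for X Y y
    using \<phi>[OF that] by (simp add: e_def h_def)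
  have Fr: "smooth_near \<A> x (\<lambda>y. F (r y))" by (rule smooth_near_compose[OF rx T(1) T(2)[OF xp] sm(1)])
  have cr: "smooth_near \<A> x (\<lambda>y. c (r y))" by (rule smooth_near_compose[OF rx T(1) T(2)[OF xp] sm(2)])
  have deriv: "Z x (\<lambda>y. \<phi> y (X y) (Y y)) = F (r x) * (k * Z x r * (e X Y x + c (r x) * h X Y x) +
      (Z x (\<lambda>y. X y (\<lambda>y. l y (Y y))) - Z x (\<lambda>y. Y y (\<lambda>y. l y (X y))) - Z x (\<lambda>y. l y (lie_bracket \<A> X Y y))
        + c' * Z x r * h X Y x + c (r x) * (Z x (\<lambda>y. X y r) * l x (Y x) + X x r * Z x (\<lambda>y. l y (Y y))
        - Z x (\<lambda>y. Y y r) * l x (X x) - Y x r * Z x (\<lambda>y. l y (X y)))))"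
    if X: "smooth_field \<A> W X" and Y: "smooth_field \<A> W Y" and Z: "smooth_field \<A> W Z" for X Y Z
  proof -
    note v = smooth_field_tangent[OF Z x]
    note lX = one_form_smooth[OF l X x] and lY = one_form_smooth[OF l Y x]
    note lXY = one_form_smooth[OF l smooth_field_lie_bracket[OF X Y] x]
    note XlY = smooth_field_apply[OF X x lY] and YlX = smooth_field_apply[OF Y x lX]
    note Xr = smooth_field_apply[OF X x rx] and Yr = smooth_field_apply[OF Y x rx]
    have e: "smooth_near \<A> x (e X Y)" "Z x (e X Y) = Z x (\<lambda>y. X y (\<lambda>y. l y (Y y))) - Z x (\<lambda>y. Y y (\<lambda>y. l y (X y))) - Z x (\<lambda>y. l y (lie_bracket \<A> X Y y))"
      unfolding e_def[abs_def]
      by (intro smooth_near_diff XlY YlX lXY) (simp add: tangent_diff[OF v] smooth_near_diff XlY YlX lXY)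
    have h: "smooth_near \<A> x (h X Y)" "Z x (h X Y) = Z x (\<lambda>y. X y r) * l x (Y x) + X x r * Z x (\<lambda>y. l y (Y y))
        - (Z x (\<lambda>y. Y y r) * l x (X x) + Y x r * Z x (\<lambda>y. l y (X y)))"
      unfolding h_def[abs_def]
      by (intro smooth_near_diff smooth_near_mult Xr Yr lX lY)
        (simp add: tangent_diff[OF v smooth_near_mult[OF Xr lY] smooth_near_mult[OF Yr lX]]
          tangent_mult[OF v Xr lY] tangent_mult[OF v Yr lX])
    have ch: "smooth_near \<A> x (\<lambda>y. c (r y) * h X Y y)" by (rule smooth_near_mult[OF cr h(1)])
    have "Z x (\<lambda>y. \<phi> y (X y) (Y y)) = Z x (\<lambda>y. F (r y) * (e X Y y + c (r y) * h X Y y))"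
      by (rule tangent_cong[OF v Wo x]) (rule \<phi>'[OF X Y])
    also have "\<dots> = F (r x) * Z x (\<lambda>y. e X Y y + c (r y) * h X Y y) + Z x (\<lambda>y. F (r y)) * (e X Y x + c (r x) * h X Y x)"
      by (rule tangent_mult[OF v Fr smooth_near_add[OF e(1) ch]])
    also have "Z x (\<lambda>y. e X Y y + c (r y) * h X Y y) = Z x (e X Y) + Z x (\<lambda>y. c (r y) * h X Y y)"
      by (rule tangent_add[OF v e(1) ch])
    also have "Z x (\<lambda>y. c (r y) * h X Y y) = c (r x) * Z x (h X Y) + Z x (\<lambda>y. c (r y)) * h X Y x"
      by (rule tangent_mult[OF v cr h(1)])
    also have "Z x (\<lambda>y. c (r y)) = c' * Z x r"
      by (rule tangent_compose[OF v rx T(1) T(2)[OF xp] sm(2) c'])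
    also have "Z x (\<lambda>y. F (r y)) = F (r x) * k * Z x r"
      by (rule tangent_compose[OF v rx T(1) T(2)[OF xp] sm(1) F'])
    finally show ?thesis unfolding e(2) h(2) by (simp add: algebra_simps)
  qed
  note br = smooth_field_lie_bracket
  have brack: "\<phi> x (lie_bracket \<A> X Y x) (Z x) = F (r x) *
     (X x (\<lambda>y. Y y (\<lambda>y. l y (Z y))) - Y x (\<lambda>y. X y (\<lambda>y. l y (Z y))) - Z x (\<lambda>y. l y (lie_bracket \<A> X Y y))
       - l x (lie_bracket \<A> (lie_bracket \<A> X Y) Z x)
       + c (r x) * ((X x (\<lambda>y. Y y r) - Y x (\<lambda>y. X y r)) * l x (Z x) - Z x r * l x (lie_bracket \<A> X Y x)))"
    if X: "smooth_field \<A> W X" and Y: "smooth_field \<A> W Y" and Z: "smooth_field \<A> W Z" for X Y Z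
    using \<phi>[OF br[OF X Y] Z x] by (simp add: lie_bracket_apply rx one_form_smooth[OF l Z x])
  have jac: "l x (lie_bracket \<A> (lie_bracket \<A> A C) B x) =
      l x (lie_bracket \<A> (lie_bracket \<A> A B) C x) + l x (lie_bracket \<A> (lie_bracket \<A> B C) A x)"
    unfolding jacobi[OF fields x]
    using one_form_linear[OF l smooth_field_tangent[OF br[OF br[OF fields(1,2)] fields(3)] x]
        smooth_field_tangent[OF br[OF br[OF fields(2,3)] fields(1)] x], of 1 1]
    by (simp add: vscale_def)
  \<comment> \<open>After the Jacobi identity the second-order terms in \<open>l\<close> and in
    \<open>r\<close> cancel, and the terms with \<open>c'\<close> add up to dr \<and> dr \<and> l,
    which is 0.\<close>
  show ?thesis
    unfolding ext_deriv2_def wedge12_def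
      deriv[OF fields(2,3,1)] deriv[OF fields(1,3,2)] deriv[OF fields(1,2,3)]
      brack[OF fields(1,3,2)] brack[OF fields(1,2,3)] brack[OF fields(2,3,1)] jac
      \<phi>'[OF fields(2,3) x] \<phi>'[OF fields(1,3) x] \<phi>'[OF fields(1,2) x]
    unfolding e_def h_def by (simp add: algebra_simps)
qed

end

section \<open>The fundamental form\<close>

text \<open>With s = sqrt (1 + q n) one has 1 + q n = s^2, so the two denominators are 1 + s and s
  (1 + s). Everything reduces to q - D s^2 = q / (1 + s) for D = q / (s (1 + s)): the
  \<open>q\<close>-term of the metric, corrected by the term in \<open>Jt_hor\<close>, leaves
  exactly the coefficient occurring in \<open>Jt_vert\<close>.\<close>

lemma fundamental_form_algebra:
  fixes \<omega> p q n :: real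
  assumes \<omega>: "\<omega> > 0" and q: "q \<ge> 0" "n \<ge> 0"
  shows "- (\<omega> powr (p / 2) * (a + q / (1 + sqrt (1 + q * n)) * b * b'))
     + \<omega> powr p * (\<omega> powr (- p / 2) * (d - q * e / (1 + q * n + sqrt (1 + q * n)) * e')
        + q * e' * (\<omega> powr (- p / 2) * (e - q * e / (1 + q * n + sqrt (1 + q * n)) * n)))
    = \<omega> powr (p / 2) * (d - a + q / (1 + sqrt (1 + q * n)) * (e' * e - b * b'))"
proof -
  define s where "s = sqrt (1 + q * n)"
  have s: "s > 0" "1 + q * n = s * s" using q by (simp_all add: s_def add_pos_nonneg)
  have P: "\<omega> powr p * \<omega> powr (- p / 2) = \<omega> powr (p / 2)" by (simp add: powr_add[symmetric])
  define D where "D = q / (s * (1 + s))"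
  have qe: "q * e / (s * s + s) = e * D" by (simp add: D_def algebra_simps)
  have "D * (s * s) = q * s / (1 + s)" using s(1) by (simp add: D_def)
  moreover have "q - q * s / (1 + s) = q / (1 + s)" using s(1) by (simp add: field_simps)
  ultimately have D: "q - D * (s * s) = q / (1 + s)" by simp
  have "- (q * e / (s * s + s) * e') + q * e' * (e - q * e / (s * s + s) * n) = e * e' * (q - D * (1 + q * n))"
    unfolding qe by (simp add: algebra_simps)
  also have "q - D * (1 + q * n) = q / (1 + s)" unfolding s(2) by (rule D)
  finally have *: "- (q * e / (s * s + s) * e') + q * e' * (e - q * e / (s * s + s) * n) = e * e' * (q / (1 + s))" .
  have "\<omega> powr p * (\<omega> powr (- p / 2) * (d - q * e / (s * s + s) * e')
        + q * e' * (\<omega> powr (- p / 2) * (e - q * e / (s * s + s) * n)))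
     = (\<omega> powr p * \<omega> powr (- p / 2)) * (d + (- (q * e / (s * s + s) * e') + q * e' * (e - q * e / (s * s + s) * n)))"
    by (simp add: algebra_simps)
  also have "\<dots> = \<omega> powr (p / 2) * (d + e * e' * (q / (1 + s)))" unfolding P * ..
  finally show ?thesis
    unfolding s_def[symmetric] unfolding s(2) by (simp add: algebra_simps)
qed

context totally_real_geodesic
begin

text \<open>Defined through \<open>K\<close> and thus algebraic in the vector;
  \<open>tangent_sqnorm\<close> identifies it with half the differential of
  \<open>sqnorm g\<close>.\<close>

definition d\<rho> :: "'m \<times> 'm tvec \<Rightarrow> ('m \<times> 'm tvec) tvec \<Rightarrow> real" where
  "d\<rho> z A = g (fst z) (K z A) (snd z)"

text \<open>With \<theta> = J u this pairs the base part of \<open>A\<close> with u: it is the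
  canonical one-form of the cotangent bundle of \<open>L\<close>, transported by the metric and by
  \<open>J\<close>.\<close>

definition lam :: "'m \<times> 'm tvec \<Rightarrow> ('m \<times> 'm tvec) tvec \<Rightarrow> real" where
  "lam z A = g (fst z) (J (fst z) (proj_push \<A> z A)) (snd z)"

text \<open>The exterior derivative of \<open>lam\<close> in pointwise form; the agreement with the
  bracket formula is \<open>dlam_eq\<close>.\<close>

definition dlam :: "'m \<times> 'm tvec \<Rightarrow> ('m \<times> 'm tvec) tvec \<Rightarrow> ('m \<times> 'm tvec) tvec \<Rightarrow> real" where
  "dlam z A B = g (fst z) (K z A) (J (fst z) (proj_push \<A> z B)) - g (fst z) (K z B) (J (fst z) (proj_push \<A> z A))"

definition csq :: "real \<Rightarrow> 'm \<times> 'm tvec \<Rightarrow> real" where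
  "csq q z = q / (1 + sqrt (1 + q * sqnorm g z))"

context
  fixes C y and u :: 'e assumes C: "C \<in> slice_charts \<A> L" and y: "y \<in> fst C" "y \<in> L"
begin

lemma forms_T:
  "sqnorm g (y, JE C u y) = G C y u u"
  "d\<rho> (y, JE C u y) (T C y u (X, V)) = G C y (V + \<Gamma> C y X u) u"
  "lam (y, JE C u y) (T C y u (X, V)) = G C y X u"
  "dlam (y, JE C u y) (T C y u (X, V)) (T C y u (X', V')) =
     G C y (V + \<Gamma> C y X u) X' - G C y (V' + \<Gamma> C y X' u) X"
  by (simp_all add: sqnorm_def d\<rho>_def lam_def dlam_def K_T[OF C y] proj_T[OF C y]
      JE_def[symmetric] G_JE[OF C y(1)])

lemma fundamental_T:
  assumes q: "q \<ge> 0"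
  shows "fundamental_form \<A> g J L K p q (y, JE C u y) (T C y u (X, V)) (T C y u (Y, W)) =
    omega g (y, JE C u y) powr (p / 2) *
     (G C y (V + \<Gamma> C y X u) Y - G C y (W + \<Gamma> C y Y u) X +
      csq q (y, JE C u y) * (G C y (V + \<Gamma> C y X u) u * G C y Y u - G C y (W + \<Gamma> C y Y u) u * G C y X u))"
proof -
  let ?z = "(y, JE C u y)"
  define n where "n = G C y u u"
  define \<omega> where "\<omega> = omega g ?z"
  define \<kappa> where "\<kappa> = W + \<Gamma> C y Y u"
  define \<kappa>' where "\<kappa>' = V + \<Gamma> C y X u"
  \<comment> \<open>\<open>Y'\<close> and \<open>W'\<close> are the coordinates of the projection
    and of the \<open>K\<close> component of the image of the second vector under \<open>Jt\<close>.
    The minus sign comes from J^2 = -1, since \<open>J\<close> is applied to a vector of the frame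
    \<open>JE\<close>.\<close>
  define Y' where "Y' = - (\<omega> powr (p / 2)) *\<^sub>R (\<kappa> + (q / (1 + sqrt (1 + q * n)) * G C y \<kappa> u) *\<^sub>R u)"
  define W' where "W' = (\<omega> powr (- p / 2)) *\<^sub>R (Y - (q * G C y Y u / (1 + q * n + sqrt (1 + q * n))) *\<^sub>R u)"
  have n: "n \<ge> 0" unfolding n_def by (rule G_nonneg[OF C y(1)])
  have \<omega>: "\<omega> > 0" using n by (simp add: \<omega>_def omega_def forms_T n_def)
  have "Jt \<A> g J L K p q ?z (T C y u (Y, W)) = T C y u (Y', W' - \<Gamma> C y Y' u)"
    unfolding Jt_def Jt_vert_def Jt_hor_def Let_def fst_conv snd_conv K_T[OF C y] proj_T[OF C y]
      J_JE[OF C y(1)] G_JE[OF C y(1)] hlift_T[OF C y] JE_def[symmetric] vlift_T[OF C y] forms_T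
      T_scale[OF C y] T_add[OF C y] \<omega>_def[symmetric] \<kappa>_def[symmetric] n_def[symmetric]
    by (simp add: Y'_def W'_def linear_add[OF linear_\<Gamma>[OF C y]] linear_neg[OF linear_\<Gamma>[OF C y]]
        linear_diff[OF linear_\<Gamma>[OF C y]] linear_cmul[OF linear_\<Gamma>[OF C y]] scaleR_diff_right scaleR_add_right)
      (simp add: algebra_simps)
  then have "fundamental_form \<A> g J L K p q ?z (T C y u (X, V)) (T C y u (Y, W)) =
      G C y X Y' + \<omega> powr p * (G C y \<kappa>' W' + q * G C y \<kappa>' u * G C y W' u)"
    by (simp add: fundamental_form_def pq_metric_def Let_def K_T[OF C y] proj_T[OF C y]
        G_JE[OF C y(1)] G_def[symmetric] \<omega>_def \<kappa>'_def)
  also have "\<dots> = - (\<omega> powr (p / 2) * (G C y \<kappa> X + q / (1 + sqrt (1 + q * n)) * G C y \<kappa> u * G C y X u))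
     + \<omega> powr p * (\<omega> powr (- p / 2) * (G C y \<kappa>' Y - q * G C y Y u / (1 + q * n + sqrt (1 + q * n)) * G C y \<kappa>' u)
        + q * G C y \<kappa>' u * (\<omega> powr (- p / 2) * (G C y Y u - q * G C y Y u / (1 + q * n + sqrt (1 + q * n)) * n)))"
    by (simp add: Y'_def W'_def G_simps[OF C y(1)] n_def[symmetric] G_sym[OF C y(1), of X \<kappa>])
  also have "\<dots> = \<omega> powr (p / 2) * (G C y \<kappa>' Y - G C y \<kappa> X +
      q / (1 + sqrt (1 + q * n)) * (G C y \<kappa>' u * G C y Y u - G C y \<kappa> u * G C y X u))"
    by (rule fundamental_form_algebra[OF \<omega> q n])
  finally show ?thesis by (simp add: \<omega>_def \<kappa>_def \<kappa>'_def csq_def forms_T n_def)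
qed

end

lemma fundamental_form_eq:
  assumes q: "q \<ge> 0" and A: "A \<in> tangent \<N> z" and B: "B \<in> tangent \<N> z"
  shows "fundamental_form \<A> g J L K p q z A B =
    omega g z powr (p / 2) * (dlam z A B + csq q z * (d\<rho> z A * lam z B - d\<rho> z B * lam z A))"
proof -
  obtain C y u where C: "C \<in> slice_charts \<A> L" and y: "y \<in> fst C" "y \<in> L" and z: "z = (y, JE C u y)"
    using points_normal_bundle[OF nb.tangent_points[OF A]] .
  obtain X V where A: "A = T C y u (X, V)" using A[unfolded z] by (rule tangent_T[OF C y])
  obtain Y W where B: "B = T C y u (Y, W)" using B[unfolded z] by (rule tangent_T[OF C y])
  show ?thesis unfolding z A B by (simp add: fundamental_T[OF C y q] forms_T[OF C y])
qed

section \<open>The squared norm and the canonical one-form in bundle charts\<close>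

lemma sqnorm_nonneg:
  assumes "z \<in> points \<N>"
  shows "sqnorm g z \<ge> 0"
proof -
  obtain C y u where C: "C \<in> slice_charts \<A> L" and y: "y \<in> fst C" "y \<in> L" and z: "z = (y, JE C u y)"
    using points_normal_bundle[OF assms] .
  show ?thesis unfolding z forms_T[OF C y] by (rule G_nonneg[OF C y(1)])
qed

context
  fixes C assumes C: "C \<in> slice_charts \<A> L"
begin

lemma NC_cases:
  assumes "z \<in> fst (NC C)"
  obtains y u where "y \<in> fst C" "y \<in> L" "z = (y, JE C u y)" "snd (NC C) z = (fst (snd C y), u)"
proof -
  obtain y \<theta> where y: "y \<in> fst C" "y \<in> L" "z = (y, \<theta>)" "\<theta> \<in> nsub y"
    using assms by (auto simp: fst_bchart)
  then obtain u where "z = (y, JE C u y)" using normal_sub_JE[OF C y(1,2)] by blast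
  then show ?thesis using that[OF y(1,2)] NC_facts(2)[OF C y(1,2)] by simp
qed

lemma open_U_times: "open (U C \<times> (UNIV :: 'e set))"
  using open_U[OF C] by (simp add: open_Times)

lemma sqnorm_chart: "z \<in> fst (NC C) \<Longrightarrow> sqnorm g z = Gh C (fst (snd (NC C) z)) (snd (snd (NC C) z)) (snd (snd (NC C) z))"
  by (erule NC_cases) (simp add: forms_T[OF C] Gh_eq[OF C])

lemma sqnorm_smooth_chart: "smooth_on (U C \<times> UNIV) (\<lambda>w. Gh C (fst w) (snd w) (snd w))"
  by (rule Gh_smooth_compose[OF C open_U_times _ smooth_on_bounded_linear[OF open_U_times bounded_linear_fst]
        smooth_on_bounded_linear[OF open_U_times bounded_linear_snd]
        smooth_on_bounded_linear[OF open_U_times bounded_linear_snd]]) auto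

lemma sqnorm_smooth_near_chart:
  assumes "z \<in> fst (NC C)"
  shows "smooth_near \<N> z (sqnorm g)"
  by (rule nb.smooth_nearI[OF NC_max[OF C] assms open_U_times _ sqnorm_smooth_chart sqnorm_chart])
    (use assms NC_image[OF C] in blast)

lemma field_coord:
  assumes B: "smooth_field \<N> W B" and z: "z \<in> W" "z \<in> fst (NC C)" "z = (y, JE C u y)"
  shows "B z = T C y u (vec_coord (NC C) (B z))"
  using nb.chart_vec_vec_coord[OF NC_max[OF C] z(2) nb.smooth_field_tangent[OF B z(1)]] z(3) by (simp add: T_def)

context
  fixes W B assumes B: "smooth_field \<N> W B"
begin

abbreviation (input) "Bc w \<equiv> vec_coord (NC C) (B (chart_inv (NC C) w))"
abbreviation (input) "WC \<equiv> snd (NC C) ` (W \<inter> fst (NC C))"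

lemma lam_field_chart:
  assumes "z \<in> W" "z \<in> fst (NC C)"
  shows "lam z (B z) = Gh C (fst (snd (NC C) z)) (fst (Bc (snd (NC C) z))) (snd (snd (NC C) z))"
proof -
  obtain y u where y: "y \<in> fst C" "y \<in> L" and z: "z = (y, JE C u y)" "snd (NC C) z = (fst (snd C y), u)"
    using NC_cases[OF assms(2)] .
  have "chart_inv (NC C) (snd (NC C) z) = z" by (rule nb.inv_left[OF NC_max[OF C] assms(2)])
  moreover have "lam z (B z) = G C y (fst (vec_coord (NC C) (B z))) u"
    using field_coord[OF B assms z(1)] forms_T(3)[OF C y, of u "fst (vec_coord (NC C) (B z))" "snd (vec_coord (NC C) (B z))"] z(1)
    by simp
  ultimately show ?thesis by (simp add: z(2) Gh_eq[OF C y])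
qed

lemma field_coord_smooth: "open WC" "smooth_on WC Bc" "WC \<subseteq> U C \<times> UNIV"
  using nb.open_image_openin[OF NC_max[OF C] nb.smooth_field_openin[OF B]]
    nb.smooth_field_coord[OF B NC_max[OF C]] NC_image[OF C] by blast+

lemma lam_field_smooth_chart: "smooth_on WC (\<lambda>w. Gh C (fst w) (fst (Bc w)) (snd w))"
  using field_coord_smooth
  by (intro Gh_smooth_compose[OF C] smooth_on_bounded_linear[OF _ bounded_linear_fst]
      smooth_on_bounded_linear[OF _ bounded_linear_snd] smooth_on_bounded_linear_comp[OF _ bounded_linear_fst]) auto

lemma lam_field_smooth_near:
  assumes "z \<in> W" "z \<in> fst (NC C)"
  shows "smooth_near \<N> z (\<lambda>z. lam z (B z))"
proof (rule nb.smooth_nearI[OF NC_max[OF C] assms(2) field_coord_smooth(1) _ lam_field_smooth_chart])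
  show "snd (NC C) z \<in> WC" using assms by blast
  fix z' assume z': "z' \<in> fst (NC C)" "snd (NC C) z' \<in> WC"
  then have "z' \<in> W" using inj_onD[OF nb.max_atlas_inj[OF NC_max[OF C]]] by blast
  then show "lam z' (B z') = Gh C (fst (snd (NC C) z')) (fst (Bc (snd (NC C) z'))) (snd (snd (NC C) z'))"
    by (rule lam_field_chart[OF _ z'(1)])
qed

text \<open>The first two terms differentiate the metric, the third the coefficients of
  \<open>B\<close>, the fourth the fibre coordinate.\<close>

lemma lam_field_derivative:
  assumes z: "z \<in> W" "z \<in> fst (NC C)" and y: "y \<in> fst C" "y \<in> L" "z = (y, JE C u y)"
  shows "T C y u (X, V) (\<lambda>z. lam z (B z)) =
    G C y (\<Gamma> C y X (fst (vec_coord (NC C) (B z)))) u + G C y (fst (vec_coord (NC C) (B z))) (\<Gamma> C y X u)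
    + G C y (fst (\<D> Bc (snd (NC C) z) (X, V))) u + G C y (fst (vec_coord (NC C) (B z))) V"
proof -
  let ?w = "snd (NC C) z"
  have w1: "?w \<in> WC" using z by blast
  have w2: "?w = (fst (snd C y), u)" by (simp add: y(3) NC_facts(2)[OF C y(1,2)])
  note w = w1 w2
  have inv: "chart_inv (NC C) ?w = z" by (rule nb.inv_left[OF NC_max[OF C] z(2)])
  note dB = smooth_on_has_derivative[OF field_coord_smooth(2) w(1)]
  have "((\<lambda>w. Gh C (fst w) (fst (Bc w)) (snd w)) has_derivative (\<lambda>h.
    G C y (\<Gamma> C y (fst h) (fst (Bc ?w))) (snd ?w) + G C y (fst (Bc ?w)) (\<Gamma> C y (fst h) (snd ?w)) +
    G C y (fst (\<D> Bc ?w h)) (snd ?w) + G C y (fst (Bc ?w)) (snd h))) (at ?w)"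
    by (rule Gh_compose_has_derivative[OF C field_coord_smooth(1) _ w(1) y(1,2) _
          bounded_linear_imp_has_derivative[OF bounded_linear_fst] has_derivative_fst[OF dB]
          bounded_linear_imp_has_derivative[OF bounded_linear_snd]])
      (use field_coord_smooth(3) w(2) in auto)
  then have "((\<lambda>z. lam z (B z)) \<circ> chart_inv (NC C) has_derivative (\<lambda>h.
    G C y (\<Gamma> C y (fst h) (fst (Bc ?w))) (snd ?w) + G C y (fst (Bc ?w)) (\<Gamma> C y (fst h) (snd ?w)) +
    G C y (fst (\<D> Bc ?w h)) (snd ?w) + G C y (fst (Bc ?w)) (snd h))) (at ?w)"
  proof (rule has_derivative_transform_within_open[OF _ field_coord_smooth(1) w(1)])
    fix w' assume "w' \<in> WC"
    then obtain z' where z': "z' \<in> W" "z' \<in> fst (NC C)" "w' = snd (NC C) z'" by blast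
    then show "Gh C (fst w') (fst (Bc w')) (snd w') = ((\<lambda>z. lam z (B z)) \<circ> chart_inv (NC C)) w'"
      using lam_field_chart[OF z'(1,2)] nb.inv_left[OF NC_max[OF C] z'(2)] by simp
  qed
  from nb.chart_vec_apply[OF NC_max[OF C] z(2) lam_field_smooth_near[OF z] this, of "(X, V)"]
  show ?thesis using w(2) inv y(3) by (simp add: T_def)
qed

end

end

lemma sqnorm_smooth_near:
  assumes "z \<in> points \<N>"
  shows "smooth_near \<N> z (sqnorm g)"
proof -
  obtain C y u where C: "C \<in> slice_charts \<A> L" and y: "y \<in> fst C" "y \<in> L" and z: "z = (y, JE C u y)"
    using points_normal_bundle[OF assms] .
  show ?thesis unfolding z by (rule sqnorm_smooth_near_chart[OF C NC_facts(1)[OF C y]])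
qed

text \<open>In G(u, u), metric compatibility contributes \<Gamma>(X, u) and the fibre velocity
  contributes V, each twice; their sum is the \<open>K\<close> component.\<close>

lemma tangent_sqnorm:
  assumes A: "A \<in> tangent \<N> z"
  shows "A (sqnorm g) = 2 * d\<rho> z A"
proof -
  obtain C y u where C: "C \<in> slice_charts \<A> L" and y: "y \<in> fst C" "y \<in> L" and z: "z = (y, JE C u y)"
    using points_normal_bundle[OF nb.tangent_points[OF A]] .
  obtain X V where A: "A = T C y u (X, V)" using A[unfolded z] by (rule tangent_T[OF C y])
  note zN = NC_facts(1,2)[OF C y, of u]
  let ?w = "snd (NC C) z"
  have w: "?w \<in> U C \<times> UNIV" "?w = (fst (snd C y), u)" using zN NC_image[OF C] z by (blast, simp)
  have "((\<lambda>w. Gh C (fst w) (snd w) (snd w)) has_derivative (\<lambda>h.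
    G C y (\<Gamma> C y (fst h) (snd ?w)) (snd ?w) + G C y (snd ?w) (\<Gamma> C y (fst h) (snd ?w)) +
    G C y (snd h) (snd ?w) + G C y (snd ?w) (snd h))) (at ?w)"
    by (rule Gh_compose_has_derivative[OF C open_U_times[OF C] _ w(1) y])
      (use w(2) in \<open>auto intro: bounded_linear_imp_has_derivative bounded_linear_fst bounded_linear_snd\<close>)
  then have "(sqnorm g \<circ> chart_inv (NC C) has_derivative (\<lambda>h.
    G C y (\<Gamma> C y (fst h) (snd ?w)) (snd ?w) + G C y (snd ?w) (\<Gamma> C y (fst h) (snd ?w)) +
    G C y (snd h) (snd ?w) + G C y (snd ?w) (snd h))) (at ?w)"
  proof (rule has_derivative_transform_within_open[OF _ open_U_times[OF C] w(1)])
    fix w' assume "w' \<in> U C \<times> (UNIV :: 'e set)"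
    then obtain z' where z': "z' \<in> fst (NC C)" "w' = snd (NC C) z'" using NC_image[OF C] by blast
    then show "Gh C (fst w') (snd w') (snd w') = (sqnorm g \<circ> chart_inv (NC C)) w'"
      using sqnorm_chart[OF C z'(1)] nb.inv_left[OF NC_max[OF C] z'(1)] by simp
  qed
  from nb.chart_vec_apply[OF NC_max[OF C] zN(1) sqnorm_smooth_near_chart[OF C zN(1)] this[unfolded z], of "(X, V)"]
  show ?thesis
    unfolding A z forms_T[OF C y] by (simp add: T_def zN(2) G_simps[OF C y(1)] G_sym[OF C y(1), of u])
qed

lemma lam_linear:
  assumes A: "A \<in> tangent \<N> z" and B: "B \<in> tangent \<N> z"
  shows "lam z (a \<bullet>\<^sub>t A \<boxplus> b \<bullet>\<^sub>t B) = a * lam z A + b * lam z B"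
    and "d\<rho> z (a \<bullet>\<^sub>t A \<boxplus> b \<bullet>\<^sub>t B) = a * d\<rho> z A + b * d\<rho> z B"
proof -
  obtain C y u where C: "C \<in> slice_charts \<A> L" and y: "y \<in> fst C" "y \<in> L" and z: "z = (y, JE C u y)"
    using points_normal_bundle[OF nb.tangent_points[OF A]] .
  obtain X V where A: "A = T C y u (X, V)" using A[unfolded z] by (rule tangent_T[OF C y])
  obtain Y W where B: "B = T C y u (Y, W)" using B[unfolded z] by (rule tangent_T[OF C y])
  have eq: "a \<bullet>\<^sub>t A \<boxplus> b \<bullet>\<^sub>t B = T C y u (a *\<^sub>R X + b *\<^sub>R Y, a *\<^sub>R V + b *\<^sub>R W)"
    unfolding A B using T_lin[OF C y, of u a "(X, V)" b "(Y, W)"] by simp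
  show "lam z (a \<bullet>\<^sub>t A \<boxplus> b \<bullet>\<^sub>t B) = a * lam z A + b * lam z B"
    and "d\<rho> z (a \<bullet>\<^sub>t A \<boxplus> b \<bullet>\<^sub>t B) = a * d\<rho> z A + b * d\<rho> z B"
    unfolding eq unfolding A B z
    by (simp_all add: forms_T[OF C y] G_simps[OF C y(1)] \<Gamma>_lin[OF C y] distrib_left)
qed

lemma one_form_lam: "one_form \<N> lam"
  unfolding one_form_def
proof (intro conjI ballI allI impI)
  fix W X z assume X: "smooth_field \<N> W X" and z: "z \<in> W"
  have "z \<in> points \<N>" using nb.smooth_field_openin[OF X] nb.openin_mtop z by blast
  then obtain C y u where C: "C \<in> slice_charts \<A> L" and y: "y \<in> fst C" "y \<in> L" and z': "z = (y, JE C u y)"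
    by (rule points_normal_bundle)
  show "smooth_near \<N> z (\<lambda>y. lam y (X y))"
    by (rule lam_field_smooth_near[OF C X z]) (simp add: z' NC_facts(1)[OF C y])
qed (rule lam_linear)

text \<open>In bundle coordinates the bracket absorbs the derivatives of the coefficients, the terms
  with \<Gamma>(X, X') cancel by symmetry, and the rest assembles into \<open>K\<close>
  components.\<close>

lemma dlam_eq:
  assumes A: "smooth_field \<N> W A" and B: "smooth_field \<N> W B" and zW: "z \<in> W"
  shows "A z (\<lambda>z. lam z (B z)) - B z (\<lambda>z. lam z (A z)) - lam z (lie_bracket \<N> A B z) = dlam z (A z) (B z)"
proof -
  have "z \<in> points \<N>" using nb.smooth_field_openin[OF A] nb.openin_mtop zW by blast
  then obtain C y u where C: "C \<in> slice_charts \<A> L" and y: "y \<in> fst C" "y \<in> L" and z: "z = (y, JE C u y)"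
    by (rule points_normal_bundle)
  have zN: "z \<in> fst (NC C)" by (simp add: z NC_facts(1)[OF C y])
  obtain X V where XV: "vec_coord (NC C) (A z) = (X, V)" by fastforce
  obtain X' V' where XV': "vec_coord (NC C) (B z) = (X', V')" by fastforce
  have Az: "A z = T C y u (X, V)" using field_coord[OF C A zW zN z] by (simp add: XV)
  have Bz: "B z = T C y u (X', V')" using field_coord[OF C B zW zN z] by (simp add: XV')
  let ?dA = "\<D> (\<lambda>w. vec_coord (NC C) (A (chart_inv (NC C) w))) (snd (NC C) z)"
  let ?dB = "\<D> (\<lambda>w. vec_coord (NC C) (B (chart_inv (NC C) w))) (snd (NC C) z)"
  have lb: "lie_bracket \<N> A B z = T C y u (?dB (X, V) - ?dA (X', V'))"
    using nb.lie_bracket_coord[OF A B NC_max[OF C] zW zN] by (simp only: XV XV' T_def z[symmetric])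
  have lamw: "lam z (T C y u w) = G C y (fst w) u" for w
    by (cases w) (simp add: z forms_T(3)[OF C y])
  have "lam z (lie_bracket \<N> A B z) = G C y (fst (?dB (X, V)) - fst (?dA (X', V'))) u"
    unfolding lb lamw by simp
  moreover have "A z (\<lambda>z. lam z (B z)) = G C y (\<Gamma> C y X X') u + G C y X' (\<Gamma> C y X u) + G C y (fst (?dB (X, V))) u + G C y X' V"
    unfolding Az using lam_field_derivative[OF C B zW zN y z, of X V] by (simp add: XV')
  moreover have "B z (\<lambda>z. lam z (A z)) = G C y (\<Gamma> C y X' X) u + G C y X (\<Gamma> C y X' u) + G C y (fst (?dA (X', V'))) u + G C y X V'"
    unfolding Bz using lam_field_derivative[OF C A zW zN y z, of X' V'] by (simp add: XV)
  moreover have "dlam z (A z) (B z) = G C y (V + \<Gamma> C y X u) X' - G C y (V' + \<Gamma> C y X' u) X"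
    unfolding Az Bz unfolding z by (rule forms_T(4)[OF C y])
  ultimately show ?thesis
    by (simp add: G_simps[OF C y(1)] \<Gamma>_sym[OF C y, of X' X] G_sym[OF C y(1), of _ X'] G_sym[OF C y(1), of _ X])
qed

end

section \<open>The Lee form\<close>

text \<open>An open set that contains all r \<ge> 0 when q \<ge> 0, hence all values of
  \<open>sqnorm g\<close>; smoothness of the two functions below requires an open domain.\<close>

definition conf_dom :: "real \<Rightarrow> real set" where
  "conf_dom q = {r. 0 < 1 + r \<and> 0 < 1 + q * r}"

text \<open>\<open>conf_F\<close> and \<open>conf_c\<close> are
  \<open>omega g z powr (p / 2)\<close> and \<open>csq q z\<close> as functions of the squared
  norm.\<close>

definition conf_F :: "real \<Rightarrow> real \<Rightarrow> real" where
  "conf_F p r = (1 + r) powr (- (p / 2))"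

definition conf_c :: "real \<Rightarrow> real \<Rightarrow> real" where
  "conf_c q r = q / (1 + sqrt (1 + q * r))"

lemma open_conf_dom: "open (conf_dom q)"
  unfolding conf_dom_def by (intro open_Collect_conj open_Collect_less continuous_intros)

lemma smooth_on_affine_powr:
  fixes a :: real
  assumes "open S" "\<And>r. r \<in> S \<Longrightarrow> 0 < 1 + a * r"
  shows "smooth_on S (\<lambda>r. (1 + a * r) powr b)"
proof (rule smooth_on_compose[OF assms(1) _ _ smooth_on_powr])
  show "smooth_on S (\<lambda>r. 1 + a * r)"
    by (intro smooth_on_add smooth_on_const smooth_on_bounded_linear bounded_linear_mult_right assms(1))
qed (use assms(2) in auto)

lemma smooth_on_conf_F: "smooth_on (conf_dom q) (conf_F p)"
  using smooth_on_affine_powr[OF open_conf_dom, of q 1 "- (p / 2)"]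
  by (simp add: conf_dom_def conf_F_def[abs_def])

lemma smooth_on_conf_c: "smooth_on (conf_dom q) (conf_c q)"
proof (rule smooth_on_transform[OF open_conf_dom])
  \<comment> \<open>Root and reciprocal are both written as powers, so that
    \<open>smooth_on_powr\<close> covers them.\<close>
  show "smooth_on (conf_dom q) (\<lambda>r. q * (1 + (1 + q * r) powr (1 / 2)) powr (- 1))"
  proof (intro smooth_on_mult smooth_on_const open_conf_dom)
    show "smooth_on (conf_dom q) (\<lambda>r. (1 + (1 + q * r) powr (1 / 2)) powr (- 1))"
    proof (rule smooth_on_compose[OF open_conf_dom _ _ smooth_on_powr])
      show "smooth_on (conf_dom q) (\<lambda>r. 1 + (1 + q * r) powr (1 / 2))"
        by (intro smooth_on_add smooth_on_const open_conf_dom smooth_on_affine_powr) (simp add: conf_dom_def)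
    qed (auto simp: conf_dom_def add_pos_nonneg)
  qed
  fix r assume "r \<in> conf_dom q"
  then have "0 < 1 + q * r" by (simp add: conf_dom_def)
  moreover from this have "0 < 1 + sqrt (1 + q * r)" by (simp add: add_pos_nonneg)
  ultimately show "q * (1 + (1 + q * r) powr (1 / 2)) powr (- 1) = conf_c q r"
    by (simp add: conf_c_def powr_half_sqrt powr_minus_divide)
qed

text \<open>The derivative is expressed as \<open>conf_F\<close> times its logarithmic derivative,
  the shape required by \<open>ext_deriv2_conformal\<close>.\<close>

lemma conf_F_derivative:
  assumes "0 < 1 + r"
  shows "(conf_F p has_real_derivative conf_F p r * (- (p / (2 * (1 + r))))) (at r)"
proof -
  have "((\<lambda>r. (1 + r) powr (- (p / 2))) has_real_derivative - (p / 2) * (1 + r) powr (- (p / 2) - 1) * 1) (at r)"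
    by (rule DERIV_chain2[OF has_real_derivative_powr]) (use assms in \<open>auto intro!: derivative_eq_intros\<close>)
  then show ?thesis
    using assms by (simp add: conf_F_def[abs_def] powr_diff mult.commute)
qed

text \<open>In terms of \<open>m = \<surd>(1 + q r)\<close> the equation expresses \<open>p\<close> by \<open>m\<close>; three values of \<open>m\<close> already
  contradict each other when \<open>q > 0\<close>.\<close>
lemma lee_coefficient_zero:
  fixes p q :: real
  assumes q: "q \<ge> 0" and eq: "\<And>r. r > 0 \<Longrightarrow> p / (1 + r) + q / (1 + sqrt (1 + q * r)) = 0"
  shows "p = 0 \<and> q = 0"
proof (cases "q = 0")
  case True
  then show ?thesis using eq[of 1] by simp
next
  case False
  then have q: "q > 0" using q by simp
  have val: "- p = (q + (m * m - 1)) / (1 + m)" if "m > 1" for m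
  proof -
    define r where "r = (m * m - 1) / q"
    have "m * m > 1 * 1" using that by (intro mult_strict_mono) auto
    then have r: "r > 0" "1 + q * r = m * m" using q by (simp_all add: r_def)
    then have "p / (1 + r) = - (q / (1 + m))" using eq[of r] that by simp
    then have "- p = q / (1 + m) * (1 + r)" using r(1) by (simp add: field_simps)
    also have "\<dots> = (q + q * r) / (1 + m)" by (simp add: algebra_simps)
    finally show ?thesis using r(2) by simp
  qed
  \<comment> \<open>The values at m = 2 and m = 3 force q = 12, those at m = 3 and m = 4 force q =
    20.\<close>
  from val[of 2] val[of 3] val[of 4] have False by simp
  then show ?thesis ..
qed

lemma DIM_ge_2_Basis:
  assumes "DIM('e::euclidean_space) \<ge> 2"
  obtains b b' :: "'e::euclidean_space" where "b \<in> Basis" "b' \<in> Basis" "b \<noteq> b'"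
proof -
  obtain b :: 'e where b: "b \<in> Basis" using nonempty_Basis by blast
  have "\<not> Basis \<subseteq> {b}"
  proof
    assume "(Basis :: 'e set) \<subseteq> {b}"
    then have "DIM('e) \<le> 1" using card_mono[of "{b}" "Basis :: 'e set"] by simp
    then show False using assms by simp
  qed
  then show ?thesis using that b by blast
qed

section \<open>Exterior derivative of the fundamental form\<close>

context totally_real_geodesic
begin

abbreviation "\<Phi> p q \<equiv> fundamental_form \<A> g J L K p q"

definition lee :: "real \<Rightarrow> real \<Rightarrow> 'm \<times> 'm tvec \<Rightarrow> ('m \<times> 'm tvec) tvec \<Rightarrow> real" where
  "lee p q z A = - (p * omega g z + csq q z) * d\<rho> z A"

lemma sqnorm_conf_dom: "q \<ge> 0 \<Longrightarrow> z \<in> points \<N> \<Longrightarrow> sqnorm g z \<in> conf_dom q"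
  using sqnorm_nonneg[of z] by (simp add: conf_dom_def add_pos_nonneg)

lemma omega_powr: "z \<in> points \<N> \<Longrightarrow> omega g z powr (p / 2) = conf_F p (sqnorm g z)"
  using sqnorm_nonneg[of z] by (simp add: omega_def conf_F_def powr_minus powr_divide inverse_eq_divide)

text \<open>Passing from \<rho> to \<open>sqnorm g\<close>, which is 2 \<rho>, halves both
  coefficients and turns \<open>K\<close> into the differential of a function.\<close>

lemma lee_eq:
  assumes "A \<in> tangent \<N> z"
  shows "lee p q z A = (- (p / (2 * (1 + sqnorm g z))) - conf_c q (sqnorm g z) / 2) * A (sqnorm g)"
proof -
  have "- (p * (1 / a) + q / b) * d = (- (p / (2 * a)) - q / b / 2) * (2 * d)" for a b d :: real
    by (simp add: algebra_simps)
  then show ?thesis unfolding tangent_sqnorm[OF assms] lee_def omega_def csq_def conf_c_def .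
qed

lemma fundamental_form_fields:
  assumes q: "q \<ge> 0" and X: "smooth_field \<N> W X" and Y: "smooth_field \<N> W Y" and z: "z \<in> W"
  shows "\<Phi> p q z (X z) (Y z) = conf_F p (sqnorm g z) *
    (X z (\<lambda>y. lam y (Y y)) - Y z (\<lambda>y. lam y (X y)) - lam z (lie_bracket \<N> X Y z)
      + conf_c q (sqnorm g z) / 2 * (X z (sqnorm g) * lam z (Y z) - Y z (sqnorm g) * lam z (X z)))"
proof -
  note t = nb.smooth_field_tangent[OF X z] nb.smooth_field_tangent[OF Y z]
  have eq: "f * (e + b * (x * l - x' * l')) = f * (e + b / 2 * (2 * x * l - 2 * x' * l'))" for f e b x l x' l' :: real
    by (simp add: algebra_simps)
  show ?thesis
    unfolding fundamental_form_eq[OF q t] dlam_eq[OF X Y z] omega_powr[OF nb.tangent_points[OF t(1)]]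
      tangent_sqnorm[OF t(1)] tangent_sqnorm[OF t(2)] csq_def conf_c_def
    by (rule eq)
qed

lemma ext_deriv2_fundamental_form:
  assumes q: "q \<ge> 0" and fields: "smooth_field \<N> W A" "smooth_field \<N> W B" "smooth_field \<N> W C" and z: "z \<in> W"
  shows "ext_deriv2 \<N> (\<Phi> p q) A B C z =
    wedge12 (lee p q) (\<Phi> p q) z (A z) (B z) (C z)"
proof -
  have zp: "z \<in> points \<N>" using nb.tangent_points[OF nb.smooth_field_tangent[OF fields(1) z]] .
  have sm: "smooth_on (conf_dom q) (\<lambda>r. conf_c q r / 2)"
    using smooth_on_bounded_linear_comp[OF open_conf_dom bounded_linear_divide smooth_on_conf_c] .
  have "ext_deriv2 \<N> (\<Phi> p q) A B C z =
    wedge12 (\<lambda>x v. (- (p / (2 * (1 + sqnorm g z))) - conf_c q (sqnorm g x) / 2) * v (sqnorm g))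
      (\<Phi> p q) z (A z) (B z) (C z)"
    by (rule nb.ext_deriv2_conformal[where F = "conf_F p" and T = "conf_dom q" and c = "\<lambda>r. conf_c q r / 2" and l = lam,
          OF one_form_lam sqnorm_smooth_near open_conf_dom sqnorm_conf_dom[OF q] smooth_on_conf_F sm
          fundamental_form_fields[OF q] fields z conf_F_derivative])
      (use sqnorm_nonneg[OF zp] in auto)
  then show ?thesis
    by (simp add: wedge12_def lee_eq nb.smooth_field_tangent[OF fields(1) z]
        nb.smooth_field_tangent[OF fields(2) z] nb.smooth_field_tangent[OF fields(3) z])
qed

lemma lift_decomp:
  assumes A: "A \<in> tangent \<N> z"
  obtains X \<xi> where "X \<in> tangent_sub \<A> L (fst z)" "\<xi> \<in> nsub (fst z)"
    "A = hlift \<A> g L K z X \<boxplus> vlift \<A> g L K z \<xi>" "\<xi> = K z A"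
    "hlift \<A> g L K z X \<in> tangent \<N> z" "vlift \<A> g L K z \<xi> \<in> tangent \<N> z"
proof -
  obtain C y u where C: "C \<in> slice_charts \<A> L" and y: "y \<in> fst C" "y \<in> L" and z: "z = (y, JE C u y)"
    using points_normal_bundle[OF nb.tangent_points[OF A]] .
  obtain X V where A: "A = T C y u (X, V)" using A[unfolded z] by (rule tangent_T[OF C y])
  show ?thesis
  proof (rule that[of "E C y X" "JE C (V + \<Gamma> C y X u) y"])
    show "E C y X \<in> tangent_sub \<A> L (fst z)" by (simp add: z tangent_sub_E[OF C y])
    show "JE C (V + \<Gamma> C y X u) y \<in> nsub (fst z)" by (simp add: z normal_sub_JE[OF C y])
    show "A = hlift \<A> g L K z (E C y X) \<boxplus> vlift \<A> g L K z (JE C (V + \<Gamma> C y X u) y)"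
      by (simp add: A z hlift_T[OF C y] vlift_T[OF C y] T_add[OF C y])
    show "JE C (V + \<Gamma> C y X u) y = K z A" by (simp add: A z K_T[OF C y])
  qed (simp_all add: z hlift_T[OF C y] vlift_T[OF C y] T_tangent[OF C y])
qed

text \<open>Uniqueness: every tangent vector is the sum of a horizontal and a vertical lift, so
  linearity and the prescribed values determine the form.\<close>

lemma lee_form_eq:
  assumes \<alpha>: "lee_form \<A> g L K p q \<alpha>" and A: "A \<in> tangent \<N> z"
  shows "\<alpha> z A = lee p q z A"
proof -
  obtain X \<xi> where X: "X \<in> tangent_sub \<A> L (fst z)" and \<xi>: "\<xi> \<in> nsub (fst z)"
    and dec: "A = hlift \<A> g L K z X \<boxplus> vlift \<A> g L K z \<xi>" "\<xi> = K z A"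
      "hlift \<A> g L K z X \<in> tangent \<N> z" "vlift \<A> g L K z \<xi> \<in> tangent \<N> z"
    using lift_decomp[OF A] .
  have one: "one_form \<N> \<alpha>" using \<alpha> by (simp add: lee_form_def)
  have "\<alpha> z A = \<alpha> z (hlift \<A> g L K z X) + \<alpha> z (vlift \<A> g L K z \<xi>)"
    using nb.one_form_linear[OF one dec(3,4), of 1 1] dec(1) by (simp add: lincomb_simps)
  also have "\<dots> = lee p q z A"
    using \<alpha> nb.tangent_points[OF A] X \<xi> by (simp add: lee_form_def lee_def d\<rho>_def csq_def dec(2)[symmetric])
  finally show ?thesis .
qed

text \<open>Smoothness comes from \<open>lee_eq\<close>: along a field the form is a smooth function
  of \<open>sqnorm g\<close> times the derivative of \<open>sqnorm g\<close>, which replaces a study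
  of how \<open>K\<close> varies with the point.\<close>

lemma one_form_lee:
  assumes q: "q \<ge> 0"
  shows "one_form \<N> (lee p q)"
  unfolding one_form_def
proof (intro conjI ballI allI impI)
  fix z u v and a b :: real assume "u \<in> tangent \<N> z" "v \<in> tangent \<N> z"
  then show "lee p q z (a \<bullet>\<^sub>t u \<boxplus> b \<bullet>\<^sub>t v) = a * lee p q z u + b * lee p q z v"
    by (simp add: lee_def lam_linear(2) algebra_simps)
next
  fix W X z assume X: "smooth_field \<N> W X" and z: "z \<in> W"
  have zp: "z \<in> points \<N>" using nb.tangent_points[OF nb.smooth_field_tangent[OF X z]] .
  let ?h = "\<lambda>r. - (p / 2) * (1 + 1 * r) powr (- 1) + - (1 / 2) * conf_c q r"
  have inv: "smooth_on (conf_dom q) (\<lambda>r. (1 + 1 * r) powr (- 1))"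
    by (rule smooth_on_affine_powr[OF open_conf_dom]) (simp add: conf_dom_def)
  have "smooth_on (conf_dom q) ?h"
    by (rule smooth_on_add[OF open_conf_dom smooth_on_mult[OF open_conf_dom smooth_on_const[OF open_conf_dom] inv]
          smooth_on_mult[OF open_conf_dom smooth_on_const[OF open_conf_dom] smooth_on_conf_c]])
  from nb.smooth_near_compose[OF sqnorm_smooth_near[OF zp] open_conf_dom sqnorm_conf_dom[OF q zp] this]
  have "smooth_near \<N> z (\<lambda>y. ?h (sqnorm g y))" .
  from nb.smooth_near_mult[OF this nb.smooth_field_apply[OF X z sqnorm_smooth_near[OF zp]]]
  have near: "smooth_near \<N> z (\<lambda>y. ?h (sqnorm g y) * X y (sqnorm g))" .
  have eq: "lee p q y (X y) = (- (p / 2) * (1 + 1 * sqnorm g y) powr (- 1) + - (1 / 2) * conf_c q (sqnorm g y)) * X y (sqnorm g)"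
    if "y \<in> W" for y
  proof -
    note t = nb.smooth_field_tangent[OF X that]
    have "0 < 1 + sqnorm g y" using sqnorm_nonneg[OF nb.tangent_points[OF t]] by simp
    then show ?thesis unfolding lee_eq[OF t] by (simp add: powr_minus_divide)
  qed
  show "smooth_near \<N> z (\<lambda>y. lee p q y (X y))"
    by (rule nb.smooth_near_cong[OF nb.smooth_field_openin[OF X] z, THEN iffD2, OF eq near])
qed

lemma lee_form_lee:
  assumes q: "q \<ge> 0"
  shows "lee_form \<A> g L K p q (lee p q)"
  unfolding lee_form_def
proof (intro conjI ballI one_form_lee q)
  fix z assume "z \<in> points \<N>"
  then obtain C y u where C: "C \<in> slice_charts \<A> L" and y: "y \<in> fst C" "y \<in> L" and z: "z = (y, JE C u y)"
    by (rule points_normal_bundle)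
  show "lee p q z (hlift \<A> g L K z X) = 0" if "X \<in> tangent_sub \<A> L (fst z)" for X
  proof -
    obtain a where "X = E C y a" using \<open>X \<in> tangent_sub \<A> L (fst z)\<close> by (auto simp: z tangent_sub_E[OF C y])
    then show ?thesis by (simp add: z lee_def hlift_T[OF C y] forms_T[OF C y] G_simps[OF C y(1)])
  qed
  show "lee p q z (vlift \<A> g L K z \<xi>) = - (p * omega g z + q / (1 + sqrt (1 + q * sqnorm g z))) * g (fst z) \<xi> (snd z)"
    if "\<xi> \<in> nsub (fst z)" for \<xi>
  proof -
    obtain a where "\<xi> = JE C a y" using \<open>\<xi> \<in> nsub (fst z)\<close> by (auto simp: z normal_sub_JE[OF C y])
    then show ?thesis
      by (simp add: z lee_def csq_def vlift_T[OF C y] forms_T[OF C y] G_JE[OF C y(1)] linear_0[OF linear_\<Gamma>[OF C y]])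
  qed
qed

lemma ext_deriv2_eq_lee_form:
  assumes "q \<ge> 0" "lee_form \<A> g L K p q \<alpha>"
  shows "ext_deriv2_eq \<N> (\<Phi> p q) (wedge12 \<alpha> (\<Phi> p q))"
  unfolding ext_deriv2_eq_def
proof (intro allI impI ballI; elim conjE)
  fix W A B C z assume fields: "smooth_field \<N> W A" "smooth_field \<N> W B" "smooth_field \<N> W C" and z: "z \<in> W"
  show "ext_deriv2 \<N> (\<Phi> p q) A B C z =
      wedge12 \<alpha> (\<Phi> p q) z (A z) (B z) (C z)"
    unfolding ext_deriv2_fundamental_form[OF assms(1) fields z]
    by (simp add: wedge12_def lee_form_eq[OF assms(2)] nb.smooth_field_tangent[OF fields(1) z]
        nb.smooth_field_tangent[OF fields(2) z] nb.smooth_field_tangent[OF fields(3) z])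
qed

text \<open>Evaluate \<open>\<alpha> \<and> \<phi>\<close> at \<open>\<theta>\<^sup>v\<close>, \<open>(J e')\<^sup>v\<close>, \<open>(e')\<^sup>h\<close>, where \<open>\<theta> = J u\<close> with \<open>u\<close> a multiple of some \<open>e\<close>
  orthogonal to \<open>e'\<close>.\<close>
lemma almost_kaehler_imp_zero:
  assumes q: "q \<ge> 0" and L: "L \<noteq> {}" and dim: "DIM('e) \<ge> 2"
    and closed: "ext_deriv2_eq \<N> (\<Phi> p q) (\<lambda>z a b c. 0)"
  shows "p = 0 \<and> q = 0"
proof (rule lee_coefficient_zero[OF q])
  fix r :: real assume r: "r > 0"
  obtain y where y2: "y \<in> L" using L by blast
  obtain C where C: "C \<in> slice_charts \<A> L" and y1: "y \<in> fst C" using slice_chart_exists[OF y2] by blast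
  note y = y1 y2 and Gs = G_simps[OF C y1]
  obtain b b' :: 'e where b: "b \<in> Basis" "b' \<in> Basis" "b \<noteq> b'" by (rule DIM_ge_2_Basis[OF dim])
  have Gb: "G C y b b > 0" using b(1) by (intro G_pos[OF C y1]) auto
  \<comment> \<open>A Gram-Schmidt step in the metric at \<open>y\<close>, followed by scaling
    \<open>b\<close> so that the squared norm of \<theta> becomes the prescribed r.\<close>
  define e' where "e' = b' - (G C y b' b / G C y b b) *\<^sub>R b"
  define u where "u = sqrt (r / G C y b b) *\<^sub>R b"
  have e'b: "G C y e' b = 0" using Gb by (simp add: e'_def Gs)
  have "e' \<bullet> b' = 1" using b by (simp add: e'_def inner_diff_left inner_Basis)
  then have "e' \<noteq> 0" by auto
  then have Ge': "G C y e' e' > 0" by (rule G_pos[OF C y1])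
  have "sqrt (r / G C y b b) * sqrt (r / G C y b b) = r / G C y b b" using Gb r by simp
  then have "sqrt (r / G C y b b) * sqrt (r / G C y b b) * G C y b b = r" using Gb by simp
  moreover have "G C y u u = sqrt (r / G C y b b) * sqrt (r / G C y b b) * G C y b b"
    by (simp only: u_def Gs mult.assoc)
  ultimately have Gu: "G C y u u = r" "G C y e' u = 0" using e'b by (simp_all only: u_def Gs mult_zero_right)
  let ?z = "(y, JE C u y)" and ?\<phi> = "\<Phi> p q"
  \<comment> \<open>Closedness is tested on fields, so the three vectors are extended with constant
    coordinates in the bundle chart.\<close>
  define fld where "fld w = (\<lambda>z. chart_vec \<N> (NC C) z w)" for w
  have fld: "smooth_field \<N> (fst (NC C)) (fld w)" for w
    by (rule nb.smooth_fieldI[OF nb.openin_chart[OF NC_max[OF C]] order_refl NC_max[OF C], where w = "\<lambda>_. w"])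
      (simp_all add: fld_def smooth_on_const nb.open_chart_image[OF NC_max[OF C]])
  have fldz: "fld w ?z = T C y u w" for w by (simp add: fld_def T_def)
  let ?a = "(0, u)" and ?b = "(0, e')" and ?c = "(e', - \<Gamma> C y e' u)"
  note \<Gamma>0 = linear_0[OF linear_\<Gamma>[OF C y]]
  have "0 = wedge12 (lee p q) ?\<phi> ?z (fld ?a ?z) (fld ?b ?z) (fld ?c ?z)"
    using closed fld NC_facts(1)[OF C y, of u] ext_deriv2_fundamental_form[OF q fld fld fld NC_facts(1)[OF C y, of u]]
    unfolding ext_deriv2_eq_def by metis
  \<comment> \<open>The other two terms vanish: \<open>e'\<close> is orthogonal to \<open>u\<close>,
    and \<open>?c\<close> is a horizontal lift, so \<open>lee\<close> is 0 on both vectors.\<close>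
  also have "\<dots> = lee p q ?z (T C y u ?a) * ?\<phi> ?z (T C y u ?b) (T C y u ?c)"
    unfolding fldz wedge12_def
    by (simp add: lee_def forms_T[OF C y] \<Gamma>0 Gu Gs)
  also have "\<dots> = - (p / (1 + r) + q / (1 + sqrt (1 + q * r))) * r * (omega g ?z powr (p / 2) * G C y e' e')"
    by (simp add: lee_def forms_T[OF C y] fundamental_T[OF C y q] \<Gamma>0 Gu Gs omega_def csq_def)
  finally have "- (p / (1 + r) + q / (1 + sqrt (1 + q * r))) * r * (omega g ?z powr (p / 2) * G C y e' e') = 0" by simp
  moreover have "omega g ?z > 0" using r by (simp add: omega_def forms_T[OF C y] Gu)
  ultimately show "p / (1 + r) + q / (1 + sqrt (1 + q * r)) = 0" using r Ge' by (simp only: mult_eq_0_iff neg_equal_0_iff_equal) auto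
qed

lemma almost_kaehler_zero:
  "ext_deriv2_eq \<N> (\<Phi> 0 0) (\<lambda>z a b c. 0)"
  unfolding ext_deriv2_eq_def
proof (intro allI impI ballI; elim conjE)
  fix W A B C z assume fields: "smooth_field \<N> W A" "smooth_field \<N> W B" "smooth_field \<N> W C" and z: "z \<in> W"
  show "ext_deriv2 \<N> (\<Phi> 0 0) A B C z = 0"
    unfolding ext_deriv2_fundamental_form[OF order_refl fields z]
    by (simp add: wedge12_def lee_def csq_def)
qed

end

text \<open>Existence of \<alpha> is asserted on its own, so that the statement about all such
  \<alpha> is not vacuous. The equivalence is confined to k \<ge> 2: for k = 1 the total space is a
  surface, on which every 3-form is 0.\<close>

theorem theorem2:
  fixes \<A> :: "('m, 'e::euclidean_space \<times> 'e) atlas"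
    and g :: "'m \<Rightarrow> 'm tvec \<Rightarrow> 'm tvec \<Rightarrow> real"
    and J :: "'m \<Rightarrow> 'm tvec \<Rightarrow> 'm tvec"
    and nab :: "'m \<Rightarrow> 'm tvec \<Rightarrow> ('m \<Rightarrow> 'm tvec) \<Rightarrow> 'm tvec"
    and L :: "'m set"
    and K :: "'m \<times> 'm tvec \<Rightarrow> ('m \<times> 'm tvec) tvec \<Rightarrow> 'm tvec"
    and p q :: real
  assumes "q \<ge> 0"
    and "kaehler \<A> g J nab"
    and "submanifold \<A> L" and "L \<noteq> {}"
    and "totally_real \<A> g J L"
    and "totally_geodesic \<A> g nab L"
    and "connection_map \<A> g nab L K"
  shows "(\<exists>\<alpha>. lee_form \<A> g L K p q \<alpha>) \<and>
    (\<forall>\<alpha>. lee_form \<A> g L K p q \<alpha> \<longrightarrow>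
       ext_deriv2_eq (normal_bundle \<A> g L) (fundamental_form \<A> g J L K p q)
         (wedge12 \<alpha> (fundamental_form \<A> g J L K p q))) \<and>
    (DIM('e) \<ge> 2 \<longrightarrow>
       (ext_deriv2_eq (normal_bundle \<A> g L) (fundamental_form \<A> g J L K p q) (\<lambda>z a b c. 0)
        \<longleftrightarrow> p = 0 \<and> q = 0))"
proof -
  have "smooth_atlas \<A>" using assms(2) by (simp add: kaehler_def smooth_manifold_def)
  then interpret totally_real_geodesic \<A> L g J nab K
    by unfold_locales (use assms in auto)
  show ?thesis
    using lee_form_lee[OF assms(1)] ext_deriv2_eq_lee_form[OF assms(1)]
      almost_kaehler_imp_zero[OF assms(1) assms(4)] almost_kaehler_zero by blast
qed

end
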